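(* Let $m>1$, $m\ge N\ge1$, $p>0$, $q,\mu\in\mathbb{R}$ and $\alpha\in(0,N)$. Then the inequality $$-\Delta_m u-\frac{\mu}{|x|^m}u^{m-1}\ge (I_\alpha*u^p)u^q\quad\text{in }\mathbb{R}^N\setminus\overline{B}_1 \tag{P}$$ has a positive solution if and only if all of the following hold: (i) $\mu<0$; (ii) $p>\frac{\alpha}{|\beta^-|}$; (iii) $p+q>m-1+\frac{m+\alpha}{|\beta^-|}$; (iv) $q>m-1-\frac{N-m-\alpha}{|\beta^-|}$. (Under (i), $\beta^\pm$ are well defined and $\beta^-<0<\beta^+$.)
   Context: $B_r$ denotes the open ball of radius $r$ centered at the origin in $\mathbb{R}^N$. $\Delta_m u=\operatorname{div}(|\nabla u|^{m-2}\nabla u)$. For $\alpha\in(0,N)$, $I_\alpha(x)=A_\alpha|x|^{\alpha-N}$ with $A_\alpha=\frac{\Gamma((N-\alpha)/2)}{\Gamma(\alpha/2)\pi^{N/2}2^\alpha}$, and $(I_\alpha*g)(x)=\int_{\mathbb{R}^N\setminus\overline B_1}I_\alpha(x-y)g(y)\,dy$. A positive solution of (P) is a function $u\in W^{1,m}_{loc}(\mathbb{R}^N\setminus\overline B_1)\cap C(\mathbb{R}^N\setminus\overline B_1)$ such that: $u>0$ and $(I_\alpha*u^p)u^q\in L^1_{loc}(\mathbb{R}^N\setminus\overline B_1)$; $\int_{\mathbb{R}^N\setminus\overline B_1}\frac{u^p(y)}{1+|y|^{N-\alpha}}dy<\infty$; and for every $\phi\in C_c^\infty(\mathbb{R}^N\setminus\overline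 B_1)$ with $\phi\ge0$, $\int_{\mathbb{R}^N\setminus\overline B_1}\big(|\nabla u|^{m-2}\nabla u\cdot\nabla\phi-\frac{\mu}{|x|^m}u^{m-1}\phi\big)\ge\int_{\mathbb{R}^N\setminus\overline B_1}(I_\alpha*u^p)u^q\phi$. $C_H=\left|\frac{N-m}{m}\right|^m$. Let $G(\beta)=-\beta|\beta|^{m-2}(\beta(m-1)+N-m)$. For $\mu\le C_H$, $\{\beta:G(\beta)\ge\mu\}=[\beta^-,\beta^+]$, where $\beta^-\le\beta^+$ are the real solutions of $G(\beta)=\mu$. *)

theory Defs
  imports "HOL-Analysis.Analysis"
begin

definition ext_dom :: "'a::euclidean_space set" where
  "ext_dom = - cball 0 1"

fun Ck :: "nat \<Rightarrow> ('a::euclidean_space \<Rightarrow> real) \<Rightarrow> bool" where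
  "Ck 0 f = continuous_on UNIV f"
| "Ck (Suc k) f = (continuous_on UNIV f \<and> (\<forall>x. f differentiable (at x)) \<and>
      (\<forall>b\<in>Basis. Ck k (\<lambda>x. frechet_derivative f (at x) b)))"

definition smooth_fun :: "('a::euclidean_space \<Rightarrow> real) \<Rightarrow> bool" where
  "smooth_fun f \<longleftrightarrow> (\<forall>k. Ck k f)"

definition tsupport :: "('a::euclidean_space \<Rightarrow> real) \<Rightarrow> 'a set" where
  "tsupport f = closure {x. f x \<noteq> 0}"

definition test_fun :: "'a::euclidean_space set \<Rightarrow> ('a \<Rightarrow> real) \<Rightarrow> bool" where
  "test_fun \<Omega> \<phi> \<longleftrightarrow> smooth_fun \<phi> \<and> compact (tsupport \<phi>) \<and> tsupport \<phi> \<subseteq> \<Omega>"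

definition grad :: "('a::euclidean_space \<Rightarrow> real) \<Rightarrow> 'a \<Rightarrow> 'a" where
  "grad f x = (\<Sum>b\<in>Basis. frechet_derivative f (at x) b *\<^sub>R b)"

definition Lloc :: "real \<Rightarrow> 'a::euclidean_space set \<Rightarrow> ('a \<Rightarrow> real) \<Rightarrow> bool" where
  "Lloc r \<Omega> f \<longleftrightarrow> (\<forall>K. compact K \<and> K \<subseteq> \<Omega> \<longrightarrow>
      set_integrable lebesgue K f \<and> set_integrable lebesgue K (\<lambda>x. \<bar>f x\<bar> powr r))"

definition weak_grad :: "'a::euclidean_space set \<Rightarrow> ('a \<Rightarrow> real) \<Rightarrow> ('a \<Rightarrow> 'a) \<Rightarrow> bool" where
  "weak_grad \<Omega> u Du \<longleftrightarrow> set_borel_measurable lebesgue \<Omega> Du \<and>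
     Lloc 1 \<Omega> u \<and> Lloc 1 \<Omega> (\<lambda>x. norm (Du x)) \<and>
     (\<forall>\<phi>. test_fun \<Omega> \<phi> \<longrightarrow> (\<forall>b\<in>Basis.
        (LINT x:\<Omega>|lebesgue. u x * frechet_derivative \<phi> (at x) b)
          = - (LINT x:\<Omega>|lebesgue. (Du x \<bullet> b) * \<phi> x)))"

definition W1loc :: "real \<Rightarrow> 'a::euclidean_space set \<Rightarrow> ('a \<Rightarrow> real) \<Rightarrow> ('a \<Rightarrow> 'a) \<Rightarrow> bool" where
  "W1loc m \<Omega> u Du \<longleftrightarrow> weak_grad \<Omega> u Du \<and> Lloc m \<Omega> u \<and> Lloc m \<Omega> (\<lambda>x. norm (Du x))"

definition riesz_const :: "nat \<Rightarrow> real \<Rightarrow> real" where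
  "riesz_const N \<alpha> = Gamma ((real N - \<alpha>) / 2) / (Gamma (\<alpha> / 2) * pi powr (real N / 2) * 2 powr \<alpha>)"

definition riesz_kernel :: "real \<Rightarrow> 'a::euclidean_space \<Rightarrow> real" where
  "riesz_kernel \<alpha> x = riesz_const DIM('a) \<alpha> * norm x powr (\<alpha> - real DIM('a))"

definition riesz_conv :: "real \<Rightarrow> ('a::euclidean_space \<Rightarrow> real) \<Rightarrow> 'a \<Rightarrow> ennreal" where
  "riesz_conv \<alpha> g x = (\<integral>\<^sup>+ y. indicator ext_dom y * ennreal (riesz_kernel \<alpha> (x - y) * g y) \<partial>lebesgue)"

definition pos_solution :: "real \<Rightarrow> real \<Rightarrow> real \<Rightarrow> real \<Rightarrow> real \<Rightarrow> ('a::euclidean_space \<Rightarrow> real) \<Rightarrow> bool" where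
  "pos_solution m \<mu> p q \<alpha> u \<longleftrightarrow>
     continuous_on ext_dom u \<and> (\<forall>x\<in>ext_dom. u x > 0) \<and>
     (\<exists>Du. W1loc m ext_dom u Du \<and>
       (\<forall>K. compact K \<and> K \<subseteq> ext_dom \<longrightarrow>
          (\<integral>\<^sup>+ x. indicator K x * riesz_conv \<alpha> (\<lambda>y. u y powr p) x * ennreal (u x powr q) \<partial>lebesgue) < \<infinity>) \<and>
       (\<integral>\<^sup>+ y. indicator ext_dom y * ennreal (u y powr p / (1 + norm y powr (real DIM('a) - \<alpha>))) \<partial>lebesgue) < \<infinity> \<and>
       (\<forall>\<phi>. test_fun ext_dom \<phi> \<and> (\<forall>x. \<phi> x \<ge> 0) \<longrightarrow>
          (LINT x:ext_dom|lebesgue. norm (Du x) powr (m - 2) * (Du x \<bullet> grad \<phi> x)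
               - \<mu> / norm x powr m * u x powr (m - 1) * \<phi> x)
          \<ge> enn2real (\<integral>\<^sup>+ x. indicator ext_dom x * riesz_conv \<alpha> (\<lambda>y. u y powr p) x
                              * ennreal (u x powr q * \<phi> x) \<partial>lebesgue)))"

definition Gfun :: "real \<Rightarrow> nat \<Rightarrow> real \<Rightarrow> real" where
  "Gfun m N \<beta> = - \<beta> * \<bar>\<beta>\<bar> powr (m - 2) * (\<beta> * (m - 1) + real N - m)"

text \<open>beta^- = left endpoint of {beta. G(beta) >= mu} = [beta^-, beta^+].\<close>
definition beta_minus :: "real \<Rightarrow> nat \<Rightarrow> real \<Rightarrow> real" where
  "beta_minus m N \<mu> = Inf {\<beta>. Gfun m N \<beta> \<ge> \<mu>}"

end

theory Submission
  imports Defs "HOL-Real_Asymp.Real_Asymp"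
begin

text \<open>
  Put \<open>K(b) = - G(-b)\<close>, so that \<open>|\<beta>\<^sup>-| = b\<close> is the root of \<open>K(b) = - \<mu>\<close> when \<open>\<mu> < 0\<close>; the power
  \<open>|x| powr (-b)\<close> solves \<open>-\<Delta>\<^sub>m w + K(b) |x| powr (-m) w powr (m-1) = 0\<close>.

  Necessity. If \<open>u\<close> is a supersolution of this equation near infinity, comparison with
  \<open>c |x| powr (-b) - \<epsilon>\<close> gives \<open>u \<ge> c |x| powr (-b)\<close>, and then integrability of
  \<open>u powr p / |y| powr (N-\<alpha>)\<close> forces \<open>p b > \<alpha>\<close>. Hence the Hardy constant of a supersolution
  must exceed \<open>K(\<alpha>/p) > 0\<close>, which yields (i) and (ii). The nonlocal term is at least a multiple
  of \<open>|x| powr (-s) u powr q\<close> with \<open>s = N - \<alpha>\<close> and with \<open>s = p b - \<alpha>\<close>. If (iii) or (iv) fails, it absorbs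
  a positive part of the Hardy term; comparison then improves the decay of \<open>u\<close>, the nonlocal
  term dominates every multiple of the Hardy term, and every Hardy constant becomes admissible,
  a contradiction. The comparison only uses points where \<open>u < 1\<close>, so \<open>q \<le> m - 1\<close> needs no
  upper bound on \<open>u\<close>.

  Sufficiency. For \<open>\<gamma> < b\<close> close to \<open>b\<close> and suitable \<open>c\<close>, \<open>c |x| powr (-\<gamma>)\<close> is a solution.
\<close>

section \<open>Smooth functions\<close>

lemma grad_inner_Basis: "b \<in> Basis \<Longrightarrow> grad f x \<bullet> b = frechet_derivative f (at x) b"
  by (simp add: grad_def inner_sum_left inner_Basis if_distrib cong: if_cong)

lemma GDERIV_imp_grad_eq:
  assumes "GDERIV f x :> g"
  shows "grad f x = g"
proof -
  have "frechet_derivative f (at x) = (\<lambda>h. h \<bullet> g)"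
    using frechet_derivative_at[OF assms[unfolded gderiv_def]] by simp
  then show ?thesis
    by (simp add: grad_def inner_commute[of _ g] euclidean_representation)
qed

lemma differentiable_imp_GDERIV_grad:
  assumes "f differentiable (at x)"
  shows "GDERIV f x :> grad f x"
proof -
  have deriv: "(f has_derivative frechet_derivative f (at x)) (at x)"
    using assms frechet_derivative_works by blast
  then have linear_deriv: "linear (frechet_derivative f (at x))"
    by (rule has_derivative_linear)
  have "frechet_derivative f (at x) h = h \<bullet> grad f x" for h
  proof -
    have "frechet_derivative f (at x) h = frechet_derivative f (at x) (\<Sum>b\<in>Basis. (h \<bullet> b) *\<^sub>R b)"
      by (simp add: euclidean_representation)
    also have "\<dots> = h \<bullet> grad f x"
      by (simp add: linear_sum[OF linear_deriv] linear_cmul[OF linear_deriv] grad_def inner_sum_right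
        mult.commute)
    finally show ?thesis .
  qed
  then have "frechet_derivative f (at x) = (\<lambda>h. h \<bullet> grad f x)" by (rule ext)
  with deriv show ?thesis by (simp add: gderiv_def)
qed

lemma GDERIV_transform_within_open:
  "GDERIV f x :> g \<Longrightarrow> open S \<Longrightarrow> x \<in> S \<Longrightarrow> (\<And>y. y \<in> S \<Longrightarrow> f y = h y) \<Longrightarrow> GDERIV h x :> g"
  unfolding gderiv_def by (rule has_derivative_transform_within_open)

lemma GDERIV_translate:
  assumes "GDERIV f (x + a) :> g"
  shows "GDERIV (\<lambda>x. f (x + a)) x :> g"
proof -
  have "((\<lambda>x. x + a) has_derivative (\<lambda>h. h)) (at x)"
    by (auto intro!: derivative_eq_intros)
  from has_derivative_compose[OF this assms[unfolded gderiv_def]] show ?thesis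
    by (simp add: gderiv_def)
qed

lemma GDERIV_imp_continuous_on:
  assumes "\<And>x. x \<in> S \<Longrightarrow> GDERIV f x :> g x"
  shows "continuous_on S f"
proof (intro continuous_at_imp_continuous_on ballI)
  fix x assume "x \<in> S"
  from assms[OF this] show "isCont f x"
    unfolding gderiv_def by (rule has_derivative_continuous)
qed

fun Ck_on :: "nat \<Rightarrow> 'a::euclidean_space set \<Rightarrow> ('a \<Rightarrow> real) \<Rightarrow> bool" where
  "Ck_on 0 S f = continuous_on S f"
| "Ck_on (Suc k) S f = (continuous_on S f \<and> (\<forall>x\<in>S. f differentiable (at x)) \<and>
      (\<forall>b\<in>Basis. Ck_on k S (\<lambda>x. frechet_derivative f (at x) b)))"

lemma Ck_on_UNIV: "Ck_on k UNIV f \<longleftrightarrow> Ck k f"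
  by (induction k arbitrary: f) auto

lemma Ck_on_imp_continuous_on: "Ck_on k S f \<Longrightarrow> continuous_on S f"
  by (cases k) auto

lemma Ck_on_subset: "Ck_on k S f \<Longrightarrow> T \<subseteq> S \<Longrightarrow> Ck_on k T f"
  by (induction k arbitrary: f) (auto intro: continuous_on_subset)

lemma Ck_on_SucD: "Ck_on (Suc k) S f \<Longrightarrow> Ck_on k S f"
  by (induction k arbitrary: f) auto

lemma Ck_on_Suc_imp_GDERIV: "Ck_on (Suc k) S f \<Longrightarrow> x \<in> S \<Longrightarrow> GDERIV f x :> grad f x"
  by (simp add: differentiable_imp_GDERIV_grad)

lemma Ck_on_grad: "Ck_on (Suc k) S f \<Longrightarrow> b \<in> Basis \<Longrightarrow> Ck_on k S (\<lambda>x. grad f x \<bullet> b)"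
  by (simp add: grad_inner_Basis)

lemma Ck_on_cong_imp:
  assumes "open S" "\<And>x. x \<in> S \<Longrightarrow> f x = g x" "Ck_on k S f"
  shows "Ck_on k S g"
  using assms(2,3)
proof (induction k arbitrary: f g)
  case 0
  then show ?case by (simp cong: continuous_on_cong)
next
  case (Suc k)
  have deriv: "(g has_derivative frechet_derivative f (at x)) (at x)" if "x \<in> S" for x
  proof (rule has_derivative_transform_within_open[OF _ assms(1) that])
    show "(f has_derivative frechet_derivative f (at x)) (at x)"
      using Suc.prems(2) that by (simp add: frechet_derivative_works[symmetric])
  qed (rule Suc.prems(1))
  have "frechet_derivative f (at x) = frechet_derivative g (at x)" if "x \<in> S" for x
    using frechet_derivative_at[OF deriv[OF that]] .
  then have deriv_eq: "frechet_derivative f (at x) b = frechet_derivative g (at x) b" if "x \<in> S" for x b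
    using that by simp
  have "Ck_on k S (\<lambda>x. frechet_derivative g (at x) b)" if "b \<in> Basis" for b
    by (rule Suc.IH[of "\<lambda>x. frechet_derivative f (at x) b"]) (use deriv_eq Suc.prems(2) that in auto)
  moreover have "continuous_on S g"
    using Suc.prems by (simp cong: continuous_on_cong)
  ultimately show ?case
    using deriv by (auto simp: differentiable_def)
qed

lemma Ck_on_local:
  assumes "\<And>x. x \<in> S \<Longrightarrow> \<exists>T. open T \<and> x \<in> T \<and> Ck_on k T f"
  shows "Ck_on k S f"
proof -
  have cont: "continuous_on S f" if "\<And>x. x \<in> S \<Longrightarrow> \<exists>T. open T \<and> x \<in> T \<and> Ck_on k T f" for k f
  proof (intro continuous_at_imp_continuous_on ballI)
    fix x assume "x \<in> S"
    from that[OF this] obtain T where "open T" "x \<in> T" "Ck_on k T f" by blast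
    then show "isCont f x"
      using Ck_on_imp_continuous_on[of k T f] by (simp add: continuous_on_eq_continuous_at)
  qed
  show ?thesis
    using assms
  proof (induction k arbitrary: f)
    case 0
    then show ?case by (simp add: cont[of 0])
  next
    case (Suc k)
    have "f differentiable at x" if "x \<in> S" for x
      using Suc.prems[OF that] by auto
    moreover have "Ck_on k S (\<lambda>x. frechet_derivative f (at x) b)" if "b \<in> Basis" for b
    proof (rule Suc.IH)
      fix x assume "x \<in> S"
      from Suc.prems[OF this] that
      show "\<exists>T. open T \<and> x \<in> T \<and> Ck_on k T (\<lambda>x. frechet_derivative f (at x) b)" by auto
    qed
    ultimately show ?case using cont[OF Suc.prems] by simp
  qed
qed

lemma Ck_on_SucI:
  assumes "open S" "\<And>x. x \<in> S \<Longrightarrow> GDERIV f x :> g x"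
    and "\<And>b. b \<in> Basis \<Longrightarrow> Ck_on k S (\<lambda>x. g x \<bullet> b)"
  shows "Ck_on (Suc k) S f"
proof -
  have "frechet_derivative f (at x) b = g x \<bullet> b" if "x \<in> S" "b \<in> Basis" for x b
    using GDERIV_imp_grad_eq[OF assms(2)] grad_inner_Basis that by metis
  then have "Ck_on k S (\<lambda>x. frechet_derivative f (at x) b)" if "b \<in> Basis" for b
    using Ck_on_cong_imp[OF assms(1) _ assms(3)[OF that]] that by simp
  moreover have "continuous_on S f"
    using assms(2) by (rule GDERIV_imp_continuous_on)
  moreover have "\<forall>x\<in>S. f differentiable (at x)"
    using assms(2) by (auto simp: gderiv_def differentiable_def)
  ultimately show ?thesis by simp
qed

lemma Ck_on_const: "open S \<Longrightarrow> Ck_on k S (\<lambda>x. c)"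
proof (induction k arbitrary: c)
  case (Suc k)
  show ?case
    by (rule Ck_on_SucI[where g="\<lambda>_. 0"]) (use Suc in \<open>auto intro: GDERIV_const\<close>)
qed auto

lemma Ck_on_inner: "open S \<Longrightarrow> Ck_on k S (\<lambda>x. x \<bullet> v)"
proof (cases k)
  case (Suc j)
  assume "open S"
  then show ?thesis
    unfolding Suc
    by (intro Ck_on_SucI[where g="\<lambda>_. v"])
       (auto simp: gderiv_def intro!: derivative_eq_intros Ck_on_const)
qed (auto intro!: continuous_intros)

lemma Ck_on_add:
  "open S \<Longrightarrow> Ck_on k S f \<Longrightarrow> Ck_on k S g \<Longrightarrow> Ck_on k S (\<lambda>x. f x + g x)"
proof (induction k arbitrary: f g)
  case (Suc k)
  show ?case
  proof (rule Ck_on_SucI[OF Suc.prems(1)])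
    show "GDERIV (\<lambda>x. f x + g x) x :> grad f x + grad g x" if "x \<in> S" for x
      using that Suc.prems(2,3) by (intro GDERIV_add Ck_on_Suc_imp_GDERIV)
    show "Ck_on k S (\<lambda>x. (grad f x + grad g x) \<bullet> b)" if "b \<in> Basis" for b
      using that Suc.prems unfolding inner_add_left by (intro Suc.IH Ck_on_grad)
  qed
qed (auto intro: continuous_on_add)

lemma Ck_on_sum:
  "open S \<Longrightarrow> (\<And>i. i \<in> I \<Longrightarrow> Ck_on k S (f i)) \<Longrightarrow> Ck_on k S (\<lambda>x. \<Sum>i\<in>I. f i x)"
  by (induction I rule: infinite_finite_induct) (auto intro: Ck_on_const Ck_on_add)

lemma Ck_on_mult:
  "open S \<Longrightarrow> Ck_on k S f \<Longrightarrow> Ck_on k S g \<Longrightarrow> Ck_on k S (\<lambda>x. f x * g x)"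
proof (induction k arbitrary: f g)
  case (Suc k)
  show ?case
  proof (rule Ck_on_SucI[OF Suc.prems(1)])
    show "GDERIV (\<lambda>x. f x * g x) x :> f x *\<^sub>R grad g x + g x *\<^sub>R grad f x" if "x \<in> S" for x
      using that Suc.prems(2,3) by (intro GDERIV_mult Ck_on_Suc_imp_GDERIV)
    show "Ck_on k S (\<lambda>x. (f x *\<^sub>R grad g x + g x *\<^sub>R grad f x) \<bullet> b)" if "b \<in> Basis" for b
      using Ck_on_grad[OF Suc.prems(2) that] Ck_on_grad[OF Suc.prems(3) that]
        Ck_on_SucD[OF Suc.prems(2)] Ck_on_SucD[OF Suc.prems(3)] Suc.prems(1)
      unfolding inner_add_left inner_scaleR_left by (intro Ck_on_add Suc.IH)
  qed
qed (auto intro: continuous_on_mult)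

lemma Ck_on_minus: "open S \<Longrightarrow> Ck_on k S f \<Longrightarrow> Ck_on k S (\<lambda>x. - f x)"
  using Ck_on_mult[OF _ Ck_on_const[of S k "-1"]] by simp

lemma Ck_on_diff:
  "open S \<Longrightarrow> Ck_on k S f \<Longrightarrow> Ck_on k S g \<Longrightarrow> Ck_on k S (\<lambda>x. f x - g x)"
  using Ck_on_add[OF _ _ Ck_on_minus, of S k f g] by simp

lemma Ck_on_real_SucI:
  fixes f :: "real \<Rightarrow> real"
  assumes "open S" "\<And>x. x \<in> S \<Longrightarrow> (f has_real_derivative g x) (at x)" "Ck_on k S g"
  shows "Ck_on (Suc k) S f"
  by (rule Ck_on_SucI[where g=g]) (use assms in auto)

lemma Ck_on_compose:
  fixes F :: "real \<Rightarrow> real"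
  assumes "open S" "open T" "f ` S \<subseteq> T"
  shows "Ck_on k T F \<Longrightarrow> Ck_on k S f \<Longrightarrow> Ck_on k S (\<lambda>x. F (f x))"
proof (induction k arbitrary: F)
  case 0
  then show ?case using assms by (auto intro: continuous_on_compose2)
next
  case (Suc k)
  have deriv: "(F has_real_derivative grad F (f x)) (at (f x))" if "x \<in> S" for x
    using Ck_on_Suc_imp_GDERIV[OF Suc.prems(1)] assms(3) that by auto
  have "Ck_on k S (\<lambda>x. grad F (f x))"
    using Suc.IH[of "grad F"] Ck_on_grad[OF Suc.prems(1)] Ck_on_SucD[OF Suc.prems(2)] by simp
  then have "Ck_on k S (\<lambda>x. (grad F (f x) *\<^sub>R grad f x) \<bullet> b)" if "b \<in> Basis" for b
    unfolding inner_scaleR_left using assms(1) Suc.prems(2) that by (intro Ck_on_mult Ck_on_grad)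
  moreover have "GDERIV (\<lambda>x. F (f x)) x :> grad F (f x) *\<^sub>R grad f x" if "x \<in> S" for x
    using that Suc.prems(2) deriv by (intro GDERIV_DERIV_compose Ck_on_Suc_imp_GDERIV)
  ultimately show ?case
    by (rule Ck_on_SucI[OF assms(1), rotated])
qed

lemma Ck_on_translate:
  fixes f :: "'a::euclidean_space \<Rightarrow> real"
  shows "Ck_on k UNIV f \<Longrightarrow> Ck_on k UNIV (\<lambda>x. f (x + a))"
proof (induction k arbitrary: f)
  case 0
  then show ?case by (auto intro!: continuous_on_compose2[of UNIV f] continuous_intros)
next
  case (Suc k)
  show ?case
  proof (rule Ck_on_SucI)
    show "GDERIV (\<lambda>x. f (x + a)) x :> grad f (x + a)" for x
      using Suc.prems by (intro GDERIV_translate Ck_on_Suc_imp_GDERIV) auto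
  qed (use Suc.IH[OF Ck_on_grad[OF Suc.prems]] in auto)
qed

lemma Ck_on_powr: "Ck_on k {0<..} (\<lambda>t::real. t powr a)"
proof (induction k arbitrary: a)
  case (Suc k)
  have "Ck_on k {0<..} (\<lambda>t::real. a * t powr (a - 1))"
    using Suc by (intro Ck_on_mult Ck_on_const) auto
  then show ?case
    by (rule Ck_on_real_SucI[OF open_greaterThan, rotated])
       (auto intro!: derivative_eq_intros simp: powr_diff field_simps)
qed (auto intro!: continuous_intros)

lemma Ck_on_inner_self: "Ck_on k UNIV (\<lambda>x::'a::euclidean_space. x \<bullet> x)"
  unfolding euclidean_inner[of x x for x :: 'a] by (intro Ck_on_sum Ck_on_mult Ck_on_inner) auto

lemma Ck_on_norm_powr: "Ck_on k (- {0}) (\<lambda>x::'a::euclidean_space. norm x powr a)"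
proof (rule Ck_on_cong_imp)
  show "(x \<bullet> x) powr (a / 2) = norm x powr a" if "x \<in> - {0}" for x :: 'a
    using that by (simp add: norm_eq_sqrt_inner powr_half_sqrt[symmetric] powr_powr)
  show "Ck_on k (- {0}) (\<lambda>x::'a. (x \<bullet> x) powr (a / 2))"
    by (rule Ck_on_compose[OF _ _ _ Ck_on_powr Ck_on_subset[OF Ck_on_inner_self]]) auto
qed auto

definition flat_exp :: "nat \<Rightarrow> real \<Rightarrow> real" where
  "flat_exp j t = (if t > 0 then exp (- 1 / t) / t ^ j else 0)"

lemma flat_exp_nonneg: "flat_exp j t \<ge> 0"
  by (simp add: flat_exp_def)

lemma flat_exp_pos: "t > 0 \<Longrightarrow> flat_exp j t > 0"
  by (simp add: flat_exp_def)

lemma flat_exp_eq_0: "t \<le> 0 \<Longrightarrow> flat_exp j t = 0"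
  by (simp add: flat_exp_def)

lemma flat_exp_0_mono: "s \<le> t \<Longrightarrow> flat_exp 0 s \<le> flat_exp 0 t"
  by (auto simp: flat_exp_def frac_le)

lemma flat_exp_has_derivative_at_0: "(flat_exp j has_real_derivative 0) (at 0)"
proof -
  have "((\<lambda>h. flat_exp j h / h) \<longlongrightarrow> 0) (at_left 0)"
    by (rule Lim_transform_eventually[OF tendsto_const])
       (auto simp: flat_exp_def eventually_at_left_field intro!: exI[of _ "-1"])
  moreover have "((\<lambda>h. flat_exp j h / h) \<longlongrightarrow> 0) (at_right 0)"
  proof (rule Lim_transform_eventually)
    show "((\<lambda>h::real. exp (- 1 / h) / h ^ j / h) \<longlongrightarrow> 0) (at_right 0)" by real_asymp
  qed (auto simp: flat_exp_def eventually_at_right_field intro!: exI[of _ 1])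
  ultimately have "((\<lambda>h. flat_exp j h / h) \<longlongrightarrow> 0) (at 0)"
    by (simp add: filterlim_split_at)
  then show ?thesis
    by (simp add: has_field_derivative_iff flat_exp_def)
qed

lemma exp_minus_inverse_has_derivative:
  fixes t :: real
  assumes "t > 0"
  shows "((\<lambda>t. exp (- 1 / t) / t ^ j) has_real_derivative
      exp (- 1 / t) / t ^ (j + 2) - real j * (exp (- 1 / t) / t ^ (j + 1))) (at t)"
proof -
  have deriv_exp: "((\<lambda>t. exp (- 1 / t)) has_real_derivative exp (- 1 / t) / t\<^sup>2) (at t)"
    using assms by (auto intro!: derivative_eq_intros simp: power2_eq_square)
  have "real j * t ^ (j - Suc 0) = real j * t ^ j / t"
    using assms by (cases j) auto
  with assms show ?thesis
    by (intro DERIV_cong[OF DERIV_divide[OF deriv_exp DERIV_pow]])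
       (simp_all, simp add: field_simps power2_eq_square)
qed

lemma flat_exp_has_derivative:
  "(flat_exp j has_real_derivative flat_exp (j + 2) t - real j * flat_exp (j + 1) t) (at t)"
proof -
  consider "t < 0" | "t = 0" | "t > 0" by linarith
  then show ?thesis
  proof cases
    case 1
    have "(flat_exp j has_real_derivative 0) (at t)"
      by (rule has_field_derivative_transform_within_open[OF DERIV_const, where S="{..<0}"])
         (use 1 in \<open>auto simp: flat_exp_def\<close>)
    with 1 show ?thesis by (simp add: flat_exp_def)
  next
    case 2
    then show ?thesis using flat_exp_has_derivative_at_0 by (simp add: flat_exp_def)
  next
    case 3
    have "(flat_exp j has_real_derivative
        exp (- 1 / t) / t ^ (j + 2) - real j * (exp (- 1 / t) / t ^ (j + 1))) (at t)"
      by (rule has_field_derivative_transform_within_open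
          [OF exp_minus_inverse_has_derivative[OF 3], where S="{0<..}"])
         (use 3 in \<open>auto simp: flat_exp_def\<close>)
    with 3 show ?thesis by (simp add: flat_exp_def)
  qed
qed

lemma Ck_on_flat_exp: "Ck_on k UNIV (flat_exp j)"
proof (induction k arbitrary: j)
  case 0
  show ?case
    using DERIV_isCont[OF flat_exp_has_derivative] by (auto intro!: continuous_at_imp_continuous_on)
next
  case (Suc k)
  show ?case
    by (rule Ck_on_real_SucI[OF _ flat_exp_has_derivative])
       (auto intro!: Ck_on_diff Ck_on_mult Ck_on_const Suc)
qed

lemma smooth_fun_iff_Ck_on: "smooth_fun f \<longleftrightarrow> (\<forall>k. Ck_on k UNIV f)"
  by (simp add: smooth_fun_def Ck_on_UNIV)

lemma smooth_fun_imp_continuous_on: "smooth_fun f \<Longrightarrow> continuous_on S f"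
  by (metis Ck_on_imp_continuous_on Ck_on_subset smooth_fun_iff_Ck_on subset_UNIV)

lemma smooth_fun_GDERIV: "smooth_fun f \<Longrightarrow> GDERIV f x :> grad f x"
  using Ck_on_Suc_imp_GDERIV smooth_fun_iff_Ck_on by blast

lemma smooth_fun_grad: "smooth_fun f \<Longrightarrow> b \<in> Basis \<Longrightarrow> smooth_fun (\<lambda>x. grad f x \<bullet> b)"
  using Ck_on_grad smooth_fun_iff_Ck_on by blast

lemma smooth_fun_continuous_on_grad:
  assumes "smooth_fun f"
  shows "continuous_on S (grad f)"
  using smooth_fun_imp_continuous_on[OF smooth_fun_grad[OF assms]] by (subst continuous_on_componentwise) auto

section \<open>Integration by parts\<close>

lemma integrable_compact_support:
  fixes f :: "'a::euclidean_space \<Rightarrow> 'b::{banach,second_countable_topology}"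
  assumes "compact K" "continuous_on K f" "\<And>x. x \<notin> K \<Longrightarrow> f x = 0"
  shows "integrable lborel f"
proof -
  have "(\<lambda>x. indicator K x *\<^sub>R f x) = f"
    using assms(3) by (auto simp: indicator_def)
  then show ?thesis
    using borel_integrable_compact[OF assms(1,2)] by simp
qed

lemma
  fixes f :: "'a::euclidean_space \<Rightarrow> 'b::{banach,second_countable_topology}"
  assumes "compact K" "K \<subseteq> \<Omega>" "continuous_on K f" "\<And>x. x \<notin> K \<Longrightarrow> f x = 0"
  shows set_integrable_compact_support: "set_integrable lebesgue \<Omega> f"
    and set_lebesgue_integral_compact_support: "(LINT x:\<Omega>|lebesgue. f x) = integral\<^sup>L lborel f"
proof -
  have "(\<lambda>x. indicator \<Omega> x *\<^sub>R f x) = f"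
    using assms(2,4) by (auto simp: indicator_def fun_eq_iff)
  moreover have "integrable lborel f"
    using assms(1,3,4) by (rule integrable_compact_support)
  moreover from this have "f \<in> borel_measurable lborel" by simp
  ultimately show "set_integrable lebesgue \<Omega> f" "(LINT x:\<Omega>|lebesgue. f x) = integral\<^sup>L lborel f"
    by (simp_all add: set_integrable_def integrable_completion set_lebesgue_integral_def integral_completion)
qed

lemma set_integrable_continuous_compact:
  fixes f :: "'a::euclidean_space \<Rightarrow> 'b::{banach,second_countable_topology}"
  assumes "compact K" "continuous_on K f"
  shows "set_integrable lebesgue K f"
proof -
  have "integrable lborel (\<lambda>x. indicator K x *\<^sub>R f x)"
    using assms by (rule borel_integrable_compact)
  moreover from this have "(\<lambda>x. indicator K x *\<^sub>R f x) \<in> borel_measurable lborel" by simp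
  ultimately show ?thesis by (simp add: set_integrable_def integrable_completion)
qed

lemma integral_cbox_eq_lborel:
  fixes f :: "'a::euclidean_space \<Rightarrow> 'b::euclidean_space"
  assumes "continuous_on UNIV f" "\<And>x. x \<notin> cbox a c \<Longrightarrow> f x = 0"
  shows "integral (cbox a c) f = integral\<^sup>L lborel f"
proof -
  have "integrable lborel f"
    by (rule integrable_compact_support[of "cbox a c"])
       (use assms in \<open>auto intro: continuous_on_subset\<close>)
  then have "(f has_integral integral\<^sup>L lborel f) UNIV"
    by (rule has_integral_integral_lborel)
  moreover have "(f has_integral integral (cbox a c) f) UNIV"
    by (rule has_integral_on_superset[OF integrable_integral[OF integrable_continuous]])
       (use assms in \<open>auto intro: continuous_on_subset\<close>)
  ultimately show ?thesis by (rule has_integral_unique[symmetric])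
qed

lemma lborel_integral_translate:
  fixes f :: "'a::euclidean_space \<Rightarrow> 'b::{banach,second_countable_topology}"
  assumes "f \<in> borel_measurable borel"
  shows "(\<integral>x. f (x + v) \<partial>lborel) = integral\<^sup>L lborel f"
  using integral_distr[of "(+) v" lborel borel f] assms by (simp add: lborel_distr_plus add.commute)

lemma lborel_nn_integral_translate:
  fixes f :: "'a::euclidean_space \<Rightarrow> ennreal"
  assumes "f \<in> borel_measurable borel"
  shows "(\<integral>\<^sup>+x. f (x + v) \<partial>lborel) = integral\<^sup>N lborel f"
  using nn_integral_distr[of "(+) v" lborel borel f] assms by (simp add: lborel_distr_plus add.commute)

lemma GDERIV_integral_cbox:
  fixes f :: "'a::euclidean_space \<Rightarrow> 'b::euclidean_space \<Rightarrow> real"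
  assumes deriv: "\<And>x t. t \<in> cbox a c \<Longrightarrow> GDERIV (\<lambda>x. f x t) x :> g x t"
    and cont_f: "\<And>x. continuous_on (cbox a c) (f x)"
    and cont_g: "continuous_on (UNIV \<times> cbox a c) (\<lambda>(x, t). g x t)"
  shows "GDERIV (\<lambda>x. integral (cbox a c) (f x)) x :> integral (cbox a c) (g x)"
proof -
  have "((\<lambda>x. integral (cbox a c) (f x)) has_derivative
      blinfun_apply (integral (cbox a c) (\<lambda>t. blinfun_inner_left (g x t)))) (at x within UNIV)"
  proof (rule leibniz_rule)
    show "((\<lambda>x. f x t) has_derivative blinfun_apply (blinfun_inner_left (g x t))) (at x within UNIV)"
      if "t \<in> cbox a c" for x t
      using deriv[OF that, of x] by (simp add: gderiv_def)
    show "continuous_on (UNIV \<times> cbox a c) (\<lambda>(x, t). blinfun_inner_left (g x t))"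
      using bounded_linear.continuous_on[OF bounded_linear_blinfun_inner_left cont_g]
      by (simp add: split_def)
  qed (auto intro!: integrable_continuous cont_f)
  moreover have "continuous_on (cbox a c) ((\<lambda>(x, t). g x t) \<circ> (\<lambda>t. (x, t)))"
    by (intro continuous_on_compose continuous_intros continuous_on_subset[OF cont_g]) auto
  then have "g x integrable_on cbox a c"
    by (intro integrable_continuous) (simp add: o_def)
  from integral_linear[OF this bounded_linear_blinfun_inner_left]
  have "integral (cbox a c) (\<lambda>t. blinfun_inner_left (g x t)) = blinfun_inner_left (integral (cbox a c) (g x))"
    by (simp add: o_def)
  ultimately show ?thesis by (simp add: gderiv_def)
qed

lemma GDERIV_eq_0_outside:
  fixes h :: "'a::euclidean_space \<Rightarrow> real"
  assumes "GDERIV h x :> g" "closed K" "x \<notin> K" "\<And>y. y \<notin> K \<Longrightarrow> h y = 0"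
  shows "g = 0"
proof -
  have "GDERIV h x :> 0"
    by (rule GDERIV_transform_within_open[OF GDERIV_const, of "- K"]) (use assms in auto)
  from GDERIV_imp_grad_eq[OF this] GDERIV_imp_grad_eq[OF assms(1)] show ?thesis by simp
qed

text \<open>The integrals of the translates of \<open>h\<close> agree; differentiate them in the translation vector.\<close>

lemma integral_gradient_eq_0:
  fixes h :: "'a::euclidean_space \<Rightarrow> real"
  assumes deriv: "\<And>x. GDERIV h x :> g x" and cont: "continuous_on UNIV g"
    and compact_K: "compact K" "\<And>x. x \<notin> K \<Longrightarrow> h x = 0"
  shows "integral\<^sup>L lborel g = 0"
proof -
  obtain R where K_sub_ball: "K \<subseteq> ball 0 R"
    using compact_imp_bounded[OF compact_K(1)] bounded_subset_ballD by blast
  obtain a where sub_cbox: "ball (0::'a) (R + 1) \<subseteq> cbox (- a) a"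
    using bounded_subset_cbox_symmetric[OF bounded_ball] by blast
  have cont_h: "continuous_on UNIV h"
    using deriv by (rule GDERIV_imp_continuous_on)
  have outside: "y + v \<notin> K" if "norm v < 1" "y \<notin> cbox (- a) a" for v y
    using that sub_cbox K_sub_ball norm_triangle_ineq4[of "y + v" v] by force
  have "GDERIV (\<lambda>v. integral (cbox (- a) a) (\<lambda>y. h (y + v))) 0 :> integral (cbox (- a) a) (\<lambda>y. g (y + 0))"
  proof (rule GDERIV_integral_cbox)
    show "GDERIV (\<lambda>v. h (y + v)) v :> g (y + v)" for v y
      using GDERIV_translate[OF deriv, of y v] by (simp add: add.commute[of _ y])
  qed (auto simp: split_def intro!: continuous_intros continuous_on_compose2[OF cont_h]
    continuous_on_compose2[OF cont])
  moreover have "GDERIV (\<lambda>v. integral (cbox (- a) a) (\<lambda>y. h (y + v))) 0 :> 0"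
  proof (rule GDERIV_transform_within_open[OF GDERIV_const, of "ball 0 1"])
    fix v :: 'a assume v_small: "v \<in> ball 0 1"
    have "integral (cbox (- a) a) (\<lambda>y. h (y + v)) = (\<integral>y. h (y + v) \<partial>lborel)"
    proof (rule integral_cbox_eq_lborel)
      show "h (y + v) = 0" if "y \<notin> cbox (- a) a" for y
        using outside[OF _ that, of v] v_small compact_K(2) by simp
    qed (auto intro!: continuous_intros continuous_on_compose2[OF cont_h])
    then show "integral\<^sup>L lborel h = integral (cbox (- a) a) (\<lambda>y. h (y + v))"
      using lborel_integral_translate[of h v] cont_h borel_measurable_continuous_onI by metis
  qed auto
  ultimately have "integral (cbox (- a) a) g = 0"
    by (auto dest!: GDERIV_imp_grad_eq)
  moreover have "g x = 0" if "x \<notin> cbox (- a) a" for x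
    using outside[OF _ that, of 0] GDERIV_eq_0_outside[OF deriv compact_imp_closed[OF compact_K(1)]]
      compact_K(2) by simp
  ultimately show ?thesis
    using integral_cbox_eq_lborel[OF cont] by simp
qed

lemma eq_0_outside_tsupport: "x \<notin> tsupport f \<Longrightarrow> f x = 0"
  using closure_subset[of "{x. f x \<noteq> 0}"] by (auto simp: tsupport_def)

lemma closed_tsupport: "closed (tsupport f)"
  by (simp add: tsupport_def)

lemma grad_eq_0_outside_tsupport:
  assumes "x \<notin> tsupport f"
  shows "grad f x = 0"
proof (rule GDERIV_imp_grad_eq)
  show "GDERIV f x :> 0"
    by (rule GDERIV_transform_within_open[OF GDERIV_const, of "- tsupport f"])
       (use assms in \<open>auto simp: closed_tsupport eq_0_outside_tsupport\<close>)
qed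

lemma test_funD:
  assumes "test_fun \<Omega> \<phi>"
  shows "smooth_fun \<phi>" "compact (tsupport \<phi>)" "tsupport \<phi> \<subseteq> \<Omega>"
    "continuous_on S \<phi>" "continuous_on S (grad \<phi>)"
  using assms smooth_fun_imp_continuous_on smooth_fun_continuous_on_grad by (auto simp: test_fun_def)

lemma set_integrable_mult_test_fun:
  assumes "test_fun \<Omega> \<phi>" "continuous_on \<Omega> f"
  shows "set_integrable lebesgue \<Omega> (\<lambda>x. f x * \<phi> x)"
  using test_funD(2,3)[OF assms(1)]
  by (rule set_integrable_compact_support)
     (auto simp: eq_0_outside_tsupport
       intro!: continuous_intros continuous_on_subset[OF assms(2)] test_funD[OF assms(1)])

lemma set_integrable_inner_grad_test_fun:
  assumes "test_fun \<Omega> \<phi>" "continuous_on \<Omega> F"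
  shows "set_integrable lebesgue \<Omega> (\<lambda>x. F x \<bullet> grad \<phi> x)"
  using test_funD(2,3)[OF assms(1)]
  by (rule set_integrable_compact_support)
     (auto simp: grad_eq_0_outside_tsupport
       intro!: continuous_intros continuous_on_subset[OF assms(2)] test_funD[OF assms(1)])

lemma bounded_continuous_compact_support:
  fixes f :: "'a::topological_space \<Rightarrow> 'b::real_normed_vector"
  assumes "compact K" "continuous_on K f" "\<And>x. x \<notin> K \<Longrightarrow> f x = 0"
  obtains C where "C > 0" "\<And>x. norm (f x) \<le> C"
proof -
  obtain B where "B > 0" "\<And>x. x \<in> K \<Longrightarrow> norm (f x) \<le> B"
    using compact_imp_bounded[OF compact_continuous_image[OF assms(2,1)]] by (auto simp: bounded_pos)
  then show thesis
    using that[of B] assms(3) by (metis less_imp_le norm_zero)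
qed

lemma test_fun_bounded:
  assumes "test_fun \<Omega> \<phi>"
  obtains C where "C > 0" "\<And>x. \<bar>\<phi> x\<bar> \<le> C"
  using bounded_continuous_compact_support[of "tsupport \<phi>" \<phi>] test_funD[OF assms] eq_0_outside_tsupport
  by (metis real_norm_def)

lemma test_fun_grad_bounded:
  assumes "test_fun \<Omega> \<phi>"
  obtains C where "C > 0" "\<And>x. norm (grad \<phi> x) \<le> C"
  using bounded_continuous_compact_support[of "tsupport \<phi>" "grad \<phi>"] test_funD[OF assms]
    grad_eq_0_outside_tsupport by metis

lemma GDERIV_mult_test_fun:
  assumes test: "test_fun \<Omega> \<phi>" and deriv: "\<And>x. x \<in> \<Omega> \<Longrightarrow> GDERIV f x :> g x"
  shows "GDERIV (\<lambda>x. f x * \<phi> x) x :> f x *\<^sub>R grad \<phi> x + \<phi> x *\<^sub>R g x"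
proof (cases "x \<in> tsupport \<phi>")
  case True
  then show ?thesis
    using test_funD(1,3)[OF test] by (intro GDERIV_mult deriv smooth_fun_GDERIV) auto
next
  case False
  have "GDERIV (\<lambda>x. f x * \<phi> x) x :> 0"
    by (rule GDERIV_transform_within_open[OF GDERIV_const, of "- tsupport \<phi>"])
       (use False closed_tsupport in \<open>auto simp: eq_0_outside_tsupport\<close>)
  then show ?thesis using False by (simp add: eq_0_outside_tsupport grad_eq_0_outside_tsupport)
qed

lemma continuous_on_UNIV_extend_by_0:
  fixes F :: "'a::topological_space \<Rightarrow> 'b::{real_normed_vector}"
  assumes "open \<Omega>" "closed K" "K \<subseteq> \<Omega>" "continuous_on \<Omega> F" "\<And>x. x \<notin> K \<Longrightarrow> F x = 0"
  shows "continuous_on UNIV F"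
proof -
  have "continuous_on (- K) F"
    by (rule continuous_on_eq[OF continuous_on_const[of _ 0]]) (simp add: assms(5))
  then have "continuous_on (\<Omega> \<union> - K) F"
    using assms(1,2,4) by (intro continuous_on_open_Un) auto
  moreover have "\<Omega> \<union> - K = UNIV" using assms(3) by auto
  ultimately show ?thesis by simp
qed

lemma test_fun_integration_by_parts:
  fixes f :: "'a::euclidean_space \<Rightarrow> real"
  assumes "open \<Omega>" and test: "test_fun \<Omega> \<phi>"
    and deriv: "\<And>x. x \<in> \<Omega> \<Longrightarrow> GDERIV f x :> g x" and cont: "continuous_on \<Omega> g"
  shows "(LINT x:\<Omega>|lebesgue. f x *\<^sub>R grad \<phi> x) = - (LINT x:\<Omega>|lebesgue. \<phi> x *\<^sub>R g x)"
proof -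
  note supp = test_funD(2,3)[OF test]
  note vanish = eq_0_outside_tsupport grad_eq_0_outside_tsupport
  have cont_terms: "continuous_on \<Omega> (\<lambda>x. f x *\<^sub>R grad \<phi> x)" "continuous_on \<Omega> (\<lambda>x. \<phi> x *\<^sub>R g x)"
    by (intro continuous_intros cont test_funD[OF test] GDERIV_imp_continuous_on[OF deriv]; assumption)+
  have "integral\<^sup>L lborel (\<lambda>x. f x *\<^sub>R grad \<phi> x + \<phi> x *\<^sub>R g x) = 0"
  proof (rule integral_gradient_eq_0[OF GDERIV_mult_test_fun[OF test deriv] _ supp(1)])
    show "continuous_on UNIV (\<lambda>x. f x *\<^sub>R grad \<phi> x + \<phi> x *\<^sub>R g x)"
      by (rule continuous_on_UNIV_extend_by_0[OF assms(1) closed_tsupport supp(2)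
        continuous_on_add[OF cont_terms]])
         (simp add: vanish)
  qed (simp_all add: vanish)
  moreover have "integrable lborel (\<lambda>x. f x *\<^sub>R grad \<phi> x)" "integrable lborel (\<lambda>x. \<phi> x *\<^sub>R g x)"
    "(LINT x:\<Omega>|lebesgue. f x *\<^sub>R grad \<phi> x) = (\<integral>x. f x *\<^sub>R grad \<phi> x \<partial>lborel)"
    "(LINT x:\<Omega>|lebesgue. \<phi> x *\<^sub>R g x) = (\<integral>x. \<phi> x *\<^sub>R g x \<partial>lborel)"
    by (rule integrable_compact_support[OF supp(1)] set_lebesgue_integral_compact_support[OF supp],
        auto simp: vanish intro: continuous_on_subset[OF cont_terms(1) supp(2)]
          continuous_on_subset[OF cont_terms(2) supp(2)])+
  ultimately show ?thesis by (simp add: add_eq_0_iff2)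
qed

lemma set_integral_inner_left:
  fixes f :: "'a \<Rightarrow> 'b::{second_countable_topology,banach,real_inner}"
  assumes "set_integrable M A f"
  shows "(LINT x:A|M. f x \<bullet> c) = (LINT x:A|M. f x) \<bullet> c"
  using assms integral_inner_left[of c M "\<lambda>x. indicator A x *\<^sub>R f x"]
  by (simp add: set_integrable_def set_lebesgue_integral_def)

lemma test_fun_partial_integration:
  fixes f :: "'a::euclidean_space \<Rightarrow> real"
  assumes "open \<Omega>" and test: "test_fun \<Omega> \<phi>"
    and deriv: "\<And>x. x \<in> \<Omega> \<Longrightarrow> GDERIV f x :> g x" and cont: "continuous_on \<Omega> g"
  shows "(LINT x:\<Omega>|lebesgue. f x * (grad \<phi> x \<bullet> b)) = - (LINT x:\<Omega>|lebesgue. (g x \<bullet> b) * \<phi> x)"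
proof -
  note supp = test_funD(2,3)[OF test]
  have "continuous_on \<Omega> f" using deriv by (rule GDERIV_imp_continuous_on)
  then have "set_integrable lebesgue \<Omega> (\<lambda>x. f x *\<^sub>R grad \<phi> x)"
    by (intro set_integrable_compact_support[OF supp] continuous_intros test_funD[OF test])
       (auto simp: grad_eq_0_outside_tsupport intro: continuous_on_subset[OF _ supp(2)])
  moreover have "set_integrable lebesgue \<Omega> (\<lambda>x. \<phi> x *\<^sub>R g x)"
    by (intro set_integrable_compact_support[OF supp] continuous_intros test_funD[OF test])
       (auto simp: eq_0_outside_tsupport intro: continuous_on_subset[OF cont supp(2)])
  ultimately show ?thesis
    using arg_cong[OF test_fun_integration_by_parts[OF assms], of "\<lambda>v. v \<bullet> b"]
    by (simp add: set_integral_inner_left[symmetric] mult.commute)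
qed

lemma test_fun_divergence:
  fixes F :: "'a::euclidean_space \<Rightarrow> 'a"
  assumes "open \<Omega>" and test: "test_fun \<Omega> \<phi>"
    and deriv: "\<And>b x. b \<in> Basis \<Longrightarrow> x \<in> \<Omega> \<Longrightarrow> GDERIV (\<lambda>x. F x \<bullet> b) x :> G b x"
    and cont: "\<And>b. b \<in> Basis \<Longrightarrow> continuous_on \<Omega> (G b)"
  shows "(LINT x:\<Omega>|lebesgue. F x \<bullet> grad \<phi> x) = - (LINT x:\<Omega>|lebesgue. (\<Sum>b\<in>Basis. G b x \<bullet> b) * \<phi> x)"
proof -
  have integrable_component: "set_integrable lebesgue \<Omega> (\<lambda>x. (F x \<bullet> b) * (grad \<phi> x \<bullet> b))" if "b \<in> Basis" for b
  proof -
    have "continuous_on \<Omega> (\<lambda>x. F x \<bullet> b)"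
      using deriv[OF that] by (rule GDERIV_imp_continuous_on)
    then show ?thesis
      using set_integrable_inner_grad_test_fun[OF test, of "\<lambda>x. (F x \<bullet> b) *\<^sub>R b"]
      by (simp add: inner_commute continuous_on_scaleR)
  qed
  have "(LINT x:\<Omega>|lebesgue. F x \<bullet> grad \<phi> x)
      = (LINT x:\<Omega>|lebesgue. \<Sum>b\<in>Basis. (F x \<bullet> b) * (grad \<phi> x \<bullet> b))"
    by (subst euclidean_inner) (rule refl)
  also have "\<dots> = (\<Sum>b\<in>Basis. LINT x:\<Omega>|lebesgue. (F x \<bullet> b) * (grad \<phi> x \<bullet> b))"
    using integrable_component unfolding set_lebesgue_integral_def set_integrable_def scaleR_sum_right
    by (intro Bochner_Integration.integral_sum) auto
  also have "\<dots> = (\<Sum>b\<in>Basis. - (LINT x:\<Omega>|lebesgue. (G b x \<bullet> b) * \<phi> x))"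
    by (intro sum.cong refl test_fun_partial_integration assms)
  also have "\<dots> = - (LINT x:\<Omega>|lebesgue. \<Sum>b\<in>Basis. (G b x \<bullet> b) * \<phi> x)"
    using set_integrable_mult_test_fun[OF test continuous_on_inner[OF cont continuous_on_const]]
    unfolding set_lebesgue_integral_def set_integrable_def scaleR_sum_right sum_negf
    by (subst Bochner_Integration.integral_sum) auto
  finally show ?thesis by (simp only: sum_distrib_right)
qed

section \<open>Continuity of translations\<close>

lemma tendsto_0_ennrealI:
  fixes f :: "'a \<Rightarrow> ennreal"
  assumes "\<And>\<epsilon>. \<epsilon> > 0 \<Longrightarrow> eventually (\<lambda>x. f x \<le> ennreal \<epsilon>) F"
  shows "(f \<longlongrightarrow> 0) F"
proof (rule order_tendstoI)
  fix a :: ennreal assume "0 < a"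
  then obtain r where "0 < r" "r < a" using dense by blast
  then obtain \<epsilon> where "r = ennreal \<epsilon>" "\<epsilon> > 0"
    by (cases r) (auto simp: top_unique)
  with \<open>r < a\<close> assms[of \<epsilon>] show "eventually (\<lambda>x. f x < a) F"
    by (auto elim!: eventually_mono)
qed simp

lemma powr_add_le:
  fixes s t m :: real
  assumes "s \<ge> 0" "t \<ge> 0" "m > 0"
  shows "(s + t) powr m \<le> 2 powr m * (s powr m + t powr m)"
proof -
  have "(s + t) powr m \<le> (2 * max s t) powr m"
    using assms by (intro powr_mono2) auto
  also have "\<dots> = 2 powr m * (max s t) powr m"
    using assms by (simp add: powr_mult)
  also have "(max s t) powr m \<le> s powr m + t powr m"
    by (auto simp: max_def)
  finally show ?thesis by simp
qed

definition Lm_dist_powr :: "real \<Rightarrow> ('a::euclidean_space \<Rightarrow> 'b::euclidean_space) \<Rightarrow> ('a \<Rightarrow> 'b) \<Rightarrow> ennreal" where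
  "Lm_dist_powr m f g = (\<integral>\<^sup>+x. ennreal (norm (f x - g x) powr m) \<partial>lborel)"

lemma Lm_dist_powr_commute: "Lm_dist_powr m f g = Lm_dist_powr m g f"
  by (simp add: Lm_dist_powr_def norm_minus_commute)

lemma Lm_dist_powr_translate:
  assumes [measurable]: "f \<in> borel_measurable borel" "g \<in> borel_measurable borel"
  shows "Lm_dist_powr m (\<lambda>x. f (x + z)) (\<lambda>x. g (x + z)) = Lm_dist_powr m f g"
  unfolding Lm_dist_powr_def
  by (rule lborel_nn_integral_translate[of "\<lambda>x. ennreal (norm (f x - g x) powr m)"]) measurable

lemma Lm_dist_powr_triangle:
  assumes "m > 0"
    and [measurable]: "f \<in> borel_measurable borel" "g \<in> borel_measurable borel" "h \<in> borel_measurable borel"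
  shows "Lm_dist_powr m f h \<le> ennreal (2 powr m) * (Lm_dist_powr m f g + Lm_dist_powr m g h)"
proof -
  have "norm (f x - h x) powr m \<le> 2 powr m * (norm (f x - g x) powr m + norm (g x - h x) powr m)" for x
  proof -
    have "norm (f x - h x) powr m \<le> (norm (f x - g x) + norm (g x - h x)) powr m"
      using assms(1) norm_triangle_ineq[of "f x - g x" "g x - h x"] by (intro powr_mono2) auto
    also note powr_add_le[OF norm_ge_zero norm_ge_zero assms(1)]
    finally show ?thesis .
  qed
  then have "Lm_dist_powr m f h
      \<le> (\<integral>\<^sup>+x. ennreal (2 powr m) * (ennreal (norm (f x - g x) powr m) + ennreal (norm (g x - h x) powr m))
        \<partial>lborel)"
    unfolding Lm_dist_powr_def
    by (intro nn_integral_mono) (simp add: ennreal_mult[symmetric] ennreal_plus[symmetric] ennreal_leI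
      del: ennreal_plus)
  also have "\<dots> = ennreal (2 powr m) * (Lm_dist_powr m f g + Lm_dist_powr m g h)"
    by (simp add: nn_integral_cmult nn_integral_add Lm_dist_powr_def)
  finally show ?thesis .
qed

lemma Lm_dist_powr_dominated_convergence:
  fixes f :: "'a::euclidean_space \<Rightarrow> 'b::euclidean_space"
  assumes "m > 0"
    and [measurable]: "f \<in> borel_measurable borel" "\<And>n. F n \<in> borel_measurable borel"
      "w \<in> borel_measurable borel"
    and lim: "AE x in lborel. (\<lambda>n. F n x) \<longlonglongrightarrow> f x"
    and bound: "\<And>n x. norm (F n x - f x) powr m \<le> w x" and finite_w: "(\<integral>\<^sup>+x. ennreal (w x) \<partial>lborel) < \<infinity>"
  shows "(\<lambda>n. Lm_dist_powr m (F n) f) \<longlonglongrightarrow> 0"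
proof -
  have "(\<lambda>n. \<integral>\<^sup>+x. ennreal (norm (F n x - f x) powr m) \<partial>lborel) \<longlonglongrightarrow> (\<integral>\<^sup>+x. 0 \<partial>(lborel :: 'a measure))"
  proof (rule nn_integral_dominated_convergence)
    show "AE x in lborel. (\<lambda>n. ennreal (norm (F n x - f x) powr m)) \<longlonglongrightarrow> 0"
      using lim
    proof eventually_elim
      case (elim x)
      then have "(\<lambda>n. norm (F n x - f x)) \<longlonglongrightarrow> 0"
        by (simp add: LIM_zero tendsto_norm_zero)
      from tendsto_powr'[OF this tendsto_const[of m]] assms(1)
      have "(\<lambda>n. norm (F n x - f x) powr m) \<longlonglongrightarrow> 0" by simp
      from tendsto_ennrealI[OF this] show ?case by simp
    qed
    show "AE x in lborel. ennreal (norm (F n x - f x) powr m) \<le> ennreal (w x)" for n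
      using bound by (simp add: ennreal_leI)
  qed (use finite_w in auto)
  then show ?thesis by (simp add: Lm_dist_powr_def)
qed

lemma finite_nn_integral_indicator_bounded:
  fixes S :: "'a::euclidean_space set"
  assumes "bounded S" and [measurable]: "S \<in> sets borel"
  shows "(\<integral>\<^sup>+x. ennreal (C * indicator S x) \<partial>lborel) < \<infinity>"
proof -
  have "(\<integral>\<^sup>+x. ennreal (C * indicator S x) \<partial>lborel) = (\<integral>\<^sup>+x. ennreal C * indicator S x \<partial>lborel)"
    by (intro nn_integral_cong) (simp split: split_indicator)
  also have "\<dots> < \<infinity>"
    using emeasure_bounded_finite[OF assms(1)] by (simp add: nn_integral_cmult_indicator ennreal_mult_less_top)
  finally show ?thesis .
qed

lemma closest_point_cball_0:
  fixes v :: "'a::euclidean_space"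
  assumes "M \<ge> 0"
  shows "norm (closest_point (cball 0 M) v) \<le> M" "norm (v - closest_point (cball 0 M) v) \<le> norm v"
    "norm v \<le> M \<Longrightarrow> closest_point (cball 0 M) v = v" "continuous_on UNIV (closest_point (cball (0::'a) M))"
  using closest_point_in_set[of "cball (0::'a) M" v] closest_point_le[of "cball (0::'a) M" 0 v] assms
  by (auto simp: dist_norm closest_point_self intro!: continuous_on_closest_point)

lemma Lm_dist_powr_bounded_convergence:
  fixes f :: "'a::euclidean_space \<Rightarrow> 'b::euclidean_space"
  assumes m_pos: "m > 0" and borel: "f \<in> borel_measurable borel" "\<And>n. F n \<in> borel_measurable borel"
    and lim: "AE x in lborel. (\<lambda>n. F n x) \<longlonglongrightarrow> f x"
    and bound: "\<And>n x. norm (F n x) \<le> C" "\<And>x. norm (f x) \<le> C"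
    and vanish: "\<And>n x. norm x \<ge> S \<Longrightarrow> F n x = 0" "\<And>x. norm x \<ge> S \<Longrightarrow> f x = 0"
  shows "(\<lambda>n. Lm_dist_powr m (F n) f) \<longlonglongrightarrow> 0"
proof (rule Lm_dist_powr_dominated_convergence[OF m_pos borel _ lim])
  show "norm (F n x - f x) powr m \<le> (2 * C) powr m * indicator (ball 0 S) x" for n x
  proof (cases "norm x \<ge> S")
    case False
    then show ?thesis
      using bound(1)[of n x] bound(2)[of x] norm_triangle_ineq4[of "F n x" "f x"] m_pos
      by (auto intro!: powr_mono2)
  qed (simp add: vanish)
  show "(\<lambda>x. (2 * C) powr m * indicator (ball (0::'a) S) x) \<in> borel_measurable borel"
    by (intro borel_measurable_times borel_measurable_indicator) auto
qed (rule finite_nn_integral_indicator_bounded[OF bounded_ball borel_open[OF open_ball]])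

definition truncate_at :: "real \<Rightarrow> ('a::euclidean_space \<Rightarrow> 'b::euclidean_space) \<Rightarrow> 'a \<Rightarrow> 'b" where
  "truncate_at R f x = indicator (ball 0 R) x *\<^sub>R closest_point (cball 0 R) (f x)"

lemma
  assumes "R \<ge> 0"
  shows norm_truncate_at_le: "norm (truncate_at R f x) \<le> R"
    and truncate_at_eq_0: "norm x \<ge> R \<Longrightarrow> truncate_at R f x = 0"
    and truncate_at_eq: "norm x < R \<Longrightarrow> norm (f x) \<le> R \<Longrightarrow> truncate_at R f x = f x"
    and norm_truncate_at_diff_le: "norm (truncate_at R f x - f x) \<le> norm (f x)"
  using closest_point_cball_0(1-3)[OF assms, of "f x"] assms
  by (auto simp: truncate_at_def indicator_def norm_minus_commute)

lemma borel_measurable_truncate_at: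
  fixes f :: "'a::euclidean_space \<Rightarrow> 'b::euclidean_space"
  assumes "f \<in> borel_measurable borel" "R \<ge> 0"
  shows "truncate_at R f \<in> borel_measurable borel"
proof -
  have "closest_point (cball (0::'b) R) \<in> borel_measurable borel"
    using closest_point_cball_0(4)[OF assms(2), where 'a='b] by (simp add: borel_measurable_continuous_onI)
  then show ?thesis
    unfolding truncate_at_def
    by (intro borel_measurable_scaleR borel_measurable_indicator measurable_compose[OF assms(1)]) auto
qed

lemma Lm_dist_powr_truncation:
  fixes f :: "'a::euclidean_space \<Rightarrow> 'b::euclidean_space"
  assumes "m > 0" and borel_f: "f \<in> borel_measurable borel"
    and finite: "(\<integral>\<^sup>+x. ennreal (norm (f x) powr m) \<partial>lborel) < \<infinity>"
  shows "(\<lambda>n. Lm_dist_powr m (truncate_at (real n) f) f) \<longlonglongrightarrow> 0"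
proof (rule Lm_dist_powr_dominated_convergence[OF assms(1)])
  show "AE x in lborel. (\<lambda>n. truncate_at (real n) f x) \<longlonglongrightarrow> f x"
  proof (rule AE_I2)
    fix x :: 'a
    obtain k where k_large: "max (norm x) (norm (f x)) < real k" using reals_Archimedean2 by blast
    have "truncate_at (real n) f x = f x" if "n \<ge> k" for n
      using that k_large by (intro truncate_at_eq) auto
    then show "(\<lambda>n. truncate_at (real n) f x) \<longlonglongrightarrow> f x"
      by (intro tendsto_eventually) (auto simp: eventually_sequentially)
  qed
  show "norm (truncate_at (real n) f x - f x) powr m \<le> norm (f x) powr m" for n x
    using assms(1) norm_truncate_at_diff_le[of "real n" f x] by (intro powr_mono2) auto
  show "(\<lambda>x. norm (f x) powr m) \<in> borel_measurable borel" using borel_f by measurable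
qed (use finite borel_f borel_measurable_truncate_at[OF borel_f] in auto)

lemma borel_AE_limit_continuous:
  fixes f :: "'a::euclidean_space \<Rightarrow> 'b::euclidean_space"
  assumes "f \<in> borel_measurable borel"
  obtains g where "\<And>j::nat. continuous_on UNIV (g j)" "AE x in lborel. (\<lambda>j. g j x) \<longlonglongrightarrow> f x"
proof -
  have "f \<in> borel_measurable lebesgue"
    using assms by (simp add: measurable_completion)
  then have "f measurable_on UNIV"
    by (intro lebesgue_measurable_imp_measurable_on) (auto simp: lebesgue_on_UNIV_eq)
  then obtain N g where negligible_N: "negligible N" and cont_g: "\<And>j. continuous_on UNIV (g j)"
      "\<And>x. x \<notin> N \<Longrightarrow> (\<lambda>j. g j x) \<longlonglongrightarrow> f x"
    by (auto simp: measurable_on_def)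
  have "AE x in lebesgue. x \<notin> N"
    using negligible_N by (intro AE_not_in) (simp add: negligible_iff_null_sets)
  then have "AE x in lborel. (\<lambda>j. g j x) \<longlonglongrightarrow> f x"
    using cont_g(2) by (auto simp: AE_completion_iff elim: eventually_mono)
  with cont_g(1) show thesis by (rule that)
qed

lemma Lm_bounded_approx_continuous:
  fixes f :: "'a::euclidean_space \<Rightarrow> 'b::euclidean_space"
  assumes m_pos: "m > 0" and [measurable]: "f \<in> borel_measurable borel"
    and bound: "\<And>x. norm (f x) \<le> R" "\<And>x. norm x \<ge> R \<Longrightarrow> f x = 0" and "R \<ge> 0" "\<epsilon> > 0"
  obtains G where "continuous_on UNIV G" "\<And>x. norm x \<ge> R + 1 \<Longrightarrow> G x = 0" "\<And>x. norm (G x) \<le> R"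
    "Lm_dist_powr m G f < ennreal \<epsilon>"
proof -
  obtain g where limit_g: "\<And>j::nat. continuous_on UNIV (g j)" "AE x in lborel. (\<lambda>j. g j x) \<longlonglongrightarrow> f x"
    using borel_AE_limit_continuous[of f] by auto
  define T where "T = closest_point (cball (0::'b) R)"
  define cut where "cut x = max 0 (min 1 (R + 1 - norm x))" for x :: 'a
  define G where "G j x = cut x *\<^sub>R T (g j x)" for j x
  have truncated_T: "norm (T v) \<le> R" "continuous_on UNIV T" for v
    using closest_point_cball_0 \<open>R \<ge> 0\<close> by (auto simp: T_def)
  have cont: "continuous_on UNIV (G j)" for j
    unfolding G_def cut_def by (intro continuous_intros
      continuous_on_compose2[OF truncated_T(2) limit_g(1)]) auto
  have bound_G: "norm (G j x) \<le> R" for j x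
    using mult_mono[of "\<bar>cut x\<bar>" 1 "norm (T (g j x))" R] truncated_T(1) by (simp add: G_def cut_def)
  have vanish_G: "G j x = 0" if "norm x \<ge> R + 1" for j x
    using that by (simp add: G_def cut_def)
  have "AE x in lborel. (\<lambda>j. G j x) \<longlonglongrightarrow> f x"
    using limit_g(2)
  proof eventually_elim
    case (elim x)
    have "(\<lambda>j. T (g j x)) \<longlonglongrightarrow> T (f x)"
      using truncated_T(2) by (intro isCont_tendsto_compose[OF _ elim])
        (simp add: continuous_on_eq_continuous_at)
    also have "T (f x) = f x"
      using closest_point_cball_0(3)[of R "f x"] bound(1) \<open>R \<ge> 0\<close> by (simp add: T_def)
    finally have "(\<lambda>j. G j x) \<longlonglongrightarrow> cut x *\<^sub>R f x"
      unfolding G_def by (intro tendsto_intros)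
    also have "cut x *\<^sub>R f x = f x"
      using bound(2)[of x] by (cases "norm x \<ge> R") (auto simp: cut_def)
    finally show ?case .
  qed
  then have "(\<lambda>j. Lm_dist_powr m (G j) f) \<longlonglongrightarrow> 0"
    using bound vanish_G bound_G
    by (intro Lm_dist_powr_bounded_convergence[OF m_pos, of _ _ R "R + 1"]
      borel_measurable_continuous_onI[OF cont]) auto
  then have "eventually (\<lambda>j. Lm_dist_powr m (G j) f < ennreal \<epsilon>) sequentially"
    by (rule order_tendstoD) (use \<open>\<epsilon> > 0\<close> in simp)
  then obtain j where "Lm_dist_powr m (G j) f < ennreal \<epsilon>"
    by (auto simp: eventually_sequentially)
  then show thesis using that[of "G j"] cont vanish_G bound_G by blast
qed

lemma Lm_dense_continuous_compact_support:
  fixes f :: "'a::euclidean_space \<Rightarrow> 'b::euclidean_space"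
  assumes m_pos: "m > 0" and borel_f[measurable]: "f \<in> borel_measurable borel"
    and finite_f: "(\<integral>\<^sup>+x. ennreal (norm (f x) powr m) \<partial>lborel) < \<infinity>" and "\<epsilon> > 0"
  obtains G R where "continuous_on UNIV G" "\<And>x. norm x \<ge> R \<Longrightarrow> G x = 0" "\<And>x. norm (G x) \<le> R"
    "Lm_dist_powr m G f \<le> ennreal \<epsilon>"
proof -
  define \<epsilon>' where "\<epsilon>' = \<epsilon> / (2 * 2 powr m)"
  have "\<epsilon>' > 0" using \<open>\<epsilon> > 0\<close> by (simp add: \<epsilon>'_def)
  have "eventually (\<lambda>n. Lm_dist_powr m (truncate_at (real n) f) f < ennreal \<epsilon>') sequentially"
    using order_tendstoD(2)[OF Lm_dist_powr_truncation[OF m_pos borel_f finite_f], of "ennreal \<epsilon>'"] \<open>\<epsilon>' > 0\<close>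
    by simp
  then obtain n where truncation_close: "Lm_dist_powr m (truncate_at (real n) f) f < ennreal \<epsilon>'"
    by (auto simp: eventually_sequentially)
  define h where "h = truncate_at (real n) f"
  have [measurable]: "h \<in> borel_measurable borel"
    unfolding h_def using borel_f by (rule borel_measurable_truncate_at) simp
  have "norm (h x) \<le> real n" "norm x \<ge> real n \<Longrightarrow> h x = 0" for x
    by (simp_all add: h_def norm_truncate_at_le truncate_at_eq_0)
  then obtain G where approx_G: "continuous_on UNIV G" "\<And>x. norm x \<ge> real n + 1 \<Longrightarrow> G x = 0" "\<And>x. norm (G x)
    \<le> real n"
    "Lm_dist_powr m G h < ennreal \<epsilon>'"
    using Lm_bounded_approx_continuous[OF m_pos, of h "real n" \<epsilon>'] \<open>\<epsilon>' > 0\<close> by auto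
  have "Lm_dist_powr m G f \<le> ennreal (2 powr m) * (Lm_dist_powr m G h + Lm_dist_powr m h f)"
    using approx_G(1) by (intro Lm_dist_powr_triangle[OF m_pos]) (auto simp: borel_measurable_continuous_onI)
  also have "\<dots> \<le> ennreal (2 powr m) * (ennreal \<epsilon>' + ennreal \<epsilon>')"
    using approx_G(4) truncation_close unfolding h_def by (intro mult_left_mono add_mono) auto
  also have "\<dots> = ennreal \<epsilon>"
    using \<open>\<epsilon>' > 0\<close> by (simp add: ennreal_mult[symmetric] ennreal_plus[symmetric] \<epsilon>'_def del: ennreal_plus)
  finally show thesis
    using that[of G "real n + 1"] approx_G(1,2) order_trans[OF approx_G(3), of "real n + 1"] by simp
qed

lemma Lm_translation_tendsto_compact_support:
  fixes G :: "'a::euclidean_space \<Rightarrow> 'b::euclidean_space"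
  assumes m_pos: "m > 0" and approx_G: "continuous_on UNIV G" "\<And>x. norm x \<ge> R \<Longrightarrow> G x = 0" "\<And>x. norm (G x) \<le> R"
  shows "((\<lambda>z. Lm_dist_powr m (\<lambda>x. G (x + z)) G) \<longlongrightarrow> 0) (at 0)"
  unfolding tendsto_at_iff_sequentially comp_def
proof (intro allI impI)
  fix z :: "nat \<Rightarrow> 'a" assume z_tendsto: "z \<longlonglongrightarrow> 0"
  obtain S where z_bounded: "\<And>n. norm (z n) \<le> S"
    using convergent_imp_Bseq[OF convergentI[OF z_tendsto]] by (auto simp: Bseq_def)
  have [measurable]: "G \<in> borel_measurable borel"
    using approx_G(1) by (rule borel_measurable_continuous_onI)
  show "(\<lambda>n. Lm_dist_powr m (\<lambda>x. G (x + z n)) G) \<longlonglongrightarrow> 0"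
  proof (rule Lm_dist_powr_bounded_convergence[OF m_pos, where C=R and S="R + S"])
    have "(\<lambda>n. G (x + z n)) \<longlonglongrightarrow> G x" for x
      using tendsto_add[OF tendsto_const[of x] z_tendsto] approx_G(1)
      by (auto simp: continuous_on_eq_continuous_at intro!: isCont_tendsto_compose[of x G])
    then show "AE x in lborel. (\<lambda>n. G (x + z n)) \<longlonglongrightarrow> G x" by simp
    show "G (x + z n) = 0" "G x = 0" if "norm x \<ge> R + S" for n x
      using that z_bounded[of n] norm_diff_ineq[of x "z n"] norm_ge_zero[of "z n"]
      by (intro approx_G(2); linarith)+
    show "G \<in> borel_measurable borel" "(\<lambda>x. G (x + z n)) \<in> borel_measurable borel" for n
      by measurable
  qed (rule approx_G(3))+
qed

lemma Lm_translation_tendsto: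
  fixes f :: "'a::euclidean_space \<Rightarrow> 'b::euclidean_space"
  assumes m_pos: "m > 0" and borel_f[measurable]: "f \<in> borel_measurable borel"
    and finite_f: "(\<integral>\<^sup>+x. ennreal (norm (f x) powr m) \<partial>lborel) < \<infinity>"
  shows "((\<lambda>z. Lm_dist_powr m (\<lambda>x. f (x + z)) f) \<longlongrightarrow> 0) (at 0)"
proof (rule tendsto_0_ennrealI)
  fix \<epsilon> :: real assume "\<epsilon> > 0"
  define c where "c = (2::real) powr m"
  define \<epsilon>' where "\<epsilon>' = \<epsilon> / (c * (1 + 2 * c))"
  have "c > 0" by (simp add: c_def)
  then have denom: "c * (1 + 2 * c) > 0" by (intro mult_pos_pos add_pos_pos) auto
  with \<open>\<epsilon> > 0\<close> have "\<epsilon>' > 0" unfolding \<epsilon>'_def by (rule divide_pos_pos)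
  note pos = \<open>c > 0\<close> \<open>\<epsilon>' > 0\<close>
  obtain G R where approx_G: "continuous_on UNIV G" "\<And>x. norm x \<ge> R \<Longrightarrow> G x = 0" "\<And>x. norm (G x) \<le> R"
    and G_close: "Lm_dist_powr m G f \<le> ennreal \<epsilon>'"
    by (rule Lm_dense_continuous_compact_support[OF m_pos borel_f finite_f pos(2)]) (auto intro: that)
  have [measurable]: "G \<in> borel_measurable borel"
    using approx_G(1) by (rule borel_measurable_continuous_onI)
  have "eventually (\<lambda>z. Lm_dist_powr m (\<lambda>x. G (x + z)) G < ennreal \<epsilon>') (at 0)"
    using order_tendstoD(2)[OF Lm_translation_tendsto_compact_support[OF m_pos approx_G], of "ennreal \<epsilon>'"]
      pos by simp
  then show "eventually (\<lambda>z. Lm_dist_powr m (\<lambda>x. f (x + z)) f \<le> ennreal \<epsilon>) (at 0)"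
  proof eventually_elim
    case (elim z)
    have "Lm_dist_powr m (\<lambda>x. f (x + z)) f
        \<le> ennreal c * (Lm_dist_powr m (\<lambda>x. f (x + z)) (\<lambda>x. G (x + z)) + Lm_dist_powr m (\<lambda>x. G (x + z)) f)"
      unfolding c_def by (rule Lm_dist_powr_triangle[OF m_pos]) measurable
    also have "Lm_dist_powr m (\<lambda>x. f (x + z)) (\<lambda>x. G (x + z)) = Lm_dist_powr m G f"
      by (simp add: Lm_dist_powr_translate Lm_dist_powr_commute)
    also have "Lm_dist_powr m (\<lambda>x. G (x + z)) f
        \<le> ennreal c * (Lm_dist_powr m (\<lambda>x. G (x + z)) G + Lm_dist_powr m G f)"
      unfolding c_def by (rule Lm_dist_powr_triangle[OF m_pos]) measurable
    also have "ennreal c * (Lm_dist_powr m G f + ennreal c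
      * (Lm_dist_powr m (\<lambda>x. G (x + z)) G + Lm_dist_powr m G f))
        \<le> ennreal c * (ennreal \<epsilon>' + ennreal c * (ennreal \<epsilon>' + ennreal \<epsilon>'))"
      using elim G_close by (intro mult_left_mono add_mono) auto
    also have "\<dots> = ennreal (\<epsilon>' * (c * (1 + 2 * c)))"
      using pos by (simp add: ennreal_mult[symmetric] ennreal_plus[symmetric] algebra_simps del: ennreal_plus)
    also have "\<epsilon>' * (c * (1 + 2 * c)) = \<epsilon>"
      using denom by (metis \<epsilon>'_def less_irrefl nonzero_eq_divide_eq)
    finally show ?case by (simp add: add_left_mono mult_left_mono)
  qed
qed

section \<open>Mollification\<close>

lemma integral_pos_of_pos_on_open:
  fixes f :: "'a::euclidean_space \<Rightarrow> real"
  assumes "integrable lebesgue f" "\<And>x. f x \<ge> 0" "open S" "S \<noteq> {}" "\<And>x. x \<in> S \<Longrightarrow> f x > 0"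
  shows "integral\<^sup>L lebesgue f > 0"
proof (rule ccontr)
  assume "\<not> integral\<^sup>L lebesgue f > 0"
  moreover have "integral\<^sup>L lebesgue f \<ge> 0"
    using assms(2) by (intro Bochner_Integration.integral_nonneg) auto
  ultimately have "AE x in lebesgue. f x = 0"
    using integral_nonneg_eq_0_iff_AE[OF assms(1)] assms(2) by auto
  then have "AE x in lebesgue. x \<notin> S"
    by eventually_elim (use assms(5) in force)
  then have "negligible S"
    using assms(3) by (simp add: negligible_iff_null_sets AE_iff_null_sets)
  then show False
    using open_not_negligible[OF assms(3,4)] by simp
qed

lemma GDERIV_reflect:
  assumes "GDERIV f (y - x) :> g"
  shows "GDERIV (\<lambda>x. f (y - x)) x :> - g"
proof -
  have "((\<lambda>x. y - x) has_derivative (\<lambda>h. - h)) (at x)"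
    by (auto intro!: derivative_eq_intros)
  from has_derivative_compose[OF this assms[unfolded gderiv_def]] show ?thesis
    by (simp add: gderiv_def)
qed

lemma powr_minus_1_mult: "t \<ge> 0 \<Longrightarrow> t powr (a - 1) * t = t powr a" for t :: real
  using powr_add[of t "a - 1" 1] by (cases "t = 0") auto

lemma powr_ge_tangent:
  fixes s t m :: real
  assumes "s \<ge> 0" "t \<ge> 0" "m > 1"
  shows "t powr m + m * t powr (m - 1) * (s - t) \<le> s powr m"
proof -
  have "s * t powr (m - 1) \<le> s powr m / m + (t powr (m - 1)) powr (m / (m - 1)) / (m / (m - 1))"
    using assms by (intro Youngs_inequality) (auto simp: field_simps)
  also have "(t powr (m - 1)) powr (m / (m - 1)) = t powr m"
    using assms(3) by (simp add: powr_powr)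
  finally have "m * (s * t powr (m - 1)) \<le> m * (s powr m / m + t powr m / (m / (m - 1)))"
    using assms(3) by (intro mult_left_mono) auto
  also have "\<dots> = s powr m + (m - 1) * t powr m"
    using assms(3) by (simp add: field_simps)
  finally have "m * (s * t powr (m - 1)) \<le> s powr m + (m - 1) * t powr m" .
  moreover have "t powr (m - 1) * t = t powr m"
    using assms(2) by (rule powr_minus_1_mult)
  ultimately show ?thesis
    by (simp add: algebra_simps)
qed

definition mollify :: "('a::euclidean_space \<Rightarrow> real) \<Rightarrow> ('a \<Rightarrow> 'b::euclidean_space) \<Rightarrow> 'a \<Rightarrow> 'b" where
  "mollify \<rho> f x = (\<integral>y. \<rho> (y - x) *\<^sub>R f y \<partial>lborel)"

lemma mollify_eq_integral_translate:
  assumes [measurable]: "\<rho> \<in> borel_measurable borel" "f \<in> borel_measurable borel"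
  shows "mollify \<rho> f x = (\<integral>z. \<rho> z *\<^sub>R f (z + x) \<partial>lborel)"
  unfolding mollify_def using lborel_integral_translate[of "\<lambda>y. \<rho> (y - x) *\<^sub>R f y" x] by simp

lemma GDERIV_mollify:
  fixes U :: "'a::euclidean_space \<Rightarrow> real"
  assumes smooth_\<rho>: "smooth_fun \<rho>" and cont_U: "continuous_on UNIV U" "bounded S" "\<And>y. y \<notin> S \<Longrightarrow> U y = 0"
  shows "GDERIV (mollify \<rho> U) x :> - (\<integral>y. U y *\<^sub>R grad \<rho> (y - x) \<partial>lborel)"
proof -
  obtain a where sub_cbox: "S \<subseteq> cbox (- a) a"
    using bounded_subset_cbox_symmetric[OF cont_U(2)] by blast
  have cont: "continuous_on UNIV (\<lambda>y. \<rho> (y - x))" "continuous_on UNIV (\<lambda>y. grad \<rho> (y - x))" for x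
    by (auto intro!: continuous_on_compose2[OF smooth_fun_imp_continuous_on[OF smooth_\<rho>, of UNIV]]
        continuous_on_compose2[OF smooth_fun_continuous_on_grad[OF smooth_\<rho>, of UNIV]] continuous_intros)
  have "mollify \<rho> U x = integral (cbox (- a) a) (\<lambda>y. \<rho> (y - x) * U y)" for x
    unfolding mollify_def real_scaleR_def
    by (rule integral_cbox_eq_lborel[symmetric])
      (use sub_cbox cont_U(3) in \<open>auto intro!: continuous_intros cont cont_U(1)\<close>)
  then have mollify_eq: "mollify \<rho> U = (\<lambda>x. integral (cbox (- a) a) (\<lambda>y. \<rho> (y - x) * U y))"
    by (rule ext)
  have grad_eq: "integral (cbox (- a) a) (\<lambda>y. - (U y *\<^sub>R grad \<rho> (y - x)))
    = - (\<integral>y. U y *\<^sub>R grad \<rho> (y - x) \<partial>lborel)"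
    unfolding integral_minus[symmetric]
    by (rule integral_cbox_eq_lborel) (use sub_cbox cont_U(3) in \<open>auto intro!: continuous_intros cont
      cont_U(1)\<close>)
  have "GDERIV (\<lambda>x. integral (cbox (- a) a) (\<lambda>y. \<rho> (y - x) * U y)) x
      :> integral (cbox (- a) a) (\<lambda>y. - (U y *\<^sub>R grad \<rho> (y - x)))"
  proof (rule GDERIV_integral_cbox)
    show "GDERIV (\<lambda>x. \<rho> (y - x) * U y) x :> - (U y *\<^sub>R grad \<rho> (y - x))" for x y
      by (rule GDERIV_subst[OF GDERIV_mult[OF GDERIV_reflect[OF smooth_fun_GDERIV[OF smooth_\<rho>]]
        GDERIV_const]]) simp
    show "continuous_on (cbox (- a) a) (\<lambda>y. \<rho> (y - x) * U y)" for x
      by (intro continuous_intros continuous_on_subset[OF cont(1)] continuous_on_subset[OF cont_U(1)]) auto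
    show "continuous_on (UNIV \<times> cbox (- a) a) (\<lambda>(x, y). - (U y *\<^sub>R grad \<rho> (y - x)))"
      unfolding split_def
      by (intro continuous_intros continuous_on_compose2[OF cont_U(1)]
          continuous_on_compose2[OF smooth_fun_continuous_on_grad[OF smooth_\<rho>, of UNIV]]) auto
  qed
  then show ?thesis by (simp only: mollify_eq grad_eq)
qed

lemma grad_mollify_inner:
  fixes U :: "'a::euclidean_space \<Rightarrow> real"
  assumes smooth_\<rho>: "smooth_fun \<rho>" and cont_U: "continuous_on UNIV U" "compact S" "\<And>y. y \<notin> S \<Longrightarrow> U y = 0"
  shows "grad (mollify \<rho> U) x \<bullet> b = - (\<integral>y. U y * (grad \<rho> (y - x) \<bullet> b) \<partial>lborel)"
proof -
  have "integrable lborel (\<lambda>y. U y *\<^sub>R grad \<rho> (y - x))"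
  proof (rule integrable_compact_support[OF cont_U(2)])
    show "continuous_on S (\<lambda>y. U y *\<^sub>R grad \<rho> (y - x))"
      by (intro continuous_intros continuous_on_compose2[OF smooth_fun_continuous_on_grad[OF smooth_\<rho>, of UNIV]]
          continuous_on_subset[OF cont_U(1)]) auto
  qed (simp add: cont_U(3))
  from integral_inner_left[of b, OF this] show ?thesis
    using GDERIV_imp_grad_eq[OF GDERIV_mollify[OF smooth_\<rho> cont_U(1) compact_imp_bounded[OF cont_U(2)]
      cont_U(3)]]
    by (simp add: inner_minus_left)
qed

lemma smooth_fun_mollify:
  fixes U :: "'a::euclidean_space \<Rightarrow> real"
  assumes "smooth_fun \<rho>" and cont_U: "continuous_on UNIV U" "compact S" "\<And>y. y \<notin> S \<Longrightarrow> U y = 0"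
  shows "smooth_fun (mollify \<rho> U)"
proof -
  have GDERIV: "GDERIV (mollify \<rho> U) x :> grad (mollify \<rho> U) x" if "smooth_fun \<rho>" for \<rho> x
    using GDERIV_mollify[OF that cont_U(1) compact_imp_bounded[OF cont_U(2)] cont_U(3)] GDERIV_imp_grad_eq
    by metis
  have "Ck_on k UNIV (mollify \<rho> U)" for k
    using assms(1)
  proof (induction k arbitrary: \<rho>)
    case 0
    then show ?case using GDERIV_imp_continuous_on[OF GDERIV] by simp
  next
    case (Suc k)
    show ?case
    proof (rule Ck_on_SucI[OF open_UNIV GDERIV[OF Suc.prems]])
      fix b :: 'a assume "b \<in> Basis"
      then have "smooth_fun (\<lambda>z. - (grad \<rho> z \<bullet> b))"
        using smooth_fun_grad[OF Suc.prems] by (simp add: smooth_fun_iff_Ck_on Ck_on_minus)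
      moreover have "mollify (\<lambda>z. - (grad \<rho> z \<bullet> b)) U = (\<lambda>x. grad (mollify \<rho> U) x \<bullet> b)"
        by (simp add: fun_eq_iff grad_mollify_inner[OF Suc.prems cont_U] mollify_def mult.commute)
      ultimately show "Ck_on k UNIV (\<lambda>x. grad (mollify \<rho> U) x \<bullet> b)"
        using Suc.IH by metis
    qed
  qed
  then show ?thesis by (simp add: smooth_fun_iff_Ck_on)
qed

locale mollifier =
  fixes \<rho> :: "'a::euclidean_space \<Rightarrow> real" and e :: real
  assumes smooth: "smooth_fun \<rho>" and nonneg: "\<rho> z \<ge> 0"
    and eq_0: "e \<le> norm z \<Longrightarrow> \<rho> z = 0" and integral_eq_1: "integral\<^sup>L lborel \<rho> = 1"
begin

lemma continuous: "continuous_on S \<rho>"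
  using smooth by (rule smooth_fun_imp_continuous_on)

lemma borel[measurable]: "\<rho> \<in> borel_measurable borel"
  using continuous by (rule borel_measurable_continuous_onI)

lemma integrable: "integrable lborel \<rho>"
  by (rule integrable_compact_support[OF compact_cball[of 0 e] continuous]) (auto intro: eq_0)

lemma tsupport_translate: "tsupport (\<lambda>y. \<rho> (y - x)) \<subseteq> cball x e"
  unfolding tsupport_def
  by (intro closure_minimal) (use eq_0 in \<open>force simp: dist_norm norm_minus_commute\<close>, simp)

lemma smooth_fun_translate: "smooth_fun (\<lambda>y. \<rho> (y - x))"
  using smooth Ck_on_translate[of _ \<rho> "- x"] by (simp add: smooth_fun_iff_Ck_on)

lemma test_fun_translate:
  assumes "cball x e \<subseteq> \<Omega>"
  shows "test_fun \<Omega> (\<lambda>y. \<rho> (y - x))"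
proof -
  have "compact (tsupport (\<lambda>y. \<rho> (y - x)))"
    using bounded_subset[OF bounded_cball tsupport_translate] closed_tsupport
    by (simp add: compact_eq_bounded_closed)
  with assms tsupport_translate[of x] show ?thesis
    by (auto simp: test_fun_def smooth_fun_translate)
qed

lemma integrable_scaleR:
  fixes f :: "'a \<Rightarrow> 'b::euclidean_space"
  assumes "integrable lborel f"
  shows "integrable lborel (\<lambda>y. \<rho> (y - x) *\<^sub>R f y)"
proof -
  obtain C where bound_C: "C > 0" "\<And>z. norm (\<rho> z) \<le> C"
    using bounded_continuous_compact_support[OF compact_cball[of 0 e] continuous] eq_0
    by (metis dist_0_norm less_imp_le mem_cball not_le)
  show ?thesis
  proof (rule Bochner_Integration.integrable_bound)
    show "integrable lborel (\<lambda>y. C * norm (f y))" using assms by simp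
    show "AE y in lborel. norm (\<rho> (y - x) *\<^sub>R f y) \<le> norm (C * norm (f y))"
      using bound_C by (auto intro!: mult_right_mono simp: abs_mult)
  qed (use assms in measurable)
qed

lemma mollify_const: "mollify \<rho> (\<lambda>_. c) x = c"
proof -
  have "mollify \<rho> (\<lambda>_. c) x = (\<integral>z. \<rho> z *\<^sub>R c \<partial>lborel)"
    by (rule mollify_eq_integral_translate) measurable
  also have "\<dots> = c" using integrable integral_eq_1 by simp
  finally show ?thesis .
qed

lemma integrable_translate: "integrable lborel (\<lambda>y. \<rho> (y - x))"
  by (rule integrable_compact_support[OF compact_cball[of x e]])
     (auto intro!: eq_0 continuous_on_compose2[OF continuous[of UNIV]] continuous_intros simp: dist_norm
       norm_minus_commute)

lemma mollify_diff_const: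
  fixes f :: "'a \<Rightarrow> 'b::euclidean_space"
  assumes "integrable lborel (\<lambda>y. \<rho> (y - x) *\<^sub>R f y)"
  shows "mollify \<rho> (\<lambda>y. f y - c) x = mollify \<rho> f x - c"
proof -
  have "mollify \<rho> (\<lambda>y. f y - c) x = mollify \<rho> f x - mollify \<rho> (\<lambda>_. c) x"
    unfolding mollify_def scaleR_diff_right
    by (rule Bochner_Integration.integral_diff[OF assms]) (use integrable_translate in simp)
  then show ?thesis by (simp add: mollify_const)
qed

lemma norm_mollify_le:
  assumes "\<And>y. norm (y - x) < e \<Longrightarrow> norm (f y) \<le> c" and "c \<ge> 0"
  shows "norm (mollify \<rho> f x) \<le> c"
proof -
  have "norm (\<rho> (y - x) *\<^sub>R f y) \<le> \<rho> (y - x) * c" for y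
    using assms nonneg[of "y - x"] eq_0[of "y - x"]
    by (cases "norm (y - x) < e") (auto intro: mult_left_mono)
  then have "norm (mollify \<rho> f x) \<le> (\<integral>y. \<rho> (y - x) * c \<partial>lborel)"
    unfolding mollify_def
    by (intro order_trans[OF integral_norm_bound] integral_mono')
       (use integrable_translate nonneg assms(2) in auto)
  also have "\<dots> = c"
    using mollify_const[of c x] by (simp add: mollify_def)
  finally show ?thesis .
qed

lemma dist_mollify_le:
  fixes f :: "'a \<Rightarrow> 'b::euclidean_space"
  assumes "continuous_on UNIV f" "\<And>y. norm (y - x) < e \<Longrightarrow> dist (f y) (f x) \<le> c" and "c \<ge> 0"
  shows "dist (mollify \<rho> f x) (f x) \<le> c"
proof -
  have "integrable lborel (\<lambda>y. \<rho> (y - x) *\<^sub>R f y)"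
    by (rule integrable_compact_support[OF compact_cball[of x e]])
       (auto intro!: eq_0 continuous_on_compose2[OF continuous[of UNIV]] continuous_on_subset[OF assms(1)]
         continuous_intros simp: dist_norm norm_minus_commute)
  then show ?thesis
    using norm_mollify_le[of x "\<lambda>y. f y - f x" c] assms(2,3) by (simp add: mollify_diff_const dist_norm)
qed

lemma Jensen_norm_powr:
  fixes g :: "'a \<Rightarrow> 'b::euclidean_space"
  assumes m_gt_1: "m > 1" and [measurable]: "g \<in> borel_measurable borel"
    and integrable_g: "integrable lborel (\<lambda>z. \<rho> z *\<^sub>R g z)"
  shows "ennreal (norm (\<integral>z. \<rho> z *\<^sub>R g z \<partial>lborel) powr m) \<le> (\<integral>\<^sup>+z. ennreal (\<rho> z * norm (g z) powr m) \<partial>lborel)"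
proof (cases "(\<integral>\<^sup>+z. ennreal (\<rho> z * norm (g z) powr m) \<partial>lborel) < \<infinity>")
  case True
  define t where "t = (\<integral>z. \<rho> z * norm (g z) \<partial>lborel)"
  have integrable_weighted_norm: "integrable lborel (\<lambda>z. \<rho> z * norm (g z))"
    using integrable_norm[OF integrable_g] nonneg by simp
  have integrable_weighted_powr: "integrable lborel (\<lambda>z. \<rho> z * norm (g z) powr m)"
    by (rule integrableI_nonneg) (use True nonneg in auto)
  have "norm (\<integral>z. \<rho> z *\<^sub>R g z \<partial>lborel) \<le> t"
    using integral_norm_bound[of lborel "\<lambda>z. \<rho> z *\<^sub>R g z"] nonneg by (simp add: t_def)
  then have "norm (\<integral>z. \<rho> z *\<^sub>R g z \<partial>lborel) powr m \<le> t powr m"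
    using m_gt_1 by (intro powr_mono2) auto
  also have "t powr m = (\<integral>z. (t powr m - m * t powr (m - 1) * t) * \<rho> z
      + m * t powr (m - 1) * (\<rho> z * norm (g z)) \<partial>lborel)"
    using integrable integrable_weighted_norm by (simp add: integral_eq_1 t_def[symmetric])
  also have "\<dots> \<le> (\<integral>z. \<rho> z * norm (g z) powr m \<partial>lborel)"
  proof (rule integral_mono)
    fix z
    have "t \<ge> 0" unfolding t_def using nonneg by (intro Bochner_Integration.integral_nonneg) auto
    from mult_left_mono[OF powr_ge_tangent[OF norm_ge_zero[of "g z"] this m_gt_1] nonneg[of z]]
    show "(t powr m - m * t powr (m - 1) * t) * \<rho> z + m * t powr (m - 1) * (\<rho> z * norm (g z))
        \<le> \<rho> z * norm (g z) powr m"
      by (simp add: algebra_simps)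
  qed (use integrable integrable_weighted_norm integrable_weighted_powr in auto)
  finally show ?thesis
    using nn_integral_eq_integral[OF integrable_weighted_powr] nonneg by (simp add: ennreal_leI)
qed (simp add: not_less top_unique)

lemma Lm_dist_powr_mollify_le:
  fixes f :: "'a \<Rightarrow> 'b::euclidean_space"
  assumes m_gt_1: "m > 1" and [measurable]: "f \<in> borel_measurable borel" and integrable_f: "integrable lborel f"
    and close: "\<And>z. norm z < e \<Longrightarrow> Lm_dist_powr m (\<lambda>x. f (x + z)) f \<le> c"
  shows "Lm_dist_powr m (mollify \<rho> f) f \<le> c"
proof -
  have "ennreal (norm (mollify \<rho> f x - f x) powr m)
    \<le> (\<integral>\<^sup>+z. ennreal (\<rho> z * norm (f (x + z) - f x) powr m) \<partial>lborel)" for x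
  proof -
    have "integrable lborel (\<lambda>y. \<rho> (y - x) *\<^sub>R (f y - f x))"
      using integrable_scaleR[OF integrable_f] integrable_translate by (simp add: scaleR_diff_right)
    then have "integrable (distr lborel borel ((+) x)) (\<lambda>y. \<rho> (y - x) *\<^sub>R (f y - f x))"
      by (simp add: lborel_distr_plus)
    then have "integrable lborel (\<lambda>z. \<rho> z *\<^sub>R (f (x + z) - f x))"
      by (subst (asm) integrable_distr_eq) (auto simp: add_diff_cancel_left')
    from Jensen_norm_powr[OF m_gt_1 _ this] show ?thesis
      using mollify_diff_const[OF integrable_scaleR[OF integrable_f], of "f x" x]
        mollify_eq_integral_translate[of \<rho> "\<lambda>y. f y - f x" x]
      by (simp add: add.commute[of x])
  qed
  then have "Lm_dist_powr m (mollify \<rho> f) f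
      \<le> (\<integral>\<^sup>+x. (\<integral>\<^sup>+z. ennreal (\<rho> z * norm (f (x + z) - f x) powr m) \<partial>lborel) \<partial>lborel)"
    unfolding Lm_dist_powr_def by (rule nn_integral_mono)
  also have "\<dots> = (\<integral>\<^sup>+z. (\<integral>\<^sup>+x. ennreal (\<rho> z * norm (f (x + z) - f x) powr m) \<partial>lborel) \<partial>lborel)"
    by (rule lborel_pair.Fubini') measurable
  also have "\<dots> = (\<integral>\<^sup>+z. ennreal (\<rho> z) * Lm_dist_powr m (\<lambda>x. f (x + z)) f \<partial>lborel)"
    using nonneg by (simp add: ennreal_mult Lm_dist_powr_def nn_integral_cmult)
  also have "\<dots> \<le> (\<integral>\<^sup>+z. ennreal (\<rho> z) * c \<partial>lborel)"
    by (intro nn_integral_mono) (metis close eq_0 ennreal_0 mult_left_mono mult_zero_left not_less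
      order_refl zero_le)
  also have "\<dots> = c"
    using nn_integral_eq_integral[OF integrable] nonneg by (simp add: nn_integral_multc integral_eq_1)
  finally show ?thesis .
qed

end

lemma mollifier_exists:
  assumes "e > 0"
  obtains \<rho> :: "'a::euclidean_space \<Rightarrow> real" where "mollifier \<rho> e"
proof -
  define bump where "bump z = flat_exp 0 (e\<^sup>2 - z \<bullet> z)" for z :: 'a
  have smooth: "smooth_fun bump"
    unfolding bump_def smooth_fun_iff_Ck_on
    using Ck_on_compose[OF open_UNIV open_UNIV subset_UNIV Ck_on_flat_exp
        Ck_on_diff[OF open_UNIV Ck_on_const[OF open_UNIV] Ck_on_inner_self]] by blast
  have nonneg: "bump z \<ge> 0" for z
    by (simp add: bump_def flat_exp_nonneg)
  have eq_0: "bump z = 0" if "e \<le> norm z" for z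
    using power_mono[OF that, of 2] assms by (simp add: bump_def flat_exp_eq_0 power2_norm_eq_inner)
  have integrable_bump: "integrable lborel bump"
    by (rule integrable_compact_support[OF compact_cball[of 0 e] smooth_fun_imp_continuous_on[OF smooth]])
       (auto intro: eq_0)
  have "integral\<^sup>L lebesgue bump > 0"
  proof (rule integral_pos_of_pos_on_open[of _ "ball 0 e"])
    show "integrable lebesgue bump"
      using integrable_bump by (simp add: integrable_completion)
    show "bump z > 0" if "z \<in> ball 0 e" for z
      using that power_strict_mono[of "norm z" e 2] by (simp add: bump_def flat_exp_pos power2_norm_eq_inner)
  qed (use assms nonneg in auto)
  then have integral_bump_pos: "integral\<^sup>L lborel bump > 0"
    using integrable_bump by (simp add: integral_completion)
  have "mollifier (\<lambda>z. bump z / integral\<^sup>L lborel bump) e"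
  proof
    have "smooth_fun (\<lambda>z. (1 / integral\<^sup>L lborel bump) * bump z)"
      using smooth unfolding smooth_fun_iff_Ck_on by (intro allI Ck_on_mult Ck_on_const) auto
    then show "smooth_fun (\<lambda>z. bump z / integral\<^sup>L lborel bump)" by simp
  qed (use assms integral_bump_pos eq_0 nonneg in auto)
  then show thesis by (rule that)
qed

section \<open>Sobolev functions and their smooth approximation\<close>

lemma Lloc_continuous:
  fixes f :: "'a::euclidean_space \<Rightarrow> real"
  assumes "continuous_on \<Omega> f" "r > 0"
  shows "Lloc r \<Omega> f"
proof -
  have "continuous_on \<Omega> (\<lambda>x. \<bar>f x\<bar> powr r)"
    using assms by (intro continuous_on_powr' continuous_on_rabs continuous_on_const) auto
  with assms(1) show ?thesis
    by (auto simp: Lloc_def intro: set_integrable_continuous_compact continuous_on_subset)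
qed

lemma W1loc_C1:
  fixes f :: "'a::euclidean_space \<Rightarrow> real"
  assumes "m > 0" "open \<Omega>" and deriv: "\<And>x. x \<in> \<Omega> \<Longrightarrow> GDERIV f x :> g x" and cont: "continuous_on \<Omega> g"
  shows "W1loc m \<Omega> f g"
proof -
  have "continuous_on \<Omega> f" using deriv by (rule GDERIV_imp_continuous_on)
  moreover have "continuous_on \<Omega> (\<lambda>x. norm (g x))" using cont by (rule continuous_on_norm)
  moreover have "(\<lambda>x. indicator \<Omega> x *\<^sub>R g x) \<in> borel_measurable borel"
    using borel_open[OF \<open>open \<Omega>\<close>] cont by (intro borel_measurable_continuous_on_indicator)
  then have "set_borel_measurable lebesgue \<Omega> g"
    unfolding set_borel_measurable_def by (intro measurable_completion) simp
  moreover have "(LINT x:\<Omega>|lebesgue. f x * frechet_derivative \<phi> (at x) b)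
    = - (LINT x:\<Omega>|lebesgue. (g x \<bullet> b) * \<phi> x)"
    if "test_fun \<Omega> \<phi>" "b \<in> Basis" for \<phi> and b
    using test_fun_partial_integration[OF \<open>open \<Omega>\<close> that(1) deriv cont, of b] that(2)
    by (simp add: grad_inner_Basis)
  ultimately show ?thesis
    using \<open>m > 0\<close> by (simp add: W1loc_def weak_grad_def Lloc_continuous)
qed

lemma borel_measurable_lebesgue_AE_eq:
  fixes g :: "'a::euclidean_space \<Rightarrow> 'b::euclidean_space"
  assumes "g \<in> borel_measurable lebesgue"
  obtains f where "f \<in> borel_measurable borel" "AE x in lebesgue. g x = f x"
proof -
  have "\<exists>h. h \<in> borel_measurable lborel \<and> (AE x in lborel. g x \<bullet> b = h x)" for b
    using completion_ex_borel_measurable_real[of "\<lambda>x. g x \<bullet> b" lborel] assms by auto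
  then obtain h where coord_h: "\<And>b. h b \<in> borel_measurable lborel" "\<And>b. AE x in lborel. g x \<bullet> b = h b x"
    by metis
  have "AE x in lborel. \<forall>b\<in>Basis. g x \<bullet> b = h b x"
    by (rule AE_finite_allI) (use coord_h in auto)
  then have "AE x in lborel. g x = (\<Sum>b\<in>Basis. h b x *\<^sub>R b)"
  proof eventually_elim
    case (elim x)
    then have "(\<Sum>b\<in>Basis. h b x *\<^sub>R b) = (\<Sum>b\<in>Basis. (g x \<bullet> b) *\<^sub>R b)" by simp
    then show ?case by (simp add: euclidean_representation)
  qed
  then have "AE x in lebesgue. g x = (\<Sum>b\<in>Basis. h b x *\<^sub>R b)"
    by (rule AE_completion)
  moreover have "(\<lambda>x. \<Sum>b\<in>Basis. h b x *\<^sub>R b) \<in> borel_measurable borel"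
    using coord_h(1) by auto
  ultimately show thesis using that by blast
qed

lemma weak_grad_indicator_measurable:
  fixes u :: "'a::euclidean_space \<Rightarrow> real"
  assumes "weak_grad \<Omega> u Du"
  shows "(\<lambda>x. indicator \<Omega> x *\<^sub>R Du x) \<in> borel_measurable lebesgue"
  using assms by (simp add: weak_grad_def set_borel_measurable_def)

lemma weak_grad_measurable_subset:
  fixes u :: "'a::euclidean_space \<Rightarrow> real"
  assumes "weak_grad \<Omega> u Du" "K \<subseteq> \<Omega>" and [measurable]: "K \<in> sets borel"
  shows "(\<lambda>x. indicator K x *\<^sub>R Du x) \<in> borel_measurable lebesgue"
proof -
  have "indicator K x *\<^sub>R (indicator \<Omega> x *\<^sub>R Du x) = indicator K x *\<^sub>R Du x" for x
    using assms(2) by (auto simp: indicator_def)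
  moreover have "(\<lambda>x. indicator K x *\<^sub>R (indicator \<Omega> x *\<^sub>R Du x)) \<in> borel_measurable lebesgue"
    by (intro borel_measurable_scaleR weak_grad_indicator_measurable[OF assms(1)]
      borel_measurable_indicator) auto
  ultimately show ?thesis by (simp only:)
qed

lemma integrable_lborel_cong_AE:
  fixes f g :: "'a::euclidean_space \<Rightarrow> 'b::{banach,second_countable_topology}"
  assumes "integrable lebesgue g" "f \<in> borel_measurable borel" "AE x in lebesgue. g x = f x"
  shows "integrable lborel f"
proof -
  have "integrable lebesgue f"
    by (rule integrable_cong_AE_imp[OF assms(1) _ assms(3)]) (simp add: assms(2) measurable_completion)
  then show ?thesis
    using assms(2) by (simp add: integrable_completion)
qed

lemma W1loc_gradient_borel_representative:
  fixes u :: "'a::euclidean_space \<Rightarrow> real"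
  assumes W1loc_u: "W1loc m \<Omega> u Du" and compact_K: "compact K" "K \<subseteq> \<Omega>"
  obtains f where "f \<in> borel_measurable borel" "AE x in lebesgue. indicator K x *\<^sub>R Du x = f x"
    "integrable lborel f" "(\<integral>\<^sup>+x. ennreal (norm (f x) powr m) \<partial>lborel) < \<infinity>"
proof -
  have "K \<in> sets borel" using compact_K(1) by (intro borel_closed compact_imp_closed)
  then have borel_Du: "(\<lambda>x. indicator K x *\<^sub>R Du x) \<in> borel_measurable lebesgue"
    using W1loc_u compact_K(2) by (intro weak_grad_measurable_subset) (auto simp: W1loc_def)
  then obtain f where borel_f: "f \<in> borel_measurable borel"
    and AE_eq_f: "AE x in lebesgue. indicator K x *\<^sub>R Du x = f x"
    using borel_measurable_lebesgue_AE_eq by blast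
  have integrable_powr_Du: "set_integrable lebesgue K (\<lambda>x. norm (Du x))"
    "set_integrable lebesgue K (\<lambda>x. norm (Du x) powr m)"
    using W1loc_u compact_K by (auto simp: W1loc_def Lloc_def)
  have "integrable lebesgue (\<lambda>x. norm (indicator K x *\<^sub>R Du x))"
    using integrable_powr_Du(1) by (simp add: set_integrable_def)
  then have "integrable lebesgue (\<lambda>x. indicator K x *\<^sub>R Du x)"
    using integrable_norm_iff[OF borel_Du] by blast
  from integrable_lborel_cong_AE[OF this borel_f AE_eq_f] have "integrable lborel f" .
  moreover have "integrable lborel (\<lambda>x. norm (f x) powr m)"
  proof (rule integrable_lborel_cong_AE[OF integrable_powr_Du(2)[unfolded set_integrable_def]])
    show "AE x in lebesgue. indicator K x *\<^sub>R norm (Du x) powr m = norm (f x) powr m"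
      using AE_eq_f
    proof eventually_elim
      case (elim x)
      then show ?case by (cases "x \<in> K") auto
    qed
  qed (use borel_f in measurable)
  then have "(\<integral>\<^sup>+x. ennreal (norm (f x) powr m) \<partial>lborel) < \<infinity>"
    by (simp add: nn_integral_eq_integral)
  ultimately show thesis using that borel_f AE_eq_f by blast
qed

lemma weak_grad_test_fun:
  assumes "weak_grad \<Omega> u Du" "test_fun \<Omega> \<phi>" "b \<in> Basis"
  shows "(LINT x:\<Omega>|lebesgue. u x * (grad \<phi> x \<bullet> b)) = - (LINT x:\<Omega>|lebesgue. (Du x \<bullet> b) * \<phi> x)"
  using assms by (simp add: weak_grad_def grad_inner_Basis)

context mollifier
begin

lemma grad_translate: "grad (\<lambda>y. \<rho> (y - x)) y = grad \<rho> (y - x)"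
  using GDERIV_translate[of \<rho> y "- x", OF smooth_fun_GDERIV[OF smooth]] by (simp add: GDERIV_imp_grad_eq)

lemma eq_0_translate:
  assumes "y \<notin> cball x e"
  shows "\<rho> (y - x) = 0" "grad \<rho> (y - x) = 0"
proof -
  have "y \<notin> tsupport (\<lambda>y. \<rho> (y - x))"
    using assms tsupport_translate by blast
  then show "\<rho> (y - x) = 0" "grad \<rho> (y - x) = 0"
    using eq_0_outside_tsupport grad_eq_0_outside_tsupport grad_translate by metis+
qed

lemma weak_grad_integral_translate:
  fixes u :: "'a \<Rightarrow> real"
  assumes weak: "weak_grad \<Omega> u Du" and sub: "cball x e \<subseteq> \<Omega>"
    and [measurable]: "f \<in> borel_measurable borel" and integrable_f: "integrable lborel f"
    and AE_eq_f: "AE y in lebesgue. y \<in> cball x e \<longrightarrow> Du y = f y"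
  shows "(LINT y:\<Omega>|lebesgue. (Du y \<bullet> b) * \<rho> (y - x)) = mollify \<rho> f x \<bullet> b"
proof -
  have "(LINT y:\<Omega>|lebesgue. (Du y \<bullet> b) * \<rho> (y - x)) = (\<integral>y. (\<rho> (y - x) *\<^sub>R f y) \<bullet> b \<partial>lebesgue)"
    unfolding set_lebesgue_integral_def
  proof (rule integral_cong_AE)
    have "(\<lambda>y. \<rho> (y - x)) \<in> borel_measurable lebesgue"
      by (intro measurable_completion) measurable
    then have "(\<lambda>y. ((indicator \<Omega> y *\<^sub>R Du y) \<bullet> b) * \<rho> (y - x)) \<in> borel_measurable lebesgue"
      by (intro borel_measurable_times borel_measurable_inner weak_grad_indicator_measurable[OF weak]) auto
    then show "(\<lambda>y. indicator \<Omega> y *\<^sub>R ((Du y \<bullet> b) * \<rho> (y - x))) \<in> borel_measurable lebesgue"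
      by (simp add: mult_ac)
    show "(\<lambda>y. (\<rho> (y - x) *\<^sub>R f y) \<bullet> b) \<in> borel_measurable lebesgue"
      by (intro measurable_completion) measurable
    show "AE y in lebesgue. indicator \<Omega> y *\<^sub>R ((Du y \<bullet> b) * \<rho> (y - x)) = (\<rho> (y - x) *\<^sub>R f y) \<bullet> b"
      using AE_eq_f
    proof eventually_elim
      case (elim y)
      show ?case
      proof (cases "y \<in> cball x e")
        case True
        with elim sub have "y \<in> \<Omega>" "Du y = f y" by auto
        then show ?thesis by (simp add: mult.commute)
      qed (simp add: eq_0_translate)
    qed
  qed
  also have "\<dots> = (\<integral>y. (\<rho> (y - x) *\<^sub>R f y) \<bullet> b \<partial>lborel)"
    by (rule integral_completion) measurable
  also have "\<dots> = mollify \<rho> f x \<bullet> b"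
    unfolding mollify_def by (rule integral_inner_left) (rule integrable_scaleR[OF integrable_f])
  finally show ?thesis .
qed

lemma grad_mollify_eq:
  fixes u U :: "'a \<Rightarrow> real"
  assumes weak: "weak_grad \<Omega> u Du" and sub: "cball x e \<subseteq> \<Omega>"
    and cont_U: "continuous_on UNIV U" "compact S" "\<And>y. y \<notin> S \<Longrightarrow> U y = 0" "\<And>y. y \<in> cball x e \<Longrightarrow> U y = u y"
    and borel_f: "f \<in> borel_measurable borel" "integrable lborel f"
      "AE y in lebesgue. y \<in> cball x e \<longrightarrow> Du y = f y"
  shows "grad (mollify \<rho> U) x = mollify \<rho> f x"
proof (rule euclidean_eqI)
  fix b :: 'a assume b_Basis: "b \<in> Basis"
  have cont: "continuous_on (cball x e) (\<lambda>y. U y * (grad \<rho> (y - x) \<bullet> b))"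
    by (intro continuous_intros continuous_on_subset[OF cont_U(1)]
        continuous_on_compose2[OF smooth_fun_continuous_on_grad[OF smooth, of UNIV]]) auto
  have "grad (mollify \<rho> U) x \<bullet> b = - (\<integral>y. U y * (grad \<rho> (y - x) \<bullet> b) \<partial>lborel)"
    by (rule grad_mollify_inner[OF smooth cont_U(1-3)])
  also have "(\<integral>y. U y * (grad \<rho> (y - x) \<bullet> b) \<partial>lborel) = (LINT y:\<Omega>|lebesgue. U y * (grad \<rho> (y - x) \<bullet> b))"
    by (rule set_lebesgue_integral_compact_support[OF compact_cball sub cont, symmetric])
       (simp add: eq_0_translate)
  also have "\<dots> = (LINT y:\<Omega>|lebesgue. u y * (grad (\<lambda>y. \<rho> (y - x)) y \<bullet> b))"
    using cont_U(4) eq_0_translate(2) unfolding grad_translate set_lebesgue_integral_def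
    by (intro Bochner_Integration.integral_cong refl) (metis inner_zero_left mult_zero_right)
  also have "\<dots> = - (LINT y:\<Omega>|lebesgue. (Du y \<bullet> b) * \<rho> (y - x))"
    by (rule weak_grad_test_fun[OF weak test_fun_translate[OF sub] b_Basis])
  also have "(LINT y:\<Omega>|lebesgue. (Du y \<bullet> b) * \<rho> (y - x)) = mollify \<rho> f x \<bullet> b"
    by (rule weak_grad_integral_translate[OF weak sub borel_f])
  finally show "grad (mollify \<rho> U) x \<bullet> b = mollify \<rho> f x \<bullet> b" by simp
qed

lemma grad_mollify_error_le:
  fixes u U :: "'a \<Rightarrow> real"
  assumes m_gt_1: "m > 1" and weak: "weak_grad \<Omega> u Du" and sub: "K \<subseteq> \<Omega>" "\<And>x. x \<in> A \<Longrightarrow> cball x e \<subseteq> K" "A \<subseteq> K"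
    and cont_U: "continuous_on UNIV U" "compact S" "\<And>y. y \<notin> S \<Longrightarrow> U y = 0" "\<And>y. y \<in> K \<Longrightarrow> U y = u y"
    and borel_f: "f \<in> borel_measurable borel" "integrable lborel f"
      "AE y in lebesgue. indicator K y *\<^sub>R Du y = f y"
    and close: "\<And>z. norm z < e \<Longrightarrow> Lm_dist_powr m (\<lambda>x. f (x + z)) f \<le> c"
  shows "(\<integral>\<^sup>+x. indicator A x * ennreal (norm (grad (mollify \<rho> U) x - Du x) powr m) \<partial>lebesgue) \<le> c"
proof -
  have "grad (mollify \<rho> U) x = mollify \<rho> f x" if "x \<in> A" for x
  proof (rule grad_mollify_eq[OF weak _ cont_U(1-3) _ borel_f(1,2)])
    show "AE y in lebesgue. y \<in> cball x e \<longrightarrow> Du y = f y"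
      using borel_f(3) by eventually_elim (use sub(2)[OF that] in auto)
    show "cball x e \<subseteq> \<Omega>" "\<And>y. y \<in> cball x e \<Longrightarrow> U y = u y"
      using sub(2)[OF that] sub(1) cont_U(4) by auto
  qed
  then have "(\<integral>\<^sup>+x. indicator A x * ennreal (norm (grad (mollify \<rho> U) x - Du x) powr m) \<partial>lebesgue)
      \<le> (\<integral>\<^sup>+x. ennreal (norm (mollify \<rho> f x - f x) powr m) \<partial>lebesgue)"
  proof (intro nn_integral_mono_AE, use borel_f(3) in eventually_elim)
    case (elim x)
    show ?case
    proof (cases "x \<in> A")
      case True
      with elim sub(3) have "Du x = f x" by auto
      with elim True show ?thesis by simp
    qed simp
  qed
  also have "\<dots> \<le> c"
    using Lm_dist_powr_mollify_le[OF m_gt_1 borel_f(1,2) close]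
    by (simp add: nn_integral_completion Lm_dist_powr_def)
  finally show ?thesis .
qed

end

lemma continuous_extension_compact_support:
  fixes u :: "'a::euclidean_space \<Rightarrow> real"
  assumes compact_K: "compact K" and cont_u: "continuous_on K u"
  obtains U S where "continuous_on UNIV U" "\<And>x. x \<in> K \<Longrightarrow> U x = u x" "compact S" "\<And>x. x \<notin> S \<Longrightarrow> U x = 0"
proof -
  obtain R where K_sub_ball: "K \<subseteq> ball 0 R"
    using compact_imp_bounded[OF compact_K] bounded_subset_ballD by blast
  define u0 where "u0 x = (if x \<in> K then u x else 0)" for x
  have "continuous_on (K \<union> - ball 0 R) u0"
    unfolding u0_def by (rule continuous_on_cases)
      (use compact_imp_closed[OF compact_K] cont_u K_sub_ball in auto)
  moreover have "closed (K \<union> - ball 0 R)"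
    using compact_imp_closed[OF compact_K] by (intro closed_Un closed_Compl open_ball)
  ultimately obtain U where cont_U: "continuous_on UNIV U" "\<And>x. x \<in> K \<union> - ball 0 R \<Longrightarrow> U x = u0 x"
    using Tietze_unbounded[of "K \<union> - ball 0 R" u0 UNIV] by auto
  show thesis
  proof (rule that[OF cont_U(1)])
    show "U x = u x" if "x \<in> K" for x using cont_U(2)[of x] that by (simp add: u0_def)
    show "U x = 0" if "x \<notin> cball 0 R" for x using cont_U(2)[of x] that K_sub_ball by (auto simp: u0_def)
  qed (rule compact_cball)
qed

lemma uniform_radius_on_compact:
  fixes \<Omega> :: "'a::euclidean_space set"
  assumes "open \<Omega>" "compact A" "A \<subseteq> \<Omega>"
  obtains d K where "d > 0" "compact K" "K \<subseteq> \<Omega>" "\<And>x. x \<in> A \<Longrightarrow> cball x d \<subseteq> K"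
proof -
  obtain d where d_radius: "d > 0" "(\<Union>x\<in>A. cball x d) \<subseteq> \<Omega>"
    using compact_subset_open_imp_cball_epsilon_subset[OF assms(2,1,3)] by blast
  define K where "K = {x + z | x z. x \<in> A \<and> z \<in> cball 0 d}"
  have "compact K" unfolding K_def by (rule compact_sums[OF assms(2) compact_cball])
  moreover have "K \<subseteq> \<Omega>"
    using d_radius(2) by (force simp: K_def dist_norm)
  moreover have "cball x d \<subseteq> K" if "x \<in> A" for x
  proof
    fix y assume "y \<in> cball x d"
    with that show "y \<in> K"
      unfolding K_def by (intro CollectI exI[of _ x] exI[of _ "y - x"])
        (auto simp: dist_norm norm_minus_commute)
  qed
  ultimately show thesis using that d_radius(1) by blast
qed

lemma mollification_radius:
  fixes U :: "'a::euclidean_space \<Rightarrow> real" and f :: "'a \<Rightarrow> 'b::euclidean_space"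
  assumes m_gt_1: "m > 1" and "\<eta> > 0" and compact_K: "compact K" and cont_U: "continuous_on K U"
    and borel_f: "f \<in> borel_measurable borel" "(\<integral>\<^sup>+x. ennreal (norm (f x) powr m) \<partial>lborel) < \<infinity>"
  obtains e where "e > 0" "\<And>x y. x \<in> K \<Longrightarrow> y \<in> K \<Longrightarrow> dist y x < e \<Longrightarrow> dist (U y) (U x) \<le> \<eta>"
    "\<And>z. norm z < e \<Longrightarrow> Lm_dist_powr m (\<lambda>x. f (x + z)) f \<le> ennreal \<eta>"
proof -
  have "eventually (\<lambda>z. Lm_dist_powr m (\<lambda>x. f (x + z)) f < ennreal \<eta>) (at 0)"
    using order_tendstoD(2)[OF Lm_translation_tendsto[OF _ borel_f], of "ennreal \<eta>"] m_gt_1 \<open>\<eta> > 0\<close> by simp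
  then obtain d where translation_d: "d > 0" "\<And>z. z \<noteq> 0 \<Longrightarrow> norm z < d \<Longrightarrow> Lm_dist_powr m (\<lambda>x. f (x + z)) f
    < ennreal \<eta>"
    by (auto simp: eventually_at dist_norm)
  have "uniformly_continuous_on K U"
    using cont_U compact_K by (rule compact_uniformly_continuous)
  then obtain d' where continuity_d: "d' > 0" "\<And>x y. x \<in> K \<Longrightarrow> y \<in> K \<Longrightarrow> dist y x < d' \<Longrightarrow> dist (U y) (U x) < \<eta>"
    using \<open>\<eta> > 0\<close> unfolding uniformly_continuous_on_def by metis
  show thesis
  proof (rule that[of "min d d'"])
    show "Lm_dist_powr m (\<lambda>x. f (x + z)) f \<le> ennreal \<eta>" if "norm z < min d d'" for z
      using translation_d(2)[of z] that by (cases "z = 0") (auto simp: Lm_dist_powr_def)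
    show "dist (U y) (U x) \<le> \<eta>" if "x \<in> K" "y \<in> K" "dist y x < min d d'" for x y
      using continuity_d(2)[of x y] that by simp
  qed (use translation_d(1) continuity_d(1) in simp)
qed

lemma W1loc_smooth_approx:
  fixes u :: "'a::euclidean_space \<Rightarrow> real"
  assumes m_gt_1: "m > 1" and open_\<Omega>: "open \<Omega>" and cont_u: "continuous_on \<Omega> u" and W1loc_u: "W1loc m \<Omega> u Du"
    and compact_A: "compact A" "A \<subseteq> \<Omega>" and \<eta>_pos: "\<eta> > 0"
  obtains v where "smooth_fun v" "\<And>x. x \<in> A \<Longrightarrow> \<bar>v x - u x\<bar> \<le> \<eta>"
    "(\<integral>\<^sup>+x. indicator A x * ennreal (norm (grad v x - Du x) powr m) \<partial>lebesgue) \<le> ennreal \<eta>"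
proof -
  obtain d K where d_pos: "d > 0" and compact_K: "compact K" "K \<subseteq> \<Omega>" "\<And>x. x \<in> A \<Longrightarrow> cball x d \<subseteq> K"
    using uniform_radius_on_compact[OF open_\<Omega> compact_A] by metis
  obtain U S where cont_U: "continuous_on UNIV U" "\<And>x. x \<in> K \<Longrightarrow> U x = u x" "compact S" "\<And>x. x \<notin> S \<Longrightarrow> U x = 0"
    using continuous_extension_compact_support[OF compact_K(1) continuous_on_subset[OF cont_u compact_K(2)]]
    by metis
  obtain f where borel_f: "f \<in> borel_measurable borel"
    and AE_eq_f: "AE x in lebesgue. indicator K x *\<^sub>R Du x = f x"
    and integrable_f: "integrable lborel f" "(\<integral>\<^sup>+x. ennreal (norm (f x) powr m) \<partial>lborel) < \<infinity>"
    by (rule W1loc_gradient_borel_representative[OF W1loc_u compact_K(1,2)])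
  obtain e\<^sub>0 where e\<^sub>0_close: "e\<^sub>0 > 0" "\<And>x y. x \<in> K \<Longrightarrow> y \<in> K \<Longrightarrow> dist y x < e\<^sub>0 \<Longrightarrow> dist (U y) (U x) \<le> \<eta>"
    "\<And>z. norm z < e\<^sub>0 \<Longrightarrow> Lm_dist_powr m (\<lambda>x. f (x + z)) f \<le> ennreal \<eta>"
    using mollification_radius[OF m_gt_1 \<eta>_pos compact_K(1) continuous_on_subset[OF cont_U(1) subset_UNIV]
      borel_f integrable_f(2)] by metis
  define e where "e = min d e\<^sub>0"
  have e_bounds: "e > 0" "e \<le> d" "e \<le> e\<^sub>0" using d_pos e\<^sub>0_close(1) by (auto simp: e_def)
  obtain \<rho> :: "'a \<Rightarrow> real" where "mollifier \<rho> e" using mollifier_exists[OF e_bounds(1)] .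
  then interpret mollifier \<rho> e .
  have ball_K: "cball x e \<subseteq> K" if "x \<in> A" for x
    using compact_K(3)[OF that] e_bounds(2) by (meson order_trans subset_cball)
  then have "A \<subseteq> K" using e_bounds(1) by (meson centre_in_cball less_imp_le subset_iff)
  have "\<bar>mollify \<rho> U x - u x\<bar> \<le> \<eta>" if "x \<in> A" for x
  proof -
    have "x \<in> K" using that \<open>A \<subseteq> K\<close> by blast
    have "dist (mollify \<rho> U x) (U x) \<le> \<eta>"
    proof (rule dist_mollify_le[OF cont_U(1)])
      fix y assume y_bounds: "norm (y - x) < e"
      then have "y \<in> K" using ball_K[OF that] by (auto simp: dist_norm norm_minus_commute)
      then show "dist (U y) (U x) \<le> \<eta>"
        using e\<^sub>0_close(2)[OF \<open>x \<in> K\<close>, of y] y_bounds e_bounds(3) by (simp add: dist_norm)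
    qed (use \<eta>_pos in simp)
    with cont_U(2)[OF \<open>x \<in> K\<close>] show ?thesis by (simp add: dist_real_def)
  qed
  moreover have "(\<integral>\<^sup>+x. indicator A x * ennreal (norm (grad (mollify \<rho> U) x - Du x) powr m) \<partial>lebesgue)
    \<le> ennreal \<eta>"
    using W1loc_u e_bounds(3) by (intro grad_mollify_error_le[OF m_gt_1 _ compact_K(2) ball_K \<open>A \<subseteq> K\<close>
      cont_U(1,3,4,2) borel_f integrable_f(1) AE_eq_f e\<^sub>0_close(3)])
      (auto simp: W1loc_def)
  ultimately show thesis
    using that[OF smooth_fun_mollify[OF smooth cont_U(1,3,4)]] by blast
qed

section \<open>The \<open>m\<close>-Laplacian of radial powers\<close>

definition m_flux :: "real \<Rightarrow> 'a::euclidean_space \<Rightarrow> 'a" where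
  "m_flux m a = norm a powr (m - 2) *\<^sub>R a"

lemma powr_minus_2_mult: "t \<ge> 0 \<Longrightarrow> t powr (a - 2) * t = t powr (a - 1)" for t :: real
  using powr_minus_1_mult[of t "a - 1"] by (simp add: algebra_simps)

lemma norm_m_flux: "norm (m_flux m a) = norm a powr (m - 1)"
  using powr_minus_2_mult[of "norm a" m] by (simp add: m_flux_def)

lemma m_flux_monotone:
  assumes "m > 1"
  shows "(m_flux m a - m_flux m b) \<bullet> (a - b) \<ge> 0"
proof -
  have "0 \<le> (norm a powr (m - 1) - norm b powr (m - 1)) * (norm a - norm b)"
    using assms powr_mono2[of "m - 1" "norm a" "norm b"] powr_mono2[of "m - 1" "norm b" "norm a"]
    by (cases "norm a \<le> norm b") (auto intro: mult_nonpos_nonpos)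
  also have "\<dots> = norm a powr (m - 2) * norm a * norm a + norm b powr (m - 2) * norm b * norm b
      - (norm a powr (m - 2) + norm b powr (m - 2)) * (norm a * norm b)"
    using powr_minus_2_mult[of "norm a" m] powr_minus_2_mult[of "norm b" m]
    by (simp add: algebra_simps)
  also have "\<dots> \<le> norm a powr (m - 2) * norm a * norm a + norm b powr (m - 2) * norm b * norm b
      - (norm a powr (m - 2) + norm b powr (m - 2)) * (a \<bullet> b)"
    using norm_cauchy_schwarz[of a b] by (intro diff_left_mono mult_left_mono) auto
  also have "\<dots> = (m_flux m a - m_flux m b) \<bullet> (a - b)"
    by (simp add: m_flux_def inner_diff_left inner_diff_right algebra_simps inner_commute
        dot_square_norm power2_eq_square)
  finally show ?thesis .
qed

lemma powr_le_one_plus_powr: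
  fixes t :: real
  assumes "t \<ge> 0" "0 \<le> a" "a \<le> b"
  shows "t powr a \<le> 1 + t powr b"
proof (cases "t \<le> 1")
  case True
  then have "t powr a \<le> 1"
    using assms powr_mono2[of a t 1] by simp
  then show ?thesis by (simp add: add_increasing2)
next
  case False
  then have "t powr a \<le> t powr b" using assms by (intro powr_mono) auto
  then show ?thesis by linarith
qed

lemma set_integrable_m_flux:
  fixes Du :: "'a::euclidean_space \<Rightarrow> 'a"
  assumes m_gt_1: "m > 1" and W1loc_u: "W1loc m \<Omega> u Du" and test: "test_fun \<Omega> \<phi>"
  shows "set_integrable lebesgue \<Omega> (\<lambda>x. m_flux m (Du x) \<bullet> grad \<phi> x)"
proof -
  define K where "K = tsupport \<phi>"
  have compact_K: "compact K" "K \<subseteq> \<Omega>" using test_funD[OF test] by (auto simp: K_def)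
  then have [measurable]: "K \<in> sets borel" by (intro borel_closed compact_imp_closed)
  obtain C where bound_C: "C > 0" "\<And>x. norm (grad \<phi> x) \<le> C"
    using test_fun_grad_bounded[OF test] by blast
  define D where "D x = indicator K x *\<^sub>R Du x" for x
  have [measurable]: "D \<in> borel_measurable lebesgue"
    using W1loc_u compact_K(2) unfolding D_def by (intro weak_grad_measurable_subset) (auto simp: W1loc_def)
  have [measurable]: "grad \<phi> \<in> borel_measurable lebesgue"
    using borel_measurable_continuous_onI[OF test_funD(5)[OF test]] by (simp add: measurable_completion)
  have "integrable lebesgue (\<lambda>x. indicat_real K x + indicator K x *\<^sub>R norm (Du x) powr m)"
    using W1loc_u compact_K emeasure_bounded_finite[OF compact_imp_bounded[OF compact_K(1)]]
    by (intro Bochner_Integration.integrable_add integrable_real_indicator)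
       (auto simp: W1loc_def Lloc_def set_integrable_def)
  then have "integrable lebesgue (\<lambda>x. C * (indicat_real K x + indicator K x *\<^sub>R norm (Du x) powr m))"
    by (rule integrable_mult_right)
  then have "integrable lebesgue (\<lambda>x. m_flux m (D x) \<bullet> grad \<phi> x)"
  proof (rule Bochner_Integration.integrable_bound)
    show "(\<lambda>x. m_flux m (D x) \<bullet> grad \<phi> x) \<in> borel_measurable lebesgue"
      unfolding m_flux_def by measurable
    have "norm (m_flux m (D x) \<bullet> grad \<phi> x) \<le> C * (indicat_real K x + indicator K x *\<^sub>R norm (Du x) powr m)"
      for x
    proof (cases "x \<in> K")
      case True
      have "norm (m_flux m (D x) \<bullet> grad \<phi> x) \<le> norm (Du x) powr (m - 1) * norm (grad \<phi> x)"
        using Cauchy_Schwarz_ineq2[of "m_flux m (D x)" "grad \<phi> x"] True by (simp add: norm_m_flux D_def)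
      also have "\<dots> \<le> (1 + norm (Du x) powr m) * C"
        using bound_C m_gt_1 by (intro mult_mono powr_le_one_plus_powr) auto
      finally show ?thesis using True by (simp add: mult.commute)
    qed (simp add: D_def m_flux_def)
    then show "AE x in lebesgue. norm (m_flux m (D x) \<bullet> grad \<phi> x)
        \<le> norm (C * (indicat_real K x + indicator K x *\<^sub>R norm (Du x) powr m))"
      using bound_C(1) by (intro AE_I2) (auto simp: abs_mult intro: order_trans)
  qed
  moreover have "m_flux m (D x) \<bullet> grad \<phi> x = indicator \<Omega> x *\<^sub>R (m_flux m (Du x) \<bullet> grad \<phi> x)" for x
    using compact_K(2) grad_eq_0_outside_tsupport[of x \<phi>] by (cases "x \<in> K") (auto simp: D_def K_def m_flux_def)
  ultimately show ?thesis by (simp add: set_integrable_def)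
qed

lemma GDERIV_norm_powr:
  fixes x :: "'a::euclidean_space"
  assumes "x \<noteq> 0"
  shows "GDERIV (\<lambda>x. norm x powr a) x :> (a * norm x powr (a - 2)) *\<^sub>R x"
proof (rule GDERIV_subst[OF GDERIV_DERIV_compose[OF GDERIV_norm[OF assms] has_real_derivative_powr]])
  show "(a * norm x powr (a - 1)) *\<^sub>R sgn x = (a * norm x powr (a - 2)) *\<^sub>R x"
    using assms powr_minus_2_mult[of "norm x" a] by (simp add: sgn_div_norm field_simps)
qed (use assms in simp)

lemma continuous_on_norm_powr: "0 \<notin> S \<Longrightarrow> continuous_on S (\<lambda>x::'a::real_normed_vector. norm x powr a)"
  by (intro continuous_intros) auto

lemma radial_power_field_integral:
  fixes \<phi> :: "'a::euclidean_space \<Rightarrow> real"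
  assumes open_\<Omega>: "open \<Omega>" "0 \<notin> \<Omega>" and test: "test_fun \<Omega> \<phi>"
  shows "(LINT x:\<Omega>|lebesgue. (norm x powr (- a) *\<^sub>R x) \<bullet> grad \<phi> x)
       = (a - real DIM('a)) * (LINT x:\<Omega>|lebesgue. norm x powr (- a) * \<phi> x)"
proof -
  define G where "G b x = norm x powr (- a) *\<^sub>R b + (x \<bullet> b) *\<^sub>R ((- a * norm x powr (- a - 2)) *\<^sub>R x)"
    for b x :: 'a
  have divergence_G: "(\<Sum>b\<in>Basis. G b x \<bullet> b) = (real DIM('a) - a) * norm x powr (- a)" if "x \<in> \<Omega>" for x
  proof -
    have "(\<Sum>b\<in>Basis. G b x \<bullet> b)
        = real DIM('a) * norm x powr (- a) - a * norm x powr (- a - 2) * (\<Sum>b\<in>Basis. (x \<bullet> b) * (x \<bullet> b))"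
      by (simp add: G_def inner_add_left inner_diff_left sum.distrib sum_subtractf sum_distrib_left mult_ac)
    also have "(\<Sum>b\<in>Basis. (x \<bullet> b) * (x \<bullet> b)) = norm x * norm x"
      by (simp add: euclidean_inner[symmetric] power2_norm_eq_inner[symmetric] power2_eq_square)
    also have "a * norm x powr (- a - 2) * (norm x * norm x) = a * norm x powr (- a)"
      using powr_minus_2_mult[of "norm x" "- a"] powr_minus_1_mult[of "norm x" "- a"]
      by (simp add: mult.assoc[symmetric])
    finally show ?thesis by (simp add: algebra_simps)
  qed
  have "(LINT x:\<Omega>|lebesgue. (norm x powr (- a) *\<^sub>R x) \<bullet> grad \<phi> x)
      = - (LINT x:\<Omega>|lebesgue. (\<Sum>b\<in>Basis. G b x \<bullet> b) * \<phi> x)"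
  proof (rule test_fun_divergence[OF open_\<Omega>(1) test])
    fix b x :: 'a assume "x \<in> \<Omega>"
    then have "x \<noteq> 0" using open_\<Omega>(2) by auto
    moreover have "GDERIV (\<lambda>x. x \<bullet> b) x :> b"
      by (auto simp: gderiv_def intro!: derivative_eq_intros)
    ultimately have "GDERIV (\<lambda>x. norm x powr (- a) * (x \<bullet> b)) x :> G b x"
      unfolding G_def by (intro GDERIV_mult GDERIV_norm_powr)
    then show "GDERIV (\<lambda>x. (norm x powr (- a) *\<^sub>R x) \<bullet> b) x :> G b x" by simp
  next
    show "continuous_on \<Omega> (G b)" for b
      unfolding G_def by (intro continuous_intros continuous_on_norm_powr open_\<Omega>(2))
  qed
  also have "\<dots> = - (LINT x:\<Omega>|lebesgue. (real DIM('a) - a) * (norm x powr (- a) * \<phi> x))"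
    using open_\<Omega>(1) divergence_G by (intro arg_cong[of _ _ uminus] set_lebesgue_integral_cong) auto
  also have "\<dots> = (a - real DIM('a)) * (LINT x:\<Omega>|lebesgue. norm x powr (- a) * \<phi> x)"
    unfolding set_integral_mult_right by (simp add: left_diff_distrib)
  finally show ?thesis .
qed

definition power_grad :: "real \<Rightarrow> real \<Rightarrow> 'a::euclidean_space \<Rightarrow> 'a" where
  "power_grad c \<gamma> x = (- (c * \<gamma> * norm x powr (- \<gamma> - 2))) *\<^sub>R x"

lemma GDERIV_power:
  fixes x :: "'a::euclidean_space"
  assumes "x \<noteq> 0"
  shows "GDERIV (\<lambda>x. c * norm x powr (- \<gamma>)) x :> power_grad c \<gamma> x"
  by (rule GDERIV_subst[OF GDERIV_mult[OF GDERIV_const GDERIV_norm_powr[OF assms]]]) (simp add: power_grad_def)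

lemma norm_power_grad:
  assumes "c > 0" "\<gamma> > 0"
  shows "norm (power_grad c \<gamma> x) = c * \<gamma> * norm x powr (- \<gamma> - 1)"
  using assms powr_minus_2_mult[of "norm x" "- \<gamma>"] by (simp add: power_grad_def)

lemma continuous_on_power_grad: "0 \<notin> S \<Longrightarrow> continuous_on S (power_grad c \<gamma>)"
  unfolding power_grad_def by (intro continuous_intros continuous_on_norm_powr)

lemma W1loc_power:
  assumes "m > 1" "open \<Omega>" "0 \<notin> \<Omega>"
  shows "W1loc m \<Omega> (\<lambda>x. c * norm x powr (- \<gamma>)) (power_grad c \<gamma>)"
  using assms by (intro W1loc_C1 continuous_on_power_grad) (auto intro!: GDERIV_power)

lemma m_flux_power_grad:
  assumes "c > 0" "\<gamma> > 0"
  shows "m_flux m (power_grad c \<gamma> x) = - ((c * \<gamma>) powr (m - 1)) *\<^sub>R (norm x powr (- (\<gamma> * (m - 1) + m)) *\<^sub>R x)"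
proof -
  have "norm (power_grad c \<gamma> x) powr (m - 2) = (c * \<gamma>) powr (m - 2) * norm x powr ((- \<gamma> - 1) * (m - 2))"
    using assms by (simp add: norm_power_grad powr_mult powr_powr)
  then have "m_flux m (power_grad c \<gamma> x) =
      - ((c * \<gamma>) powr (m - 2) * (c * \<gamma>)) *\<^sub>R ((norm x powr ((- \<gamma> - 1) * (m - 2)) * norm x powr (- \<gamma> - 2))
        *\<^sub>R x)"
    by (simp add: m_flux_def power_grad_def mult_ac)
  also have "(c * \<gamma>) powr (m - 2) * (c * \<gamma>) = (c * \<gamma>) powr (m - 1)"
    using assms powr_minus_2_mult[of "c * \<gamma>" m] by simp
  also have "norm x powr ((- \<gamma> - 1) * (m - 2)) * norm x powr (- \<gamma> - 2) = norm x powr (- (\<gamma> * (m - 1) + m))"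
    unfolding powr_add[symmetric] by (simp add: algebra_simps)
  finally show ?thesis .
qed

definition Kfun :: "real \<Rightarrow> nat \<Rightarrow> real \<Rightarrow> real" where
  "Kfun m N b = b powr (m - 1) * ((m - 1) * b + m - real N)"

lemma m_flux_power_grad_integral:
  fixes \<phi> :: "'a::euclidean_space \<Rightarrow> real"
  assumes "open \<Omega>" "0 \<notin> \<Omega>" "test_fun \<Omega> \<phi>" and params_pos: "c > 0" "\<gamma> > 0"
  shows "(LINT x:\<Omega>|lebesgue. m_flux m (power_grad c \<gamma> x) \<bullet> grad \<phi> x)
    = - (c powr (m - 1) * Kfun m DIM('a) \<gamma> * (LINT x:\<Omega>|lebesgue. norm x powr (- (\<gamma> * (m - 1) + m)) * \<phi> x))"
proof -
  have "(LINT x:\<Omega>|lebesgue. m_flux m (power_grad c \<gamma> x) \<bullet> grad \<phi> x)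
      = - ((c * \<gamma>) powr (m - 1)) * (LINT x:\<Omega>|lebesgue. (norm x powr (- (\<gamma> * (m - 1) + m)) *\<^sub>R x) \<bullet> grad \<phi> x)"
    unfolding m_flux_power_grad[OF params_pos] inner_scaleR_left[of "- ((c * \<gamma>) powr (m - 1))"]
      set_integral_mult_right ..
  also have "(c * \<gamma>) powr (m - 1) = c powr (m - 1) * \<gamma> powr (m - 1)"
    using params_pos by (simp add: powr_mult)
  finally show ?thesis
    unfolding radial_power_field_integral[OF assms(1-3)] by (simp add: Kfun_def algebra_simps)
qed

lemma powr_power_mult:
  fixes c r :: real
  assumes "c > 0" "r \<ge> 0"
  shows "(c * r powr (- \<gamma>)) powr s = c powr s * r powr (- (\<gamma> * s))"
  using assms by (simp add: powr_mult powr_powr)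

definition hardy_weight :: "real \<Rightarrow> ('a::euclidean_space \<Rightarrow> real) \<Rightarrow> 'a \<Rightarrow> real" where
  "hardy_weight m u x = norm x powr (- m) * u x powr (m - 1)"

lemma hardy_weight_nonneg: "hardy_weight m u x \<ge> 0"
  by (simp add: hardy_weight_def)

lemma hardy_weight_power:
  assumes "c > 0"
  shows "hardy_weight m (\<lambda>x. c * norm x powr (- \<gamma>)) x = c powr (m - 1) * norm x powr (- (\<gamma> * (m - 1) + m))"
proof -
  have "norm x powr (- (\<gamma> * (m - 1) + m)) = norm x powr (- (\<gamma> * (m - 1))) * norm x powr (- m)"
    unfolding powr_add[symmetric] by simp
  then show ?thesis using assms by (simp add: hardy_weight_def powr_power_mult mult_ac)
qed

lemma Kfun_strict_mono:
  assumes "m > 1" "real N \<le> m" "0 \<le> s" "s < t"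
  shows "Kfun m N s < Kfun m N t"
proof -
  have "(m - 1) * s < (m - 1) * t" "0 \<le> (m - 1) * s"
    using assms by simp_all
  then have "(m - 1) * s + m - real N < (m - 1) * t + m - real N" "0 \<le> (m - 1) * s + m - real N"
    using assms by linarith+
  then show ?thesis
    unfolding Kfun_def using assms powr_less_mono2[of "m - 1" s t]
    by (intro mult_strict_mono) auto
qed

lemma Kfun_0: "m > 1 \<Longrightarrow> Kfun m N 0 = 0"
  by (simp add: Kfun_def)

lemma Kfun_pos: "m > 1 \<Longrightarrow> real N \<le> m \<Longrightarrow> b > 0 \<Longrightarrow> Kfun m N b > 0"
  using Kfun_strict_mono[of m N 0 b] Kfun_0 by simp

lemma continuous_on_Kfun:
  assumes "m > 1"
  shows "continuous_on {0..} (Kfun m N)"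
  unfolding Kfun_def[abs_def] using assms by (intro continuous_intros continuous_on_powr') auto

lemma Kfun_surj:
  assumes "m > 1" "real N \<le> m" "lam > 0"
  obtains b where "b > 0" "Kfun m N b = lam"
proof -
  define B where "B = max 1 (lam / (m - 1))"
  have B_bounds: "1 \<le> B" "lam \<le> (m - 1) * B"
    using assms by (auto simp: B_def max_def field_simps)
  have "1 * lam \<le> Kfun m N B"
    unfolding Kfun_def using assms B_bounds by (intro mult_mono ge_one_powr_ge_zero) auto
  then obtain b where "0 \<le> b" "b \<le> B" "Kfun m N b = lam"
    using IVT'[of "Kfun m N" 0 lam B] assms B_bounds Kfun_0[of m N]
      continuous_on_subset[OF continuous_on_Kfun[OF assms(1)]] by auto
  moreover from this have "b \<noteq> 0" using assms Kfun_0[of m N] by auto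
  ultimately show thesis using that[of b] by simp
qed

lemma Gfun_uminus: "t \<ge> 0 \<Longrightarrow> Gfun m N (- t) = - Kfun m N t"
  using powr_minus_2_mult[of t m] by (auto simp: Gfun_def Kfun_def algebra_simps)

lemma beta_minus_eq:
  assumes "m > 1" "real N \<le> m" "b > 0" "Kfun m N b = - \<mu>"
  shows "beta_minus m N \<mu> = - b"
  unfolding beta_minus_def
proof (rule cInf_eq_minimum)
  show "- b \<in> {\<beta>. \<mu> \<le> Gfun m N \<beta>}" using assms by (simp add: Gfun_uminus)
  fix \<beta> assume "\<beta> \<in> {\<beta>. \<mu> \<le> Gfun m N \<beta>}"
  then have "\<mu> \<le> Gfun m N \<beta>" by simp
  show "- b \<le> \<beta>"
  proof (rule ccontr)
    assume "\<not> - b \<le> \<beta>"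
    then have "b < - \<beta>" by simp
    with assms have "Kfun m N b < Kfun m N (- \<beta>)" by (intro Kfun_strict_mono) auto
    with \<open>\<mu> \<le> Gfun m N \<beta>\<close> \<open>b < - \<beta>\<close> show False
      using Gfun_uminus[of "- \<beta>" m N] assms by simp
  qed
qed

section \<open>Comparison with radial powers\<close>

lemma open_ext_dom: "open ext_dom"
  by (simp add: ext_dom_def open_Compl)

lemma ext_dom_iff: "x \<in> ext_dom \<longleftrightarrow> norm x > 1"
  by (auto simp: ext_dom_def)

lemma zero_notin_ext_dom: "0 \<notin> ext_dom"
  by (simp add: ext_dom_def)

lemma ext_dom_measurable[measurable]: "ext_dom \<in> sets borel" "ext_dom \<in> sets lebesgue"
  using borel_open[OF open_ext_dom] by auto

text \<open>A smooth substitute for the positive part of \<open>W\<close>, hence admissible as a test function.\<close>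

definition flat_cutoff :: "'a set \<Rightarrow> ('a \<Rightarrow> real) \<Rightarrow> 'a \<Rightarrow> real" where
  "flat_cutoff A W x = (if x \<in> A then flat_exp 0 (W x) else 0)"

lemma flat_cutoff_nonneg: "flat_cutoff A W x \<ge> 0"
  by (simp add: flat_cutoff_def flat_exp_nonneg)

locale negative_on_frontier =
  fixes T A :: "'a::euclidean_space set" and W :: "'a \<Rightarrow> real"
  assumes open_T: "open T" and compact_A: "compact A" and A_sub_T: "A \<subseteq> T"
    and smooth_W: "Ck_on k T W" and frontier_neg: "x \<in> frontier A \<Longrightarrow> W x < 0"
begin

definition vanishing_set :: "'a set" where
  "vanishing_set = - A \<union> {x \<in> T. W x < 0}"

lemma continuous_W: "continuous_on T W"
  using Ck_on_imp_continuous_on[OF smooth_W] .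

lemma open_vanishing_set: "open vanishing_set"
proof -
  have "open (T \<inter> W -` {..<0})"
    by (rule continuous_open_preimage[OF continuous_W open_T open_lessThan])
  moreover have "T \<inter> W -` {..<0} = {x \<in> T. W x < 0}" by auto
  ultimately show ?thesis
    using compact_imp_closed[OF compact_A] by (auto simp: vanishing_set_def)
qed

lemma flat_cutoff_eq_0: "x \<in> vanishing_set \<Longrightarrow> flat_cutoff A W x = 0"
  by (auto simp: vanishing_set_def flat_cutoff_def flat_exp_eq_0)

lemma interior_or_vanishing: "x \<in> interior A \<or> x \<in> vanishing_set"
proof -
  have "x \<in> vanishing_set" if "x \<in> A" "x \<notin> interior A"
    using that frontier_neg[of x] A_sub_T closure_subset[of A]
    by (auto simp: frontier_def vanishing_set_def)
  then show ?thesis by (auto simp: vanishing_set_def)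
qed

lemma flat_cutoff_interior: "x \<in> interior A \<Longrightarrow> flat_cutoff A W x = flat_exp 0 (W x)"
  using interior_subset by (auto simp: flat_cutoff_def)

lemma smooth_fun_flat_cutoff: "smooth_fun (flat_cutoff A W)"
  unfolding smooth_fun_iff_Ck_on
proof (intro allI Ck_on_local)
  fix k and x :: 'a
  consider "x \<in> interior A" | "x \<in> vanishing_set" using interior_or_vanishing by blast
  then show "\<exists>S. open S \<and> x \<in> S \<and> Ck_on k S (flat_cutoff A W)"
  proof cases
    case 1
    have "interior A \<subseteq> T" using interior_subset A_sub_T by blast
    then have "Ck_on k (interior A) (\<lambda>x. flat_exp 0 (W x))"
      by (intro Ck_on_compose[OF open_interior open_UNIV subset_UNIV Ck_on_flat_exp] Ck_on_subset[OF smooth_W])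
    then have "Ck_on k (interior A) (flat_cutoff A W)"
      by (rule Ck_on_cong_imp[OF open_interior, rotated]) (simp add: flat_cutoff_interior)
    with 1 show ?thesis by blast
  next
    case 2
    have "Ck_on k vanishing_set (flat_cutoff A W)"
      by (rule Ck_on_cong_imp[OF open_vanishing_set _ Ck_on_const[OF open_vanishing_set, of _ 0]])
         (simp add: flat_cutoff_eq_0)
    with 2 open_vanishing_set show ?thesis by blast
  qed
qed

lemma tsupport_flat_cutoff: "tsupport (flat_cutoff A W) \<subseteq> {x \<in> A. W x \<ge> 0}"
  unfolding tsupport_def
proof (rule closure_minimal)
  show "{x. flat_cutoff A W x \<noteq> 0} \<subseteq> {x \<in> A. W x \<ge> 0}"
    by (auto simp: flat_cutoff_def flat_exp_def split: if_splits)
  have "closed (A \<inter> W -` {0..})"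
    by (intro continuous_closed_preimage continuous_on_subset[OF continuous_W A_sub_T]
        compact_imp_closed[OF compact_A] closed_atLeast)
  then show "closed {x \<in> A. W x \<ge> 0}" by (simp add: vimage_def Int_def)
qed

lemma test_fun_flat_cutoff: "test_fun T (flat_cutoff A W)"
proof -
  have sub: "tsupport (flat_cutoff A W) \<subseteq> A"
    using tsupport_flat_cutoff by blast
  then have "compact (tsupport (flat_cutoff A W))"
    using compact_Int_closed[OF compact_A closed_tsupport] by (metis Int_absorb1)
  with sub show ?thesis
    using smooth_fun_flat_cutoff A_sub_T by (auto simp: test_fun_def)
qed

lemma grad_flat_cutoff: "grad (flat_cutoff A W) x = (if x \<in> A then flat_exp 2 (W x) *\<^sub>R grad W x else 0)"
proof -
  consider "x \<in> interior A" | "x \<in> vanishing_set" using interior_or_vanishing by blast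
  then show ?thesis
  proof cases
    case 1
    then have "x \<in> A" using interior_subset by blast
    then have "GDERIV W x :> grad W x"
      using A_sub_T by (intro Ck_on_Suc_imp_GDERIV[OF smooth_W]) auto
    moreover have "(flat_exp 0 has_real_derivative flat_exp 2 (W x)) (at (W x))"
      using flat_exp_has_derivative[of 0 "W x"] by (simp add: numeral_2_eq_2)
    ultimately have "GDERIV (\<lambda>x. flat_exp 0 (W x)) x :> flat_exp 2 (W x) *\<^sub>R grad W x"
      by (rule GDERIV_DERIV_compose)
    then have "GDERIV (flat_cutoff A W) x :> flat_exp 2 (W x) *\<^sub>R grad W x"
      by (rule GDERIV_transform_within_open[OF _ open_interior 1]) (simp add: flat_cutoff_interior)
    with \<open>x \<in> A\<close> show ?thesis by (simp add: GDERIV_imp_grad_eq)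
  next
    case 2
    have "GDERIV (flat_cutoff A W) x :> 0"
      by (rule GDERIV_transform_within_open[OF GDERIV_const open_vanishing_set 2])
         (simp add: flat_cutoff_eq_0)
    then have "grad (flat_cutoff A W) x = 0" by (rule GDERIV_imp_grad_eq)
    with 2 show ?thesis by (auto simp: vanishing_set_def flat_exp_eq_0)
  qed
qed

end

lemma Young_powr_minus_1:
  fixes t d \<kappa> m :: real
  assumes "t \<ge> 0" "d \<ge> 0" "\<kappa> > 0" "m > 1"
  shows "t powr (m - 1) * d \<le> \<kappa> * t powr m + \<kappa> powr (1 - m) * d powr m"
proof -
  have "m * t powr (m - 1) * (d / \<kappa>) \<le> (d / \<kappa>) powr m + (m - 1) * t powr m"
    using powr_ge_tangent[of "d / \<kappa>" t m] powr_minus_1_mult[of t m] assms by (simp add: algebra_simps)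
  also have "\<dots> \<le> m * (d / \<kappa>) powr m + m * t powr m"
    using assms(4) by (intro add_mono mult_right_mono) (auto simp: mult_le_cancel_right1)
  also have "\<dots> = m * (t powr m + (d / \<kappa>) powr m)"
    by (simp add: distrib_left)
  finally have "t powr (m - 1) * (d / \<kappa>) \<le> t powr m + (d / \<kappa>) powr m"
    unfolding mult.assoc by (rule mult_left_le_imp_le) (use assms(4) in simp)
  then have "\<kappa> * (t powr (m - 1) * (d / \<kappa>)) \<le> \<kappa> * t powr m + \<kappa> * (d / \<kappa>) powr m"
    using assms(3) by (simp only: distrib_left[symmetric] mult_le_cancel_left_pos)
  moreover have "\<kappa> * (d / \<kappa>) powr m = \<kappa> powr (1 - m) * d powr m"
    using assms(2,3) by (simp add: powr_divide powr_diff)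
  ultimately show ?thesis
    using assms(3) by simp
qed

lemma weighted_Young:
  fixes t d \<kappa> m :: real
  assumes "t \<ge> 0" "d \<ge> 0" "\<kappa> > 0" "m > 1"
  shows "(1 + t powr (m - 1)) * d \<le> \<kappa> * (1 + t powr m) + 2 * \<kappa> powr (1 - m) * d powr m"
  using Young_powr_minus_1[OF assms] Young_powr_minus_1[of 1 d \<kappa> m] assms by (simp add: algebra_simps)

lemma weak_grad_compose_measurable:
  fixes u v :: "'a::euclidean_space \<Rightarrow> real" and h :: "'a \<Rightarrow> 'a \<Rightarrow> real"
  assumes weak: "weak_grad \<Omega> u Du" and smooth_v: "smooth_fun v" and A_sub: "A \<subseteq> \<Omega>" "A \<in> sets borel"
    and [measurable]: "(\<lambda>(a, b). h a b) \<in> borel_measurable (borel \<Otimes>\<^sub>M borel)"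
  shows "(\<lambda>x. indicator A x *\<^sub>R h (Du x) (grad v x)) \<in> borel_measurable lebesgue"
proof -
  have [measurable]: "A \<in> sets lebesgue" using A_sub(2) by simp
  have [measurable]: "(\<lambda>x. indicator A x *\<^sub>R Du x) \<in> borel_measurable lebesgue"
    by (rule weak_grad_measurable_subset[OF weak A_sub])
  have [measurable]: "grad v \<in> borel_measurable lebesgue"
    using borel_measurable_continuous_onI[OF smooth_fun_continuous_on_grad[OF smooth_v]]
    by (simp add: measurable_completion)
  have "(\<lambda>x. (\<lambda>(a, b). h a b) (indicator A x *\<^sub>R Du x, grad v x)) \<in> borel_measurable lebesgue"
    by measurable
  then have "(\<lambda>x. indicator A x *\<^sub>R h (indicator A x *\<^sub>R Du x) (grad v x)) \<in> borel_measurable lebesgue"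
    by simp
  moreover have "indicator A x *\<^sub>R h (indicator A x *\<^sub>R Du x) (grad v x)
    = indicator A x *\<^sub>R h (Du x) (grad v x)" for x
    by (simp add: indicator_def)
  ultimately show ?thesis by (simp only:)
qed

lemma
  fixes u v :: "'a::euclidean_space \<Rightarrow> real"
  assumes weak: "weak_grad \<Omega> u Du" and smooth_v: "smooth_fun v" and A_sub: "A \<subseteq> \<Omega>" "A \<in> sets borel" and "\<delta> > 0"
    and nn_integral_le: "(\<integral>\<^sup>+x. indicator A x * ennreal (norm (grad v x - Du x) powr m) \<partial>lebesgue) \<le> ennreal \<delta>"
  shows set_integrable_norm_grad_diff_powr: "set_integrable lebesgue A (\<lambda>x. norm (grad v x - Du x) powr m)"
    and set_integral_norm_grad_diff_powr_le: "(LINT x:A|lebesgue. norm (grad v x - Du x) powr m) \<le> \<delta>"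
proof -
  define E where "E x = indicator A x *\<^sub>R norm (grad v x - Du x) powr m" for x
  have "E \<in> borel_measurable lebesgue"
    unfolding E_def by (rule weak_grad_compose_measurable[OF weak smooth_v A_sub]) measurable
  moreover have nn_integral_E: "(\<integral>\<^sup>+x. ennreal (E x) \<partial>lebesgue) \<le> ennreal \<delta>"
    using nn_integral_le by (simp add: E_def indicator_mult_ennreal mult.commute)
  then have "(\<integral>\<^sup>+x. ennreal (E x) \<partial>lebesgue) < \<infinity>"
    using le_less_trans by fastforce
  ultimately have integrable_E: "integrable lebesgue E"
    by (intro integrableI_nonneg) (auto simp: E_def)
  then show "set_integrable lebesgue A (\<lambda>x. norm (grad v x - Du x) powr m)"
    by (simp add: set_integrable_def E_def[abs_def])
  have "ennreal (integral\<^sup>L lebesgue E) \<le> ennreal \<delta>"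
    using nn_integral_E nn_integral_eq_integral[OF integrable_E] by (simp add: E_def)
  then show "(LINT x:A|lebesgue. norm (grad v x - Du x) powr m) \<le> \<delta>"
    using \<open>\<delta> > 0\<close> by (simp add: set_lebesgue_integral_def E_def[abs_def])
qed

lemma W1loc_set_integrable_one_plus_powr:
  fixes u :: "'a::euclidean_space \<Rightarrow> real"
  assumes "W1loc m \<Omega> u Du" "compact A" "A \<subseteq> \<Omega>"
  shows "set_integrable lebesgue A (\<lambda>x. 1 + norm (Du x) powr m)"
proof (rule set_integral_add)
  have "A \<in> sets borel" using assms(2) by (intro borel_closed compact_imp_closed)
  then show "set_integrable lebesgue A (\<lambda>x. 1 :: real)"
    using emeasure_bounded_finite[OF compact_imp_bounded[OF assms(2)]] by (simp add: set_integrable_def)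
  show "set_integrable lebesgue A (\<lambda>x. norm (Du x) powr m)"
    using assms by (simp add: W1loc_def Lloc_def)
qed

definition gradient_error :: "real \<Rightarrow> ('a::euclidean_space \<Rightarrow> 'a) \<Rightarrow> ('a \<Rightarrow> real) \<Rightarrow> 'a \<Rightarrow> real" where
  "gradient_error m Du v x = (1 + norm (Du x) powr (m - 1)) * norm (grad v x - Du x)"

lemma gradient_error_nonneg: "gradient_error m Du v x \<ge> 0"
  by (simp add: gradient_error_def)

lemma
  fixes u v :: "'a::euclidean_space \<Rightarrow> real"
  assumes m_gt_1: "m > 1" and W1loc_u: "W1loc m \<Omega> u Du" and smooth_v: "smooth_fun v"
    and compact_A: "compact A" "A \<subseteq> \<Omega>" and "\<kappa> > 0"
    and integrable_diff: "set_integrable lebesgue A (\<lambda>x. norm (grad v x - Du x) powr m)"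
  shows set_integrable_gradient_error:
      "set_integrable lebesgue A (\<lambda>x. gradient_error m Du v x)"
    and set_integral_gradient_error_le:
      "(LINT x:A|lebesgue. gradient_error m Du v x)
        \<le> \<kappa> * (LINT x:A|lebesgue. 1 + norm (Du x) powr m)
          + 2 * \<kappa> powr (1 - m) * (LINT x:A|lebesgue. norm (grad v x - Du x) powr m)"
proof -
  define B where "B x = \<kappa> * (1 + norm (Du x) powr m) + 2 * \<kappa> powr (1 - m) * norm (grad v x - Du x) powr m" for x
  note int_Du = W1loc_set_integrable_one_plus_powr[OF W1loc_u compact_A]
  have integrable_B: "set_integrable lebesgue A B"
    unfolding B_def using int_Du integrable_diff by (intro set_integral_add) auto
  have error_le_B: "gradient_error m Du v x \<le> B x" for x
    unfolding B_def gradient_error_def by (rule weighted_Young[OF norm_ge_zero norm_ge_zero \<open>\<kappa> > 0\<close> m_gt_1])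
  show integrable_error: "set_integrable lebesgue A (\<lambda>x. gradient_error m Du v x)"
    unfolding set_integrable_def
  proof (rule Bochner_Integration.integrable_bound[OF integrable_B[unfolded set_integrable_def]])
    have "weak_grad \<Omega> u Du" "A \<in> sets borel"
      using W1loc_u compact_A(1) by (auto simp: W1loc_def intro: borel_closed compact_imp_closed)
    from weak_grad_compose_measurable[OF this(1) smooth_v compact_A(2) this(2), of "\<lambda>a b. (1
      + norm a powr (m - 1)) * norm (b - a)"]
    show "(\<lambda>x. indicator A x *\<^sub>R gradient_error m Du v x) \<in> borel_measurable lebesgue"
      by (simp add: gradient_error_def)
    have "\<bar>gradient_error m Du v x\<bar> \<le> \<bar>B x\<bar>" for x
      using error_le_B[of x] gradient_error_nonneg[of m Du v x] by linarith
    then show "AE x in lebesgue. norm (indicator A x *\<^sub>R gradient_error m Du v x)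
      \<le> norm (indicator A x *\<^sub>R B x)"
      by (simp add: indicator_def)
  qed
  have "(LINT x:A|lebesgue. gradient_error m Du v x) \<le> (LINT x:A|lebesgue. B x)"
    by (rule set_integral_mono[OF integrable_error integrable_B error_le_B])
  also have "\<dots> = \<kappa> * (LINT x:A|lebesgue. 1 + norm (Du x) powr m)
      + 2 * \<kappa> powr (1 - m) * (LINT x:A|lebesgue. norm (grad v x - Du x) powr m)"
    unfolding B_def using int_Du integrable_diff by (subst set_integral_add(2)) auto
  finally show "(LINT x:A|lebesgue. gradient_error m Du v x)
      \<le> \<kappa> * (LINT x:A|lebesgue. 1 + norm (Du x) powr m)
        + 2 * \<kappa> powr (1 - m) * (LINT x:A|lebesgue. norm (grad v x - Du x) powr m)" .
qed

lemma W1loc_smooth_approx_weighted: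
  fixes u :: "'a::euclidean_space \<Rightarrow> real"
  assumes m_gt_1: "m > 1" and open_\<Omega>: "open \<Omega>" and cont_u: "continuous_on \<Omega> u" and W1loc_u: "W1loc m \<Omega> u Du"
    and compact_A: "compact A" "A \<subseteq> \<Omega>" and \<eta>_pos: "\<eta> > 0"
  obtains v where "smooth_fun v" "\<And>x. x \<in> A \<Longrightarrow> \<bar>v x - u x\<bar> \<le> \<eta>"
    "set_integrable lebesgue A (\<lambda>x. gradient_error m Du v x)"
    "(LINT x:A|lebesgue. gradient_error m Du v x) \<le> \<eta>"
proof -
  define I where "I = (LINT x:A|lebesgue. 1 + norm (Du x) powr m)"
  have "I \<ge> 0" unfolding I_def set_lebesgue_integral_def by (intro Bochner_Integration.integral_nonneg) auto
  define \<kappa> where "\<kappa> = \<eta> / (2 * (I + 1))"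
  have \<kappa>_bounds: "\<kappa> > 0" "\<kappa> * I \<le> \<eta> / 2"
    using \<open>I \<ge> 0\<close> \<eta>_pos by (auto simp: \<kappa>_def field_simps)
  define \<delta> where "\<delta> = min \<eta> (\<eta> / (4 * \<kappa> powr (1 - m)))"
  have \<delta>_bounds: "\<delta> > 0" "\<delta> \<le> \<eta>" "2 * \<kappa> powr (1 - m) * \<delta> \<le> \<eta> / 2"
    using \<kappa>_bounds(1) \<eta>_pos by (auto simp: \<delta>_def min_def field_simps)
  obtain v where approx_v: "smooth_fun v" "\<And>x. x \<in> A \<Longrightarrow> \<bar>v x - u x\<bar> \<le> \<delta>"
    and v_grad: "(\<integral>\<^sup>+x. indicator A x * ennreal (norm (grad v x - Du x) powr m) \<partial>lebesgue) \<le> ennreal \<delta>"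
    using W1loc_smooth_approx[OF m_gt_1 open_\<Omega> cont_u W1loc_u compact_A \<delta>_bounds(1)] by blast
  have "A \<in> sets borel" using compact_A(1) by (intro borel_closed compact_imp_closed)
  with W1loc_u approx_v(1) compact_A(2) \<delta>_bounds(1) v_grad have integrable_diff:
    "set_integrable lebesgue A (\<lambda>x. norm (grad v x - Du x) powr m)"
    and integral_le: "(LINT x:A|lebesgue. norm (grad v x - Du x) powr m) \<le> \<delta>"
    by (auto simp: W1loc_def intro: set_integrable_norm_grad_diff_powr set_integral_norm_grad_diff_powr_le)
  note error = set_integrable_gradient_error[OF m_gt_1 W1loc_u approx_v(1) compact_A \<kappa>_bounds(1)
    integrable_diff]
    set_integral_gradient_error_le[OF m_gt_1 W1loc_u approx_v(1) compact_A \<kappa>_bounds(1) integrable_diff]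
  have "(LINT x:A|lebesgue. gradient_error m Du v x)
      \<le> \<eta> / 2 + 2 * \<kappa> powr (1 - m) * \<delta>"
    using error(2) \<kappa>_bounds(2) integral_le unfolding I_def
    by (elim order_trans) (intro add_mono mult_left_mono; simp)
  then show thesis
    using that[OF approx_v(1) _ error(1)] approx_v(2) \<delta>_bounds(2,3) by fastforce
qed

definition hardy_supersolution ::
    "real \<Rightarrow> real \<Rightarrow> real \<Rightarrow> ('a::euclidean_space \<Rightarrow> real) \<Rightarrow> ('a \<Rightarrow> 'a) \<Rightarrow> bool" where
  "hardy_supersolution m lam R u Du \<longleftrightarrow>
    (\<forall>\<phi>. test_fun ext_dom \<phi> \<and> (\<forall>x. 0 \<le> \<phi> x) \<and> (\<forall>x\<in>tsupport \<phi>. R < norm x \<and> u x < 1) \<longrightarrow>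
      0 \<le> (LINT x:ext_dom|lebesgue. m_flux m (Du x) \<bullet> grad \<phi> x)
         + lam * (LINT x:ext_dom|lebesgue. hardy_weight m u x * \<phi> x))"

locale exterior_sobolev_function =
  fixes m :: real and u :: "'a::euclidean_space \<Rightarrow> real" and Du :: "'a \<Rightarrow> 'a"
  assumes m_gt_1: "m > 1" and dim_le: "real DIM('a) \<le> m"
    and cont_u: "continuous_on ext_dom u" and u_pos: "x \<in> ext_dom \<Longrightarrow> u x > 0" and W1loc: "W1loc m ext_dom u Du"
begin

lemma continuous_on_hardy_weight: "continuous_on ext_dom (hardy_weight m u)"
  unfolding hardy_weight_def[abs_def]
  by (intro continuous_intros continuous_on_norm_powr zero_notin_ext_dom cont_u)
     (use u_pos in \<open>force simp: less_imp_neq\<close>)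

lemma set_integrable_hardy_weight:
  "test_fun ext_dom \<phi> \<Longrightarrow> set_integrable lebesgue ext_dom (\<lambda>x. hardy_weight m u x * \<phi> x)"
  by (rule set_integrable_mult_test_fun[OF _ continuous_on_hardy_weight])

lemma hardy_supersolution_mono:
  assumes supersolution: "hardy_supersolution m lam R u Du" and "lam \<le> lam'" "R \<le> R'"
  shows "hardy_supersolution m lam' R' u Du"
  unfolding hardy_supersolution_def
proof (intro allI impI, elim conjE)
  fix \<phi> :: "'a \<Rightarrow> real"
  assume test_\<phi>: "test_fun ext_dom \<phi>" "\<forall>x. 0 \<le> \<phi> x" "\<forall>x\<in>tsupport \<phi>. R' < norm x \<and> u x < 1"
  define J where "J = (LINT x:ext_dom|lebesgue. hardy_weight m u x * \<phi> x)"
  have "J \<ge> 0"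
    unfolding J_def set_lebesgue_integral_def using test_\<phi>(2)
    by (intro Bochner_Integration.integral_nonneg) (simp add: hardy_weight_nonneg)
  then have "lam * J \<le> lam' * J" using assms(2) by (rule mult_right_mono[rotated])
  moreover have "\<forall>x\<in>tsupport \<phi>. R < norm x \<and> u x < 1" using test_\<phi>(3) assms(3) by force
  then have "0 \<le> (LINT x:ext_dom|lebesgue. m_flux m (Du x) \<bullet> grad \<phi> x) + lam * J"
    using supersolution test_\<phi>(1,2) unfolding hardy_supersolution_def J_def by blast
  ultimately show "0 \<le> (LINT x:ext_dom|lebesgue. m_flux m (Du x) \<bullet> grad \<phi> x)
      + lam' * (LINT x:ext_dom|lebesgue. hardy_weight m u x * \<phi> x)"
    unfolding J_def by linarith
qed

end

lemma flat_exp_2_le: "flat_exp 2 t \<le> 2"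
proof (cases "t > 0")
  case True
  then have "1 + 1 / t + (1 / t)\<^sup>2 / 2 \<le> exp (1 / t)"
    by (intro exp_lower_Taylor_quadratic) simp
  moreover have "1 / t > 0" using True by simp
  ultimately have "(1 / t)\<^sup>2 / 2 \<le> exp (1 / t)" by linarith
  with True show ?thesis
    by (simp add: flat_exp_def exp_minus field_simps power2_eq_square)
qed (simp add: flat_exp_def)

lemma m_flux_diff_inner_le:
  assumes "m > 1"
  shows "(m_flux m a - m_flux m w) \<bullet> (w - g) \<le> (norm a powr (m - 1) + norm w powr (m - 1)) * norm (g - a)"
proof -
  have "(m_flux m a - m_flux m w) \<bullet> (w - g)
      = (m_flux m a - m_flux m w) \<bullet> (a - g) - (m_flux m a - m_flux m w) \<bullet> (a - w)"
    by (simp add: inner_diff_right)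
  also have "\<dots> \<le> norm (m_flux m a - m_flux m w) * norm (a - g)"
    using m_flux_monotone[OF assms, of a w] norm_cauchy_schwarz[of "m_flux m a - m_flux m w" "a - g"]
    by linarith
  also have "\<dots> \<le> (norm a powr (m - 1) + norm w powr (m - 1)) * norm (a - g)"
    using norm_triangle_ineq4[of "m_flux m a" "m_flux m w"]
    by (intro mult_right_mono) (auto simp: norm_m_flux)
  finally show ?thesis by (simp add: norm_minus_commute)
qed

context exterior_sobolev_function
begin

definition hardy_gap :: "real \<Rightarrow> real \<Rightarrow> 'a \<Rightarrow> real" where
  "hardy_gap b c x = hardy_weight m (\<lambda>x. c * norm x powr (- b)) x - hardy_weight m u x"

lemma hardy_gap_pos:
  assumes "x \<in> ext_dom" "u x < c * norm x powr (- b)"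
  shows "hardy_gap b c x > 0"
  using assms u_pos[OF assms(1)] m_gt_1 powr_less_mono2[of "m - 1" "u x" "c * norm x powr (- b)"]
  unfolding hardy_gap_def hardy_weight_def right_diff_distrib[symmetric]
  by (auto simp: ext_dom_iff intro!: mult_pos_pos)

lemma continuous_on_hardy_weight_power:
  assumes "c > 0"
  shows "continuous_on ext_dom (hardy_weight m (\<lambda>x::'a. c * norm x powr (- b)))"
proof -
  have "hardy_weight m (\<lambda>x::'a. c * norm x powr (- b))
    = (\<lambda>x. c powr (m - 1) * norm x powr (- (b * (m - 1) + m)))"
    by (rule ext) (rule hardy_weight_power[OF assms])
  then show ?thesis
    by (simp only:) (intro continuous_intros continuous_on_norm_powr zero_notin_ext_dom)
qed

lemma continuous_on_hardy_gap: "c > 0 \<Longrightarrow> continuous_on ext_dom (hardy_gap b c)"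
  unfolding hardy_gap_def[abs_def]
  by (intro continuous_on_diff continuous_on_hardy_weight_power continuous_on_hardy_weight)

lemma continuous_on_power_minus: "continuous_on ext_dom (\<lambda>x. c * norm x powr (- b) - u x - t)"
  by (intro continuous_intros continuous_on_norm_powr zero_notin_ext_dom cont_u)

definition truncated_hardy_gap :: "real \<Rightarrow> real \<Rightarrow> real \<Rightarrow> 'a \<Rightarrow> real" where
  "truncated_hardy_gap b c t x = hardy_gap b c x * flat_exp 0 (c * norm x powr (- b) - u x - t)"

lemma continuous_on_truncated_hardy_gap:
  assumes "c > 0"
  shows "continuous_on ext_dom (truncated_hardy_gap b c t)"
  unfolding truncated_hardy_gap_def[abs_def]
  by (intro continuous_intros continuous_on_hardy_gap[OF assms]
      continuous_on_compose2[OF Ck_on_imp_continuous_on[OF Ck_on_flat_exp[of 0 0]]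
        continuous_on_power_minus]) auto

lemma set_integrable_truncated_hardy_gap:
  assumes "c > 0" "compact A" "A \<subseteq> ext_dom"
  shows "set_integrable lebesgue A (truncated_hardy_gap b c t)"
  using assms by (intro set_integrable_continuous_compact
    continuous_on_subset[OF continuous_on_truncated_hardy_gap])

lemma truncated_hardy_gap_nonneg:
  assumes "x \<in> ext_dom" "t \<ge> 0"
  shows "truncated_hardy_gap b c t x \<ge> 0"
proof (cases "u x + t < c * norm x powr (- b)")
  case True
  then show ?thesis
    using hardy_gap_pos[OF assms(1), of c b] assms(2) by (simp add: truncated_hardy_gap_def flat_exp_nonneg)
qed (simp add: truncated_hardy_gap_def flat_exp_eq_0)

lemma hardy_gap_integral_pos:
  assumes "c > 0" "compact A" "A \<subseteq> ext_dom" "t \<ge> 0"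
    and below_at_x0: "x0 \<in> interior A" "u x0 + t < c * norm x0 powr (- b)"
  shows "(LINT x:A|lebesgue. truncated_hardy_gap b c t x) > 0"
  unfolding set_lebesgue_integral_def
proof (rule integral_pos_of_pos_on_open)
  define S where "S = interior A \<inter> (\<lambda>x. c * norm x powr (- b) - u x - t) -` {0<..}"
  have "interior A \<subseteq> ext_dom" using interior_subset assms(3) by blast
  then show "open S"
    unfolding S_def
    by (intro continuous_open_preimage[OF continuous_on_subset[OF continuous_on_power_minus]]) auto
  show "S \<noteq> {}" using below_at_x0 by (auto simp: S_def)
  show "indicator A x *\<^sub>R truncated_hardy_gap b c t x > 0" if "x \<in> S" for x
  proof -
    have "x \<in> A" "u x + t < c * norm x powr (- b)"
      using that interior_subset by (auto simp: S_def)
    then show ?thesis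
      using hardy_gap_pos[of x c b] assms(3,4) by (auto simp: truncated_hardy_gap_def flat_exp_pos)
  qed
  show "indicator A x *\<^sub>R truncated_hardy_gap b c t x \<ge> 0" for x
    using truncated_hardy_gap_nonneg[of x t b c] assms(3,4) by (auto simp: indicator_def)
qed (use set_integrable_truncated_hardy_gap[OF assms(1-3)] in \<open>simp add: set_integrable_def\<close>)

lemma hardy_gap_integral_mono:
  assumes "c > 0" "compact A" "A \<subseteq> ext_dom" "t \<ge> 0" and test: "test_fun ext_dom (flat_cutoff A W)"
    and W_ge: "\<And>x. x \<in> A \<Longrightarrow> c * norm x powr (- b) - u x - t \<le> W x"
    and W_pos: "\<And>x. x \<in> A \<Longrightarrow> W x > 0 \<Longrightarrow> u x < c * norm x powr (- b)"
  shows "(LINT x:A|lebesgue. truncated_hardy_gap b c t x)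
    \<le> (LINT x:ext_dom|lebesgue. hardy_gap b c x * flat_cutoff A W x)"
  unfolding set_lebesgue_integral_def
proof (rule integral_mono)
  fix x
  show "indicator A x *\<^sub>R truncated_hardy_gap b c t x
      \<le> indicator ext_dom x *\<^sub>R (hardy_gap b c x * flat_cutoff A W x)"
  proof (cases "x \<in> A")
    case True
    have "truncated_hardy_gap b c t x \<le> hardy_gap b c x * flat_exp 0 (W x)"
    proof (cases "W x > 0")
      case True
      then show ?thesis
        using hardy_gap_pos[of x c b] W_pos[OF \<open>x \<in> A\<close>] W_ge[OF \<open>x \<in> A\<close>] assms(3) \<open>x \<in> A\<close>
        unfolding truncated_hardy_gap_def
        by (intro mult_left_mono flat_exp_0_mono) (auto intro: less_imp_le)
    next
      case False
      then show ?thesis using W_ge[OF \<open>x \<in> A\<close>] by (simp add: truncated_hardy_gap_def flat_exp_eq_0)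
    qed
    then show ?thesis using True assms(3) by (auto simp: flat_cutoff_def)
  qed (simp add: flat_cutoff_def)
next
  show "integrable lebesgue (\<lambda>x. indicator A x *\<^sub>R truncated_hardy_gap b c t x)"
    using set_integrable_truncated_hardy_gap[OF assms(1-3)] by (simp add: set_integrable_def)
  show "integrable lebesgue (\<lambda>x. indicator ext_dom x *\<^sub>R (hardy_gap b c x * flat_cutoff A W x))"
    using set_integrable_mult_test_fun[OF test continuous_on_hardy_gap[OF assms(1)]]
    by (simp add: set_integrable_def)
qed

lemma set_integrable_flux_diff:
  assumes "test_fun ext_dom \<phi>"
  shows "set_integrable lebesgue ext_dom (\<lambda>x. (m_flux m (Du x) - m_flux m (power_grad c b x)) \<bullet> grad \<phi> x)"
  using set_integral_diff(1)[OF set_integrable_m_flux[OF m_gt_1 W1loc assms]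
      set_integrable_m_flux[OF m_gt_1 W1loc_power[OF m_gt_1 open_ext_dom zero_notin_ext_dom] assms]]
  by (simp add: inner_diff_left)

lemma hardy_gap_le_flux_diff:
  assumes params_pos: "c > 0" "b > 0" and supersolution: "hardy_supersolution m (Kfun m DIM('a) b) R u Du"
    and test: "test_fun ext_dom \<phi>" and "\<And>x. 0 \<le> \<phi> x" "\<And>x. x \<in> tsupport \<phi> \<Longrightarrow> R < norm x \<and> u x < 1"
  shows "Kfun m DIM('a) b * (LINT x:ext_dom|lebesgue. hardy_gap b c x * \<phi> x)
    \<le> (LINT x:ext_dom|lebesgue. (m_flux m (Du x) - m_flux m (power_grad c b x)) \<bullet> grad \<phi> x)"
proof -
  define J where "J = (LINT x:ext_dom|lebesgue. hardy_weight m u x * \<phi> x)"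
  define J' where "J' = (LINT x:ext_dom|lebesgue. hardy_weight m (\<lambda>x. c * norm x powr (- b)) x * \<phi> x)"
  have "0 \<le> (LINT x:ext_dom|lebesgue. m_flux m (Du x) \<bullet> grad \<phi> x) + Kfun m DIM('a) b * J"
    using supersolution assms(4-6) unfolding hardy_supersolution_def J_def by blast
  moreover have "(LINT x:ext_dom|lebesgue. m_flux m (power_grad c b x) \<bullet> grad \<phi> x) = - (Kfun m DIM('a) b * J')"
    unfolding J'_def hardy_weight_power[OF params_pos(1)] mult.assoc set_integral_mult_right
      m_flux_power_grad_integral[OF open_ext_dom zero_notin_ext_dom test params_pos] by simp
  moreover have "(LINT x:ext_dom|lebesgue. hardy_gap b c x * \<phi> x) = J' - J"
    using set_integral_diff(2)[OF set_integrable_mult_test_fun[OF test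
      continuous_on_hardy_weight_power[OF params_pos(1)]]
        set_integrable_hardy_weight[OF test]]
    by (simp add: hardy_gap_def J'_def J_def left_diff_distrib)
  moreover have "(LINT x:ext_dom|lebesgue. (m_flux m (Du x) - m_flux m (power_grad c b x)) \<bullet> grad \<phi> x)
      = (LINT x:ext_dom|lebesgue. m_flux m (Du x) \<bullet> grad \<phi> x)
        - (LINT x:ext_dom|lebesgue. m_flux m (power_grad c b x) \<bullet> grad \<phi> x)"
    using set_integral_diff(2)[OF set_integrable_m_flux[OF m_gt_1 W1loc test]
        set_integrable_m_flux[OF m_gt_1 W1loc_power[OF m_gt_1 open_ext_dom zero_notin_ext_dom] test]]
    by (simp add: inner_diff_left)
  ultimately show ?thesis by (simp add: right_diff_distrib)
qed

lemma flux_diff_le_gradient_error: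
  assumes A_sub: "A \<subseteq> ext_dom" and test: "test_fun ext_dom \<phi>"
    and grad: "\<And>x. grad \<phi> x = (if x \<in> A then flat_exp 2 (W x) *\<^sub>R (power_grad c b x - grad v x) else 0)"
    and flux_bound: "M \<ge> 0" "\<And>x. x \<in> A \<Longrightarrow> norm (power_grad c b x) powr (m - 1) \<le> M"
    and integrable_error: "set_integrable lebesgue A (\<lambda>x. gradient_error m Du v x)"
  shows "(LINT x:ext_dom|lebesgue. (m_flux m (Du x) - m_flux m (power_grad c b x)) \<bullet> grad \<phi> x)
    \<le> 2 * (M + 1) * (LINT x:A|lebesgue. gradient_error m Du v x)"
proof -
  have pointwise_le: "(m_flux m (Du x) - m_flux m (power_grad c b x)) \<bullet> grad \<phi> x
    \<le> 2 * (M + 1) * gradient_error m Du v x" if "x \<in> A" for x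
  proof -
    have "(m_flux m (Du x) - m_flux m (power_grad c b x)) \<bullet> (power_grad c b x - grad v x)
        \<le> (norm (Du x) powr (m - 1) + norm (power_grad c b x) powr (m - 1)) * norm (grad v x - Du x)"
      by (rule m_flux_diff_inner_le[OF m_gt_1])
    also have "\<dots> \<le> ((M + 1) * (1 + norm (Du x) powr (m - 1))) * norm (grad v x - Du x)"
      using flux_bound(2)[OF that] mult_nonneg_nonneg[OF flux_bound(1) powr_ge_zero[of "norm (Du x)" "m - 1"]]
      by (intro mult_right_mono) (simp_all add: algebra_simps)
    also have "\<dots> = (M + 1) * gradient_error m Du v x" by (simp add: gradient_error_def)
    finally have "flat_exp 2 (W x) * ((m_flux m (Du x) - m_flux m (power_grad c b x))
      \<bullet> (power_grad c b x - grad v x))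
        \<le> flat_exp 2 (W x) * ((M + 1) * gradient_error m Du v x)"
      by (rule mult_left_mono[OF _ flat_exp_nonneg])
    also have "\<dots> \<le> 2 * ((M + 1) * gradient_error m Du v x)"
      using flux_bound(1) by (intro mult_right_mono flat_exp_2_le) (simp add: gradient_error_nonneg)
    finally show ?thesis using that by (simp only: grad if_True inner_scaleR_right mult.assoc)
  qed
  have "(LINT x:ext_dom|lebesgue. (m_flux m (Du x) - m_flux m (power_grad c b x)) \<bullet> grad \<phi> x)
      \<le> (LINT x:A|lebesgue. 2 * (M + 1) * gradient_error m Du v x)"
    unfolding set_lebesgue_integral_def
  proof (rule integral_mono)
    show "integrable lebesgue (\<lambda>x. indicator ext_dom x
      *\<^sub>R ((m_flux m (Du x) - m_flux m (power_grad c b x)) \<bullet> grad \<phi> x))"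
      using set_integrable_flux_diff[OF test] by (simp add: set_integrable_def)
    show "integrable lebesgue (\<lambda>x. indicator A x *\<^sub>R (2 * (M + 1) * gradient_error m Du v x))"
      using set_integrable_mult_right[OF integrable_error, of "2 * (M + 1)"] by (simp add: set_integrable_def)
    show "indicator ext_dom x *\<^sub>R ((m_flux m (Du x) - m_flux m (power_grad c b x)) \<bullet> grad \<phi> x)
        \<le> indicator A x *\<^sub>R (2 * (M + 1) * gradient_error m Du v x)" for x
      using pointwise_le[of x] grad[of x] A_sub by (cases "x \<in> A") auto
  qed
  then show ?thesis by simp
qed

lemma grad_power_minus_smooth:
  assumes "smooth_fun v" "x \<noteq> 0"
  shows "grad (\<lambda>x::'a. c * norm x powr (- b) - t - v x) x = power_grad c b x - grad v x"
  using GDERIV_imp_grad_eq[OF GDERIV_diff[OF GDERIV_diff[OF GDERIV_power GDERIV_const] smooth_fun_GDERIV]] assms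
  by simp

lemma negative_on_frontier_power_minus_smooth:
  assumes compact_A: "compact A" "A \<subseteq> ext_dom" and "smooth_fun v" and close: "\<And>x. x \<in> A \<Longrightarrow> \<bar>v x - u x\<bar> \<le> \<tau>"
    and "\<tau> > 0"
    and frontier: "\<And>x. x \<in> frontier A \<Longrightarrow> c * norm x powr (- b) \<le> u x + \<delta>"
  shows "negative_on_frontier ext_dom A (\<lambda>x::'a. c * norm x powr (- b) - (\<delta> + 2 * \<tau>) - v x)"
proof
  have "Ck_on k ext_dom (\<lambda>x::'a. norm x powr (- b))" "Ck_on k ext_dom v" for k
    using Ck_on_subset[OF Ck_on_norm_powr, of ext_dom k "- b"] Ck_on_subset[of k UNIV v ext_dom]
      zero_notin_ext_dom assms(3) by (auto simp: smooth_fun_iff_Ck_on)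
  then show "Ck_on k ext_dom (\<lambda>x::'a. c * norm x powr (- b) - (\<delta> + 2 * \<tau>) - v x)" for k
    using open_ext_dom by (intro Ck_on_diff Ck_on_mult Ck_on_const)
  show "c * norm x powr (- b) - (\<delta> + 2 * \<tau>) - v x < 0" if "x \<in> frontier A" for x
    using frontier[OF that] close[of x] frontier_subset_closed[OF compact_imp_closed[OF compact_A(1)]] that
      \<open>\<tau> > 0\<close>
    by force
qed (use compact_A open_ext_dom in auto)

text \<open>
  The inequality is tested with a smoothed positive part of \<open>c |x| powr (-b) - v - (\<delta> + 2 \<tau>)\<close>, where
  \<open>v\<close> is a smooth approximation of \<open>u\<close>. By monotonicity of the flux, the gradient terms are bounded by
  the approximation error.
\<close>

lemma hardy_gap_integral_le_gradient_error:
  assumes params_pos: "c > 0" "b > 0" and supersolution: "hardy_supersolution m (Kfun m DIM('a) b) R u Du"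
    and domain_A: "compact A" "A \<subseteq> ext_dom" "\<And>x. x \<in> A \<Longrightarrow> R < norm x"
    and power_le_1: "\<And>x. x \<in> A \<Longrightarrow> c * norm x powr (- b) \<le> 1"
    and frontier: "\<And>x. x \<in> frontier A \<Longrightarrow> c * norm x powr (- b) \<le> u x + \<delta>" and "\<delta> \<ge> 0" "\<tau> > 0"
    and smooth_v: "smooth_fun v" and close: "\<And>x. x \<in> A \<Longrightarrow> \<bar>v x - u x\<bar> \<le> \<tau>"
    and integrable_error: "set_integrable lebesgue A (\<lambda>x. gradient_error m Du v x)"
    and flux_bound: "M \<ge> 0" "\<And>x. x \<in> A \<Longrightarrow> norm (power_grad c b x) powr (m - 1) \<le> M"
  shows "Kfun m DIM('a) b * (LINT x:A|lebesgue. truncated_hardy_gap b c (\<delta> + 3 * \<tau>) x)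
    \<le> 2 * (M + 1) * (LINT x:A|lebesgue. gradient_error m Du v x)"
proof -
  define W where "W x = c * norm x powr (- b) - (\<delta> + 2 * \<tau>) - v x" for x
  interpret negative_on_frontier ext_dom A W
    unfolding W_def by (rule negative_on_frontier_power_minus_smooth[OF domain_A(1,2) smooth_v close \<open>\<tau> > 0\<close>
      frontier])
  have below: "u x < c * norm x powr (- b)" if "x \<in> A" "W x \<ge> 0" for x
    using close[OF that(1)] that(2) \<open>\<tau> > 0\<close> \<open>\<delta> \<ge> 0\<close> by (simp add: W_def abs_le_iff)
  have grad_W: "grad W x = power_grad c b x - grad v x" if "x \<in> A" for x
    unfolding W_def using that domain_A(2) zero_notin_ext_dom
    by (intro grad_power_minus_smooth[OF smooth_v]) auto
  have "Kfun m DIM('a) b * (LINT x:A|lebesgue. truncated_hardy_gap b c (\<delta> + 3 * \<tau>) x)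
      \<le> Kfun m DIM('a) b * (LINT x:ext_dom|lebesgue. hardy_gap b c x * flat_cutoff A W x)"
  proof (intro mult_left_mono)
    show "(LINT x:A|lebesgue. truncated_hardy_gap b c (\<delta> + 3 * \<tau>) x)
        \<le> (LINT x:ext_dom|lebesgue. hardy_gap b c x * flat_cutoff A W x)"
    proof (rule hardy_gap_integral_mono[OF params_pos(1) domain_A(1,2) _ test_fun_flat_cutoff])
      show "c * norm x powr (- b) - u x - (\<delta> + 3 * \<tau>) \<le> W x" if "x \<in> A" for x
        using close[OF that] by (simp add: W_def abs_le_iff)
    qed (use \<open>\<tau> > 0\<close> \<open>\<delta> \<ge> 0\<close> below in \<open>auto intro: less_imp_le\<close>)
  qed (use Kfun_pos[OF m_gt_1 dim_le params_pos(2)] in simp)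
  also have "\<dots> \<le> (LINT x:ext_dom|lebesgue. (m_flux m (Du x) - m_flux m (power_grad c b x))
    \<bullet> grad (flat_cutoff A W) x)"
  proof (rule hardy_gap_le_flux_diff[OF params_pos supersolution test_fun_flat_cutoff flat_cutoff_nonneg])
    fix x assume "x \<in> tsupport (flat_cutoff A W)"
    then have "x \<in> A" "W x \<ge> 0" using tsupport_flat_cutoff by auto
    then show "R < norm x \<and> u x < 1" using below[of x] power_le_1[of x] domain_A(3)[of x] by auto
  qed
  also have "\<dots> \<le> 2 * (M + 1) * (LINT x:A|lebesgue. gradient_error m Du v x)"
    by (rule flux_diff_le_gradient_error[OF domain_A(2) test_fun_flat_cutoff _ _ flux_bound(2)
      integrable_error, of W])
       (use flux_bound(1) grad_W in \<open>auto simp: grad_flat_cutoff\<close>)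
  finally show ?thesis .
qed

lemma comparison_principle:
  assumes params_pos: "c > 0" "b > 0" and supersolution: "hardy_supersolution m (Kfun m DIM('a) b) R u Du"
    and compact_A: "compact A" "A \<subseteq> ext_dom" "\<And>x. x \<in> A \<Longrightarrow> R < norm x"
    and power_le_1: "\<And>x. x \<in> A \<Longrightarrow> c * norm x powr (- b) \<le> 1"
    and frontier: "\<And>x. x \<in> frontier A \<Longrightarrow> c * norm x powr (- b) \<le> u x + \<delta>" and "\<delta> \<ge> 0" and x0_in_A: "x0 \<in> A"
  shows "c * norm x0 powr (- b) \<le> u x0 + \<delta>"
proof (rule ccontr)
  assume not_le: "\<not> c * norm x0 powr (- b) \<le> u x0 + \<delta>"
  define \<tau> where "\<tau> = (c * norm x0 powr (- b) - u x0 - \<delta>) / 4"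
  have \<tau>_gap: "\<tau> > 0" "u x0 + (\<delta> + 3 * \<tau>) < c * norm x0 powr (- b)"
    using not_le by (auto simp: \<tau>_def field_simps)
  have "x0 \<notin> frontier A" using frontier[of x0] not_le by auto
  then have "x0 \<in> interior A" using x0_in_A closure_subset[of A] by (auto simp: frontier_def)
  define I where "I = (LINT x:A|lebesgue. truncated_hardy_gap b c (\<delta> + 3 * \<tau>) x)"
  have "I > 0"
    unfolding I_def using \<tau>_gap \<open>\<delta> \<ge> 0\<close> by (intro
      hardy_gap_integral_pos[OF params_pos(1) compact_A(1,2) _ \<open>x0 \<in> interior A\<close>]) auto
  have Kfun_pos_b: "Kfun m DIM('a) b > 0" by (rule Kfun_pos[OF m_gt_1 dim_le params_pos(2)])
  have "continuous_on A (\<lambda>x. norm (power_grad c b x) powr (m - 1))"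
    using compact_A(2) zero_notin_ext_dom m_gt_1
    by (intro continuous_on_powr' continuous_intros continuous_on_power_grad) auto
  then have "bounded ((\<lambda>x. norm (power_grad c b x) powr (m - 1)) ` A)"
    by (intro compact_imp_bounded compact_continuous_image compact_A(1))
  then obtain M where flux_bound: "M > 0" "\<And>x. x \<in> A \<Longrightarrow> norm (power_grad c b x) powr (m - 1) \<le> M"
    by (auto simp: bounded_pos)
  define \<eta> where "\<eta> = min \<tau> (Kfun m DIM('a) b * I / (4 * (M + 1)))"
  have "\<eta> \<le> Kfun m DIM('a) b * I / (4 * (M + 1))" by (simp add: \<eta>_def)
  then have "\<eta> * (4 * (M + 1)) \<le> Kfun m DIM('a) b * I"
    using flux_bound(1) by (subst (asm) pos_le_divide_eq) auto
  then have \<eta>_pos: "\<eta> > 0" "\<eta> \<le> \<tau>" "2 * (M + 1) * \<eta> \<le> Kfun m DIM('a) b * I / 2"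
    using \<tau>_gap(1) \<open>I > 0\<close> Kfun_pos_b flux_bound(1)
    by (simp add: \<eta>_def, simp add: \<eta>_def, simp add: algebra_simps)
  obtain v where approx_v: "smooth_fun v" "\<And>x. x \<in> A \<Longrightarrow> \<bar>v x - u x\<bar> \<le> \<eta>"
    "set_integrable lebesgue A (\<lambda>x. gradient_error m Du v x)"
    "(LINT x:A|lebesgue. gradient_error m Du v x) \<le> \<eta>"
    using W1loc_smooth_approx_weighted[OF m_gt_1 open_ext_dom cont_u W1loc compact_A(1,2) \<eta>_pos(1)] by blast
  have "Kfun m DIM('a) b * I \<le> 2 * (M + 1) * (LINT x:A|lebesgue. gradient_error m Du v x)"
    unfolding I_def
    by (rule hardy_gap_integral_le_gradient_error[OF params_pos supersolution compact_A power_le_1 frontier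
      \<open>\<delta> \<ge> 0\<close> \<tau>_gap(1) approx_v(1) _ approx_v(3) _ flux_bound(2)])
       (use approx_v(2) \<eta>_pos(2) flux_bound(1) in \<open>auto intro: order_trans\<close>)
  also have "\<dots> \<le> 2 * (M + 1) * \<eta>" using approx_v(4) flux_bound(1) by (intro mult_left_mono) auto
  also have "\<dots> \<le> Kfun m DIM('a) b * I / 2" by (rule \<eta>_pos(3))
  finally show False using Kfun_pos_b \<open>I > 0\<close> by simp
qed

lemma frontier_annulus_subset: "frontier (cball 0 t - ball 0 s) \<subseteq> sphere (0::'a) s \<union> sphere 0 t"
proof
  fix x :: 'a assume "x \<in> frontier (cball 0 t - ball 0 s)"
  then have "s \<le> norm x" "norm x \<le> t" "x \<notin> interior (cball 0 t - ball 0 s)"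
    using frontier_subset_closed[of "cball 0 t - ball (0::'a) s"]
    by (auto simp: frontier_def closed_Diff)
  moreover have "ball 0 t - cball 0 s \<subseteq> interior (cball 0 t - ball (0::'a) s)"
    by (intro interior_maximal) (auto simp: open_Diff)
  ultimately show "x \<in> sphere 0 s \<union> sphere 0 t" by force
qed

lemma comparison_outside_ball:
  assumes params_pos: "c > 0" "b > 0" and supersolution: "hardy_supersolution m (Kfun m DIM('a) b) R u Du"
    and s_bounds: "s > R" "s > 1" "c * s powr (- b) \<le> 1" and sphere: "\<And>y. norm y = s \<Longrightarrow> c * s powr (- b) \<le> u y"
    and x_outside: "norm x \<ge> s"
  shows "c * norm x powr (- b) \<le> u x"
proof (rule field_le_epsilon)
  fix \<epsilon> :: real assume "\<epsilon> > 0"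
  have "((\<lambda>r. c * r powr (- b)) \<longlongrightarrow> 0) at_top"
    using params_pos(2) by real_asymp
  then have "eventually (\<lambda>r. c * r powr (- b) < \<epsilon> \<and> r > norm x) at_top"
    using order_tendstoD(2)[of _ 0 at_top \<epsilon>] \<open>\<epsilon> > 0\<close> by (intro eventually_conj eventually_gt_at_top)
  then obtain t where t_large: "c * t powr (- b) < \<epsilon>" "t > norm x"
    by (auto simp: eventually_at_top_linorder)
  define A where "A = cball 0 t - ball (0::'a) s"
  have compact_A: "compact A" "A \<subseteq> ext_dom" "x \<in> A" "\<And>y. y \<in> A \<Longrightarrow> norm y \<ge> s"
    using s_bounds x_outside t_large(2) by (auto simp: A_def compact_diff ext_dom_iff)
  show "c * norm x powr (- b) \<le> u x + \<epsilon>"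
  proof (rule comparison_principle[OF params_pos supersolution compact_A(1,2)])
    fix y assume "y \<in> frontier A"
    then consider "norm y = s" | "norm y = t"
      using frontier_annulus_subset unfolding A_def by fastforce
    then show "c * norm y powr (- b) \<le> u y + \<epsilon>"
    proof cases
      case 1
      then show ?thesis using sphere[OF 1] \<open>\<epsilon> > 0\<close> by simp
    next
      case 2
      then have "y \<in> ext_dom" using x_outside t_large(2) s_bounds by (simp add: ext_dom_iff)
      with 2 show ?thesis using t_large(1) u_pos[of y] by simp
    qed
  next
    fix y assume "y \<in> A"
    then have "norm y \<ge> s" by (rule compact_A(4))
    with s_bounds(1) show "R < norm y" by simp
    have "c * norm y powr (- b) \<le> c * s powr (- b)"
      using \<open>norm y \<ge> s\<close> s_bounds(2) params_pos by (intro mult_left_mono powr_mono2') auto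
    with s_bounds(3) show "c * norm y powr (- b) \<le> 1" by simp
  qed (use \<open>\<epsilon> > 0\<close> compact_A(3) in auto)
qed

lemma hardy_supersolution_lower_bound:
  assumes b_pos: "b > 0" and R_ge_1: "R \<ge> 1" and supersolution:
      "hardy_supersolution m (Kfun m DIM('a) b) R u Du"
  obtains c where "c > 0" "\<And>x. norm x \<ge> R + 1 \<Longrightarrow> c * norm x powr (- b) \<le> u x"
proof -
  define S where "S = sphere (0::'a) (R + 1)"
  have "S \<subseteq> ext_dom" using R_ge_1 by (auto simp: S_def ext_dom_iff)
  then obtain x\<^sub>m where minimizer: "x\<^sub>m \<in> S" "\<And>x. x \<in> S \<Longrightarrow> u x\<^sub>m \<le> u x"
    using continuous_attains_inf[OF compact_sphere _ continuous_on_subset[OF cont_u], of 0 "R + 1"] R_ge_1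
    by (auto simp: S_def)
  define s where "s = min (u x\<^sub>m) 1"
  have s_bounds: "s > 0" "s \<le> 1" "\<And>x. x \<in> S \<Longrightarrow> s \<le> u x"
    using u_pos[of x\<^sub>m] minimizer \<open>S \<subseteq> ext_dom\<close> by (auto simp: s_def min_le_iff_disj)
  define c where "c = s * (R + 1) powr b"
  have "c > 0" using s_bounds(1) R_ge_1 by (simp add: c_def)
  moreover have "c * (R + 1) powr (- b) = s" using R_ge_1 by (simp add: c_def powr_minus)
  ultimately have "c * norm x powr (- b) \<le> u x" if "norm x \<ge> R + 1" for x
    using that R_ge_1 s_bounds by (intro comparison_outside_ball[OF _ b_pos supersolution]) (auto simp: S_def)
  then show thesis using that \<open>c > 0\<close> by blast
qed

end

section \<open>Radial integrals and the Riesz potential\<close>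

definition unit_sphere_area :: "nat \<Rightarrow> real" where
  "unit_sphere_area N = real N * unit_ball_vol (real N)"

lemma unit_sphere_area_nonneg[simp]: "unit_sphere_area N \<ge> 0"
  by (simp add: unit_sphere_area_def)

lemma unit_sphere_area_DIM_pos[simp]: "unit_sphere_area DIM('a::euclidean_space) > 0"
  using DIM_positive[where 'a='a] by (simp add: unit_sphere_area_def)

definition radial_density :: "nat \<Rightarrow> real \<Rightarrow> ennreal" where
  "radial_density N r = ennreal (unit_sphere_area N * r ^ (N - 1)) * indicator {0..} r"

lemma borel_measurable_radial_density[measurable]: "radial_density N \<in> borel_measurable borel"
  unfolding radial_density_def by measurable

lemma emeasure_radial_density_atMost:
  "emeasure (density lborel (radial_density DIM('a))) {..t}
    = emeasure (distr lborel borel (norm :: 'a::euclidean_space \<Rightarrow> real)) {..t}"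
proof (cases "t \<ge> 0")
  case True
  define \<omega> where "\<omega> = unit_ball_vol (real DIM('a))"
  have "((\<lambda>r. \<omega> * r ^ DIM('a)) has_real_derivative unit_sphere_area DIM('a) * r ^ (DIM('a) - 1)) (at r)" for r
    by (auto intro!: derivative_eq_intros simp: unit_sphere_area_def \<omega>_def)
  then have "(\<integral>\<^sup>+r. ennreal (unit_sphere_area DIM('a) * r ^ (DIM('a) - 1)) * indicator {0..t} r \<partial>lborel)
      = \<omega> * t ^ DIM('a) - \<omega> * 0 ^ DIM('a)"
    using True by (intro nn_integral_FTC_Icc) (auto simp: unit_sphere_area_def)
  moreover have "(\<lambda>r. radial_density DIM('a) r * indicator {..t} r)
      = (\<lambda>r. ennreal (unit_sphere_area DIM('a) * r ^ (DIM('a) - 1)) * indicator {0..t} r)"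
    by (auto simp: radial_density_def indicator_def)
  moreover have "norm -` {..t} = cball (0::'a) t" by auto
  ultimately show ?thesis
    using True by (simp add: emeasure_density emeasure_distr emeasure_cball \<omega>_def)
next
  case False
  then have "norm -` {..t} = ({} :: 'a set)"
    using norm_ge_zero order_trans by blast
  moreover have "(\<lambda>r. radial_density DIM('a) r * indicator {..t} r) = (\<lambda>_. 0)"
    using False by (auto simp: radial_density_def indicator_def)
  ultimately show ?thesis
    by (simp add: emeasure_density emeasure_distr)
qed

lemma distr_lborel_norm:
  "distr lborel borel (norm :: 'a::euclidean_space \<Rightarrow> real)
    = density lborel (radial_density DIM('a))"
proof (rule measure_eqI_generator_eq[symmetric, where E="range atMost" and \<Omega>=UNIV and A="\<lambda>n. {..real n}"])
  show "Int_stable (range atMost :: real set set)"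
    by (force simp: Int_stable_def)
  have "sets (borel :: real measure) = sigma_sets UNIV (range atMost)"
    by (subst borel_eq_atMost) (simp add: sets_measure_of)
  then show "sets (distr lborel borel (norm :: 'a \<Rightarrow> real)) = sigma_sets UNIV (range atMost)"
    "sets (density lborel (radial_density DIM('a)))
      = sigma_sets UNIV (range atMost)"
    by simp_all
  show "(\<Union>n. {..real n}) = UNIV"
    using real_arch_simple by auto
  have "norm -` {..real n} = cball (0::'a) (real n)" for n by auto
  then show "emeasure (density lborel (radial_density DIM('a)))
      {..real n} \<noteq> \<infinity>" for n
    using emeasure_lborel_cball_finite[of "0::'a" "real n"]
    unfolding emeasure_radial_density_atMost by (simp add: emeasure_distr)
qed (auto simp: emeasure_radial_density_atMost simp del: One_nat_def)

lemma nn_integral_norm_powr: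
  assumes [measurable]: "S \<in> sets borel" and S_nonneg: "S \<subseteq> {0..}"
  shows "(\<integral>\<^sup>+y. ennreal (norm y powr (- a)) * indicator S (norm y) \<partial>(lborel :: 'a::euclidean_space measure))
    = ennreal (unit_sphere_area DIM('a))
      * (\<integral>\<^sup>+r. ennreal (r powr (real DIM('a) - 1 - a)) * indicator S r \<partial>lborel)"
proof -
  have "(\<integral>\<^sup>+y. ennreal (norm y powr (- a)) * indicator S (norm y) \<partial>(lborel :: 'a measure))
      = (\<integral>\<^sup>+r. ennreal (r powr (- a)) * indicator S r \<partial>distr lborel borel (norm :: 'a \<Rightarrow> real))"
    by (subst nn_integral_distr) auto
  also have "\<dots> = (\<integral>\<^sup>+r. radial_density DIM('a) r * (ennreal (r powr (- a)) * indicator S r) \<partial>lborel)"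
    unfolding distr_lborel_norm by (rule nn_integral_density) measurable
  also have "\<dots> = (\<integral>\<^sup>+r. ennreal (unit_sphere_area DIM('a))
    * (ennreal (r powr (real DIM('a) - 1 - a)) * indicator S r) \<partial>lborel)"
  proof (rule nn_integral_cong)
    fix r :: real
    have "r ^ (DIM('a) - 1) * r powr (- a) = r powr (real DIM('a) - 1 - a)" if "r \<ge> 0"
    proof (cases "r = 0")
      case False
      with that have "r ^ (DIM('a) - 1) = r powr (real DIM('a) - 1)"
        using DIM_positive[where 'a='a] by (simp add: powr_realpow[symmetric] of_nat_diff)
      then show ?thesis by (simp add: powr_add[symmetric])
    qed simp
    then show "radial_density DIM('a) r * (ennreal (r powr (- a)) * indicator S r)
        = ennreal (unit_sphere_area DIM('a)) * (ennreal (r powr (real DIM('a) - 1 - a)) * indicator S r)"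
      using S_nonneg by (auto simp: radial_density_def indicator_def ennreal_mult[symmetric] mult.assoc)
  qed
  also have "\<dots> = ennreal (unit_sphere_area DIM('a))
    * (\<integral>\<^sup>+r. ennreal (r powr (real DIM('a) - 1 - a)) * indicator S r \<partial>lborel)"
    by (rule nn_integral_cmult) measurable
  finally show ?thesis .
qed

lemma nn_integral_norm_powr_cball:
  assumes "a < real DIM('a::euclidean_space)" "R \<ge> 0"
  shows "(\<integral>\<^sup>+y. ennreal (norm y powr (- a)) * indicator (cball 0 R) y \<partial>(lborel :: 'a measure))
    = ennreal (unit_sphere_area DIM('a) / (real DIM('a) - a) * R powr (real DIM('a) - a))"
proof -
  have radial_integral: "((\<lambda>r. r powr (real DIM('a) - 1 - a)) has_integral R powr (real DIM('a) - a)
    / (real DIM('a) - a)) {0..R}"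
    using has_integral_powr_from_0[of "real DIM('a) - 1 - a" R] assms by simp
  have "(\<integral>\<^sup>+y. ennreal (norm y powr (- a)) * indicator (cball 0 R) y \<partial>(lborel :: 'a measure))
      = (\<integral>\<^sup>+y. ennreal (norm y powr (- a)) * indicator {0..R} (norm y) \<partial>(lborel :: 'a measure))"
    by (intro nn_integral_cong) (simp add: indicator_def)
  also have "\<dots> = ennreal (unit_sphere_area DIM('a))
      * ennreal (R powr (real DIM('a) - a) / (real DIM('a) - a))"
    by (subst nn_integral_norm_powr) (simp_all add: nn_integral_has_integral_lebesgue'[OF _ radial_integral])
  finally show ?thesis
    using assms by (simp add: ennreal_mult[symmetric])
qed

lemma nn_integral_norm_powr_outside_ball:
  assumes "a > real DIM('a::euclidean_space)" "R > 0"
  shows "(\<integral>\<^sup>+y. ennreal (norm y powr (- a)) * indicator (- ball 0 R) y \<partial>(lborel :: 'a measure))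
    = ennreal (unit_sphere_area DIM('a) / (a - real DIM('a)) * R powr (real DIM('a) - a))"
proof -
  have "- (R powr (real DIM('a) - a)) / (real DIM('a) - a) = R powr (real DIM('a) - a) / (a - real DIM('a))"
    using assms by (simp add: field_simps)
  then have radial_integral: "((\<lambda>r. r powr (real DIM('a) - 1 - a)) has_integral R powr (real DIM('a) - a)
    / (a - real DIM('a))) {R..}"
    using has_integral_powr_to_inf[of "real DIM('a) - 1 - a" R] assms by simp
  have "(\<integral>\<^sup>+y. ennreal (norm y powr (- a)) * indicator (- ball 0 R) y \<partial>(lborel :: 'a measure))
      = (\<integral>\<^sup>+y. ennreal (norm y powr (- a)) * indicator {R..} (norm y) \<partial>(lborel :: 'a measure))"
    by (intro nn_integral_cong) (simp add: indicator_def)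
  also have "\<dots> = ennreal (unit_sphere_area DIM('a))
      * ennreal (R powr (real DIM('a) - a) / (a - real DIM('a)))"
    using assms by (subst nn_integral_norm_powr)
      (simp_all add: nn_integral_has_integral_lebesgue'[OF _ radial_integral])
  finally show ?thesis
    using assms by (simp add: ennreal_mult[symmetric])
qed

lemma nn_integral_inverse_atLeast:
  assumes "R > 0"
  shows "(\<integral>\<^sup>+r. ennreal (r powr (- 1)) * indicator {R..} r \<partial>lborel) = \<infinity>"
proof (rule ccontr)
  assume "\<not> ?thesis"
  then obtain I where I_eq: "(\<integral>\<^sup>+r. ennreal (r powr (- 1)) * indicator {R..} r \<partial>lborel) = ennreal I" "I \<ge> 0"
    by (cases "\<integral>\<^sup>+r. ennreal (r powr (- 1)) * indicator {R..} r \<partial>lborel") auto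
  define t where "t = R * exp (I + 1)"
  have t_gt_R: "t > R" using assms \<open>I \<ge> 0\<close> by (simp add: t_def)
  have "ennreal (ln t - ln R) = (\<integral>\<^sup>+r. ennreal (r powr (- 1)) * indicator {R..t} r \<partial>lborel)"
    using t_gt_R assms
    by (intro nn_integral_FTC_Icc[symmetric]) (auto intro!: derivative_eq_intros simp: powr_minus field_simps)
  also have "\<dots> \<le> ennreal I"
    unfolding I_eq(1)[symmetric] by (intro nn_integral_mono) (auto simp: indicator_def)
  finally have "ln t - ln R \<le> I" using I_eq(2) by (simp add: ennreal_le_iff)
  moreover have "ln t - ln R = I + 1" using assms by (simp add: t_def ln_mult)
  ultimately show False by simp
qed

lemma nn_integral_norm_powr_minus_dim_outside_ball:
  assumes "R > 0"
  shows "(\<integral>\<^sup>+y. ennreal (norm y powr (- real DIM('a::euclidean_space))) * indicator (- ball 0 R) y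
      \<partial>(lborel :: 'a measure)) = \<infinity>"
proof -
  have "(\<integral>\<^sup>+y. ennreal (norm y powr (- real DIM('a))) * indicator (- ball 0 R) y \<partial>(lborel :: 'a measure))
      = (\<integral>\<^sup>+y. ennreal (norm y powr (- real DIM('a))) * indicator {R..} (norm y) \<partial>(lborel :: 'a measure))"
    by (intro nn_integral_cong) (simp add: indicator_def)
  also have "\<dots> = ennreal (unit_sphere_area DIM('a)) * \<infinity>"
    using assms nn_integral_inverse_atLeast[OF assms] by (subst nn_integral_norm_powr) auto
  finally show ?thesis by (simp add: ennreal_mult_top ennreal_eq_0_iff not_le)
qed

lemma riesz_const_pos: "0 < \<alpha> \<Longrightarrow> \<alpha> < real N \<Longrightarrow> riesz_const N \<alpha> > 0"
  by (simp add: riesz_const_def Gamma_real_pos)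

lemma riesz_conv_lborel:
  "riesz_conv \<alpha> g x = (\<integral>\<^sup>+y. indicator ext_dom y * ennreal (riesz_kernel \<alpha> (x - y) * g y) \<partial>lborel)"
  by (simp add: riesz_conv_def nn_integral_completion)

definition shell :: "real \<Rightarrow> 'a::euclidean_space set" where
  "shell r = ball 0 (2 * r) - cball 0 r"

lemma shell_iff: "x \<in> shell r \<longleftrightarrow> r < norm x \<and> norm x < 2 * r"
  by (auto simp: shell_def)

lemma emeasure_shell_ge:
  assumes "r > 0"
  shows "ennreal (unit_ball_vol (real DIM('a)) * r powr real DIM('a))
      \<le> emeasure lborel (shell r :: 'a::euclidean_space set)"
proof -
  define \<omega> where "\<omega> = unit_ball_vol (real DIM('a))"
  have "(2::real) ^ DIM('a) \<ge> 2"
    using power_increasing[of 1 "DIM('a)" "2::real"] DIM_positive[where 'a='a] by simp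
  then have "(2 * r) ^ DIM('a) \<ge> 2 * r ^ DIM('a)"
    using assms by (simp add: power_mult_distrib)
  then have "\<omega> * (2 * r) ^ DIM('a) \<ge> \<omega> * (2 * r ^ DIM('a))"
    by (intro mult_left_mono) (auto simp: \<omega>_def)
  then have "ennreal (\<omega> * r ^ DIM('a)) \<le> ennreal (\<omega> * (2 * r) ^ DIM('a) - \<omega> * r ^ DIM('a))"
    by (intro ennreal_leI) (simp add: algebra_simps)
  also have "\<dots> = emeasure lborel (ball (0::'a) (2 * r)) - emeasure lborel (cball (0::'a) r)"
    using assms by (simp add: emeasure_ball emeasure_cball ennreal_minus[symmetric] \<omega>_def)
  also have "\<dots> = emeasure lborel (shell r :: 'a set)"
    unfolding shell_def using assms emeasure_lborel_cball_finite[of "0::'a" r]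
    by (intro emeasure_Diff[symmetric]) auto
  finally show ?thesis using assms by (simp add: \<omega>_def powr_realpow)
qed

lemma riesz_conv_ge_shell:
  fixes x :: "'a::euclidean_space"
  assumes \<alpha>_bounds: "0 < \<alpha>" "\<alpha> < real DIM('a)" and "r \<ge> 1" "k \<ge> 0"
    and g_ge: "\<And>y. r < norm y \<Longrightarrow> norm y < 2 * r \<Longrightarrow> k \<le> g y"
  shows "ennreal (riesz_const DIM('a) \<alpha> * (norm x + 2 * r) powr (\<alpha> - real DIM('a)) * k
      * (unit_ball_vol (real DIM('a)) * r powr real DIM('a))) \<le> riesz_conv \<alpha> g x"
proof -
  define C where "C = riesz_const DIM('a) \<alpha> * (norm x + 2 * r) powr (\<alpha> - real DIM('a)) * k"
  have C_nonneg: "C \<ge> 0" using riesz_const_pos[OF \<alpha>_bounds] \<open>k \<ge> 0\<close> by (simp add: C_def)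
  have "ennreal (C * (unit_ball_vol (real DIM('a)) * r powr real DIM('a)))
    \<le> ennreal C * emeasure lborel (shell r - {x})"
  proof -
    have "emeasure lborel (shell r - {x}) = emeasure lborel (shell r :: 'a set)"
      by (intro emeasure_Diff_null_set) (auto simp: shell_def)
    then show ?thesis
      using emeasure_shell_ge[of r, where 'a='a] C_nonneg \<open>r \<ge> 1\<close> by (simp add: ennreal_mult mult_left_mono)
  qed
  also have "\<dots> = (\<integral>\<^sup>+y. ennreal C * indicator (shell r - {x}) y \<partial>lborel)"
    by (subst nn_integral_cmult_indicator) (auto simp: shell_def)
  also have "\<dots> \<le> riesz_conv \<alpha> g x"
    unfolding riesz_conv_lborel
  proof (rule nn_integral_mono)
    fix y
    show "ennreal C * indicator (shell r - {x}) y
      \<le> indicator ext_dom y * ennreal (riesz_kernel \<alpha> (x - y) * g y)"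
    proof (cases "y \<in> shell r - {x}")
      case True
      then have y_bounds: "r < norm y" "norm y < 2 * r" "y \<noteq> x" by (auto simp: shell_iff)
      then have "(norm x + 2 * r) powr (\<alpha> - real DIM('a)) \<le> norm (x - y) powr (\<alpha> - real DIM('a))"
        using \<alpha>_bounds norm_triangle_ineq4[of x y] by (intro powr_mono2') auto
      then have "C \<le> riesz_kernel \<alpha> (x - y) * g y"
        using g_ge[OF y_bounds(1,2)] \<open>k \<ge> 0\<close> riesz_const_pos[OF \<alpha>_bounds] unfolding C_def riesz_kernel_def
        by (intro mult_mono) auto
      then show ?thesis
        using True y_bounds(1) \<open>r \<ge> 1\<close> by (auto simp: ext_dom_iff intro!: ennreal_leI)
    qed simp
  qed
  finally show ?thesis by (simp add: C_def)
qed

lemma riesz_conv_lower_bound: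
  fixes g :: "'a::euclidean_space \<Rightarrow> real"
  assumes \<alpha>_bounds: "0 < \<alpha>" "\<alpha> < real DIM('a)"
    and cont_pos_g: "continuous_on ext_dom g" "\<And>y. y \<in> ext_dom \<Longrightarrow> g y > 0"
  obtains c where "c > 0" "\<And>x. norm x \<ge> 1 \<Longrightarrow> ennreal (c * norm x powr (\<alpha> - real DIM('a))) \<le> riesz_conv \<alpha> g x"
proof -
  define B where "B = (cball 0 4 - ball 0 2 :: 'a set)"
  obtain b :: 'a where "b \<in> Basis" using nonempty_Basis by blast
  then have "3 *\<^sub>R b \<in> B" by (simp add: B_def)
  moreover have compact_B: "compact B" "B \<subseteq> ext_dom" by (auto simp: B_def compact_diff ext_dom_iff)
  ultimately obtain y0 where minimizer: "y0 \<in> B" "\<And>y. y \<in> B \<Longrightarrow> g y0 \<le> g y"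
    using continuous_attains_inf[OF compact_B(1) _ continuous_on_subset[OF cont_pos_g(1) compact_B(2)]] by blast
  define k where "k = g y0"
  have k_pos: "k > 0" using cont_pos_g(2) minimizer(1) compact_B(2) by (auto simp: k_def)
  define c where "c = riesz_const DIM('a) \<alpha> * 5 powr (\<alpha> - real DIM('a)) * k
    * (unit_ball_vol (real DIM('a)) * 2 powr real DIM('a))"
  show thesis
  proof (rule that)
    show "c > 0" using k_pos riesz_const_pos[OF \<alpha>_bounds] by (simp add: c_def)
    fix x :: 'a assume x_bounds: "norm x \<ge> 1"
    have "(5 * norm x) powr (\<alpha> - real DIM('a)) \<le> (norm x + 2 * 2) powr (\<alpha> - real DIM('a))"
      using x_bounds \<alpha>_bounds by (intro powr_mono2') auto
    then have constant_le: "c * norm x powr (\<alpha> - real DIM('a))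
      \<le> riesz_const DIM('a) \<alpha> * (norm x + 2 * 2) powr (\<alpha> - real DIM('a)) * k
        * (unit_ball_vol (real DIM('a)) * 2 powr real DIM('a))"
      using k_pos riesz_const_pos[OF \<alpha>_bounds] by (simp add: c_def powr_mult mult_right_mono)
    show "ennreal (c * norm x powr (\<alpha> - real DIM('a))) \<le> riesz_conv \<alpha> g x"
      using k_pos minimizer(2)
      by (intro order_trans[OF ennreal_leI[OF constant_le]] riesz_conv_ge_shell[OF \<alpha>_bounds])
        (auto simp: k_def B_def)
  qed
qed

lemma riesz_conv_power_lower_bound:
  fixes g :: "'a::euclidean_space \<Rightarrow> real"
  assumes \<alpha>_bounds: "0 < \<alpha>" "\<alpha> < real DIM('a)" and "k > 0" "\<sigma> \<ge> 0" "R \<ge> 1"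
    and lower: "\<And>y. norm y \<ge> R \<Longrightarrow> k * norm y powr (- \<sigma>) \<le> g y"
  obtains c where "c > 0" "\<And>x. norm x \<ge> R \<Longrightarrow> ennreal (c * norm x powr (\<alpha> - \<sigma>)) \<le> riesz_conv \<alpha> g x"
proof -
  define n where "n = real DIM('a)"
  define c where "c = riesz_const DIM('a) \<alpha> * 3 powr (\<alpha> - n) * (k * 2 powr (- \<sigma>)) * unit_ball_vol n"
  show thesis
  proof (rule that)
    show "c > 0" using \<open>k > 0\<close> riesz_const_pos[OF \<alpha>_bounds] by (simp add: c_def n_def)
    fix x :: 'a assume x_bounds: "norm x \<ge> R"
    have "norm x powr (\<alpha> - n) * norm x powr (- \<sigma>) * norm x powr n = norm x powr (\<alpha> - \<sigma>)"
      unfolding powr_add[symmetric] by simp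
    then have "c * norm x powr (\<alpha> - \<sigma>) = riesz_const DIM('a) \<alpha> * (norm x + 2 * norm x) powr (\<alpha> - n)
        * (k * (2 * norm x) powr (- \<sigma>)) * (unit_ball_vol n * norm x powr n)"
      using powr_mult[of 3 "norm x" "\<alpha> - n"] by (simp add: c_def powr_mult mult_ac)
    also have "ennreal \<dots> \<le> riesz_conv \<alpha> g x"
      unfolding n_def
    proof (rule riesz_conv_ge_shell[OF \<alpha>_bounds])
      fix y :: 'a assume y_bounds: "norm x < norm y" "norm y < 2 * norm x"
      have "k * (2 * norm x) powr (- \<sigma>) \<le> k * norm y powr (- \<sigma>)"
        using y_bounds x_bounds \<open>k > 0\<close> \<open>\<sigma> \<ge> 0\<close> \<open>R \<ge> 1\<close> by (intro mult_left_mono powr_mono2') auto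
      also have "\<dots> \<le> g y" using y_bounds x_bounds by (intro lower) simp
      finally show "k * (2 * norm x) powr (- \<sigma>) \<le> g y" .
    qed (use x_bounds \<open>k > 0\<close> \<open>R \<ge> 1\<close> in auto)
    finally show "ennreal (c * norm x powr (\<alpha> - \<sigma>)) \<le> riesz_conv \<alpha> g x" .
  qed
qed

lemma riesz_integrability_exponent:
  fixes u :: "'a::euclidean_space \<Rightarrow> real"
  assumes \<alpha>_bounds: "0 < \<alpha>" "\<alpha> < real DIM('a)" and p_pos: "p > 0" and "c > 0" "R > 1"
    and lower: "\<And>x. norm x \<ge> R \<Longrightarrow> c * norm x powr (- b) \<le> u x"
    and finite_at_infinity: "(\<integral>\<^sup>+ y. indicator ext_dom y
      * ennreal (u y powr p / (1 + norm y powr (real DIM('a) - \<alpha>))) \<partial>lebesgue) < \<infinity>"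
  shows "p * b > \<alpha>"
proof (rule ccontr)
  assume not_gt: "\<not> p * b > \<alpha>"
  define n where "n = real DIM('a)"
  have "\<infinity> = ennreal (c powr p / 2) * (\<integral>\<^sup>+y. ennreal (norm y powr (- n)) * indicator (- ball 0 R) y
    \<partial>(lborel :: 'a measure))"
    using \<open>c > 0\<close> \<open>R > 1\<close> nn_integral_norm_powr_minus_dim_outside_ball[of R, where 'a='a]
    by (simp add: n_def ennreal_mult_top ennreal_eq_0_iff not_le)
  also have "\<dots> = (\<integral>\<^sup>+y. ennreal (c powr p / 2) * (ennreal (norm y powr (- n)) * indicator (- ball 0 R) y)
    \<partial>(lborel :: 'a measure))"
    by (rule nn_integral_cmult[symmetric]) (intro borel_measurable_times_ennreal borel_measurable_indicator;
      simp)
  also have "\<dots> \<le> (\<integral>\<^sup>+ y. indicator ext_dom y * ennreal (u y powr p / (1 + norm y powr (n - \<alpha>))) \<partial>lborel)"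
  proof (rule nn_integral_mono)
    fix y :: 'a
    show "ennreal (c powr p / 2) * (ennreal (norm y powr (- n)) * indicator (- ball 0 R) y)
        \<le> indicator ext_dom y * ennreal (u y powr p / (1 + norm y powr (n - \<alpha>)))"
    proof (cases "norm y \<ge> R")
      case True
      then have y_bounds: "norm y \<ge> 1" "y \<in> ext_dom" using \<open>R > 1\<close> by (auto simp: ext_dom_iff)
      have "c powr p * norm y powr (- \<alpha>) \<le> c powr p * norm y powr (- (b * p))"
        using y_bounds not_gt by (intro mult_left_mono powr_mono) (auto simp: mult.commute)
      also have "\<dots> = (c * norm y powr (- b)) powr p"
        using \<open>c > 0\<close> by (simp add: powr_power_mult)
      also have "\<dots> \<le> u y powr p"
        using lower[OF True] \<open>c > 0\<close> p_pos by (intro powr_mono2) auto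
      finally have "c powr p * norm y powr (- \<alpha>) / (2 * norm y powr (n - \<alpha>))
        \<le> u y powr p / (1 + norm y powr (n - \<alpha>))"
        using y_bounds \<alpha>_bounds ge_one_powr_ge_zero[of "norm y" "n - \<alpha>"]
        by (intro frac_le) (auto simp: n_def add_pos_nonneg)
      moreover have "norm y powr (- n) = norm y powr (- \<alpha>) / norm y powr (n - \<alpha>)"
        unfolding powr_diff[symmetric] by simp
      ultimately show ?thesis
        using True y_bounds(2) by (simp add: ennreal_mult[symmetric] ennreal_leI)
    qed simp
  qed
  also have "\<dots> < \<infinity>" using finite_at_infinity by (simp add: n_def nn_integral_completion)
  finally show False by simp
qed

section \<open>Necessity\<close>

lemma borel_measurable_ext_dom:
  fixes g :: "'a::euclidean_space \<Rightarrow> real"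
  assumes "continuous_on ext_dom g"
  shows "(\<lambda>x. indicator ext_dom x * g x) \<in> borel_measurable borel"
  using borel_measurable_continuous_on_indicator[OF ext_dom_measurable(1) assms] by simp

lemma borel_measurable_riesz_conv:
  fixes g :: "'a::euclidean_space \<Rightarrow> real"
  assumes "continuous_on ext_dom g"
  shows "riesz_conv \<alpha> g \<in> borel_measurable borel"
proof -
  have [measurable]: "(\<lambda>x. indicator ext_dom x * g x) \<in> borel_measurable borel"
    by (rule borel_measurable_ext_dom[OF assms])
  have "riesz_conv \<alpha> g x = (\<integral>\<^sup>+y. ennreal (riesz_const DIM('a) \<alpha> * norm (x - y) powr (\<alpha> - real DIM('a))
      * (indicator ext_dom y * g y)) \<partial>lborel)" for x
    unfolding riesz_conv_lborel riesz_kernel_def by (intro nn_integral_cong) (simp add: indicator_def)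
  then have "riesz_conv \<alpha> g = (\<lambda>x. \<integral>\<^sup>+y. ennreal (riesz_const DIM('a) \<alpha> * norm (x - y) powr (\<alpha> - real DIM('a))
      * (indicator ext_dom y * g y)) \<partial>lborel)"
    by (rule ext)
  also have "\<dots> \<in> borel_measurable borel" by measurable
  finally show ?thesis .
qed

locale exterior_solution = exterior_sobolev_function m u Du
  for m :: real and u :: "'a::euclidean_space \<Rightarrow> real" and Du :: "'a \<Rightarrow> 'a" +
  fixes \<mu> p q \<alpha> :: real
  assumes p_pos: "p > 0" and \<alpha>_bounds: "0 < \<alpha>" "\<alpha> < real DIM('a)"
    and locally_integrable: "compact K \<Longrightarrow> K \<subseteq> ext_dom \<Longrightarrow>
      (\<integral>\<^sup>+ x. indicator K x * riesz_conv \<alpha> (\<lambda>y. u y powr p) x * ennreal (u x powr q) \<partial>lebesgue) < \<infinity>"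
    and integrable_at_infinity:
      "(\<integral>\<^sup>+ y. indicator ext_dom y * ennreal (u y powr p / (1 + norm y powr (real DIM('a) - \<alpha>))) \<partial>lebesgue) < \<infinity>"
    and inequality: "test_fun ext_dom \<phi> \<Longrightarrow> (\<And>x. \<phi> x \<ge> 0) \<Longrightarrow>
      enn2real (\<integral>\<^sup>+ x. indicator ext_dom x * riesz_conv \<alpha> (\<lambda>y. u y powr p) x * ennreal (u x powr q * \<phi> x)
        \<partial>lebesgue)
      \<le> (LINT x:ext_dom|lebesgue. m_flux m (Du x) \<bullet> grad \<phi> x - \<mu> / norm x powr m * u x powr (m - 1) * \<phi> x)"
begin

abbreviation potential :: "'a \<Rightarrow> ennreal" where
  "potential \<equiv> riesz_conv \<alpha> (\<lambda>y. u y powr p)"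

lemma continuous_on_powr_u: "continuous_on ext_dom (\<lambda>x. u x powr s)"
  by (intro continuous_intros cont_u) (use u_pos in \<open>force simp: less_imp_neq\<close>)

lemma nonlocal_term_measurable:
  assumes "K \<subseteq> ext_dom" and [measurable]: "K \<in> sets borel"
  shows "(\<lambda>x. indicator K x * potential x * ennreal (u x powr q)) \<in> borel_measurable lebesgue"
proof -
  have [measurable]: "(\<lambda>x. indicator ext_dom x * u x powr q) \<in> borel_measurable borel"
    "potential \<in> borel_measurable borel"
    by (intro borel_measurable_ext_dom borel_measurable_riesz_conv continuous_on_powr_u)+
  have "(\<lambda>x. indicator K x * potential x * ennreal (indicator ext_dom x
    * u x powr q)) \<in> borel_measurable lborel"
    by measurable
  moreover have "indicator K x * potential x * ennreal (indicator ext_dom x * u x powr q)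
      = indicator K x * potential x * ennreal (u x powr q)" for x
    using assms(1) by (auto simp: indicator_def)
  ultimately show ?thesis by (simp add: measurable_completion)
qed

lemma nonlocal_integral_finite:
  assumes test: "test_fun ext_dom \<phi>"
  shows "(\<integral>\<^sup>+ x. indicator ext_dom x * potential x * ennreal (u x powr q * \<phi> x) \<partial>lebesgue) < \<infinity>"
proof -
  obtain C where bound_C: "C > 0" "\<And>x. \<bar>\<phi> x\<bar> \<le> C" using test_fun_bounded[OF test] by blast
  note supp = test_funD(2,3)[OF test]
  show ?thesis
  proof (rule nn_integral_mult_bounded_inf[OF nonlocal_term_measurable locally_integrable[OF supp]])
    show "AE x in lebesgue. indicator ext_dom x * potential x * ennreal (u x powr q * \<phi> x)
        \<le> ennreal C * (indicator (tsupport \<phi>) x * potential x * ennreal (u x powr q))"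
    proof (rule AE_I2)
      fix x
      show "indicator ext_dom x * potential x * ennreal (u x powr q * \<phi> x)
          \<le> ennreal C * (indicator (tsupport \<phi>) x * potential x * ennreal (u x powr q))"
      proof (cases "x \<in> tsupport \<phi>")
        case True
        have "ennreal (u x powr q * \<phi> x) \<le> ennreal (u x powr q) * ennreal C"
          using bound_C(2)[of x] bound_C(1) by
            (simp add: ennreal_mult[symmetric] ennreal_leI mult_left_mono abs_le_iff)
        then have "potential x * ennreal (u x powr q * \<phi> x) \<le> potential x * (ennreal (u x powr q) * ennreal C)"
          by (rule mult_left_mono) simp
        with True supp(2) show ?thesis by (auto simp: mult_ac)
      qed (simp add: eq_0_outside_tsupport)
    qed
  qed (use supp borel_closed[OF closed_tsupport] in auto)
qed

lemma hardy_weight_integral_le_nonlocal_integral: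
  assumes test: "test_fun ext_dom \<phi>" and nonneg: "\<And>x. \<phi> x \<ge> 0" and "\<kappa> \<ge> 0"
    and weight_le: "\<And>x. x \<in> tsupport \<phi> \<Longrightarrow>
      ennreal (\<kappa> * hardy_weight m u x) \<le> potential x * ennreal (u x powr q)"
  shows "\<kappa> * (LINT x:ext_dom|lebesgue. hardy_weight m u x * \<phi> x)
    \<le> enn2real (\<integral>\<^sup>+ x. indicator ext_dom x * potential x * ennreal (u x powr q * \<phi> x) \<partial>lebesgue)"
proof -
  define P where "P x = \<kappa> * (indicator ext_dom x *\<^sub>R (hardy_weight m u x * \<phi> x))" for x
  have integral_P: "integral\<^sup>L lebesgue P = \<kappa> * (LINT x:ext_dom|lebesgue. hardy_weight m u x * \<phi> x)"
    unfolding P_def set_lebesgue_integral_def by (rule integral_mult_right_zero)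
  define X where "X = (\<integral>\<^sup>+ x. indicator ext_dom x * potential x * ennreal (u x powr q * \<phi> x) \<partial>lebesgue)"
  have integrable_P: "integrable lebesgue P"
    using set_integrable_hardy_weight[OF test] unfolding P_def set_integrable_def
    by (rule integrable_mult_right)
  have P_nonneg: "P x \<ge> 0" for x using nonneg \<open>\<kappa> \<ge> 0\<close> by (simp add: P_def hardy_weight_nonneg)
  have "ennreal (integral\<^sup>L lebesgue P) = (\<integral>\<^sup>+x. ennreal (P x) \<partial>lebesgue)"
    using nn_integral_eq_integral[OF integrable_P] P_nonneg by simp
  also have "\<dots> \<le> X"
    unfolding X_def
  proof (rule nn_integral_mono)
    fix x
    show "ennreal (P x) \<le> indicator ext_dom x * potential x * ennreal (u x powr q * \<phi> x)"
    proof (cases "x \<in> tsupport \<phi>")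
      case True
      then have "x \<in> ext_dom" using test_funD(3)[OF test] by blast
      then have "ennreal (P x) = ennreal (\<kappa> * hardy_weight m u x) * ennreal (\<phi> x)"
        using nonneg \<open>\<kappa> \<ge> 0\<close> by (simp add: P_def ennreal_mult[symmetric] hardy_weight_nonneg mult_ac)
      also have "\<dots> \<le> (potential x * ennreal (u x powr q)) * ennreal (\<phi> x)"
        using weight_le[OF True] by (rule mult_right_mono) simp
      finally show ?thesis
        using \<open>x \<in> ext_dom\<close> nonneg by (simp add: ennreal_mult mult_ac)
    qed (simp add: P_def eq_0_outside_tsupport)
  qed
  finally have "integral\<^sup>L lebesgue P \<le> enn2real X"
    using nonlocal_integral_finite[OF test] unfolding X_def[symmetric]
    by (cases X) (auto simp: ennreal_le_iff)
  then show ?thesis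
    unfolding X_def integral_P .
qed

lemma hardy_supersolution_improved:
  assumes "\<kappa> \<ge> 0"
    and weight_le: "\<And>x. x \<in> ext_dom \<Longrightarrow> R < norm x \<Longrightarrow> u x < 1 \<Longrightarrow>
      ennreal (\<kappa> * hardy_weight m u x) \<le> potential x * ennreal (u x powr q)"
  shows "hardy_supersolution m (- \<mu> - \<kappa>) R u Du"
  unfolding hardy_supersolution_def
proof (intro allI impI, elim conjE)
  fix \<phi> :: "'a \<Rightarrow> real"
  assume test: "test_fun ext_dom \<phi>" and nonneg: "\<forall>x. 0 \<le> \<phi> x" and supp: "\<forall>x\<in>tsupport \<phi>. R < norm x \<and> u x < 1"
  define P where "P x = hardy_weight m u x * \<phi> x" for x
  have integrable_P: "set_integrable lebesgue ext_dom (\<lambda>x. \<mu> * P x)"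
    unfolding P_def using set_integrable_hardy_weight[OF test] by simp
  have "\<kappa> * (LINT x:ext_dom|lebesgue. P x)
      \<le> enn2real (\<integral>\<^sup>+ x. indicator ext_dom x * potential x * ennreal (u x powr q * \<phi> x) \<partial>lebesgue)"
    unfolding P_def using test_funD(3)[OF test] supp nonneg
    by (intro hardy_weight_integral_le_nonlocal_integral[OF test _ \<open>\<kappa> \<ge> 0\<close>] weight_le) auto
  also have "\<dots> \<le> (LINT x:ext_dom|lebesgue. m_flux m (Du x) \<bullet> grad \<phi> x - \<mu> / norm x powr m * u x powr (m - 1)
    * \<phi> x)"
    using nonneg by (intro inequality[OF test]) auto
  also have "\<dots> = (LINT x:ext_dom|lebesgue. m_flux m (Du x) \<bullet> grad \<phi> x - \<mu> * P x)"
    by (simp add: P_def hardy_weight_def powr_minus divide_inverse mult_ac)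
  also have "\<dots> = (LINT x:ext_dom|lebesgue. m_flux m (Du x) \<bullet> grad \<phi> x) - \<mu> * (LINT x:ext_dom|lebesgue. P x)"
    using set_integral_diff(2)[OF set_integrable_m_flux[OF m_gt_1 W1loc test] integrable_P] by simp
  finally show "0 \<le> (LINT x:ext_dom|lebesgue. m_flux m (Du x) \<bullet> grad \<phi> x)
      + (- \<mu> - \<kappa>) * (LINT x:ext_dom|lebesgue. hardy_weight m u x * \<phi> x)"
    unfolding P_def by (simp add: algebra_simps)
qed

lemma hardy_supersolution: "hardy_supersolution m (- \<mu>) 1 u Du"
  using hardy_supersolution_improved[of 0 1] by simp

lemma not_hardy_supersolution:
  assumes "R \<ge> 1"
  shows "\<not> hardy_supersolution m (Kfun m DIM('a) (\<alpha> / p)) R u Du"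
proof
  assume "hardy_supersolution m (Kfun m DIM('a) (\<alpha> / p)) R u Du"
  then obtain c where "c > 0" "\<And>x. norm x \<ge> R + 1 \<Longrightarrow> c * norm x powr (- (\<alpha> / p)) \<le> u x"
    using hardy_supersolution_lower_bound[of "\<alpha> / p" R] \<alpha>_bounds p_pos assms by auto
  then have "p * (\<alpha> / p) > \<alpha>"
    using assms by (intro riesz_integrability_exponent[OF \<alpha>_bounds p_pos _ _ _ integrable_at_infinity]) auto
  then show False using p_pos by simp
qed

lemma Kfun_less_minus_\<mu>: "Kfun m DIM('a) (\<alpha> / p) < - \<mu>"
  using not_hardy_supersolution[of 1] hardy_supersolution_mono[OF hardy_supersolution _ order_refl]
  by (meson not_less order_refl)

lemma \<mu>_neg: "\<mu> < 0"
  using Kfun_less_minus_\<mu> Kfun_pos[OF m_gt_1 dim_le, of "\<alpha> / p"] \<alpha>_bounds p_pos by simp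

lemma root_gt:
  assumes "b > 0" "Kfun m DIM('a) b = - \<mu>"
  shows "p * b > \<alpha>"
proof -
  have "\<alpha> / p < b"
  proof (rule ccontr)
    assume "\<not> \<alpha> / p < b"
    then have "Kfun m DIM('a) b \<le> Kfun m DIM('a) (\<alpha> / p)"
      using Kfun_strict_mono[OF m_gt_1 dim_le, of b "\<alpha> / p"] assms(1) by (cases "b = \<alpha> / p") auto
    then show False using Kfun_less_minus_\<mu> assms(2) by simp
  qed
  then show ?thesis using p_pos by (simp add: field_simps)
qed

text \<open>Otherwise the nonlocal term would dominate every multiple of the Hardy term, and every Hardy
  constant would be admissible.\<close>

lemma nonlocal_term_growth_bounded:
  assumes "c > 0" "\<theta> > 0" "R \<ge> 1"
  shows "\<exists>x. x \<in> ext_dom \<and> norm x \<ge> R \<and> u x < 1 \<and>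
    \<not> ennreal (c * norm x powr (\<theta> - m) * u x powr (m - 1)) \<le> potential x * ennreal (u x powr q)"
proof (rule ccontr)
  assume dominated: "\<not> ?thesis"
  define \<kappa> where "\<kappa> = - \<mu> - Kfun m DIM('a) (\<alpha> / p)"
  have "\<kappa> > 0" using Kfun_less_minus_\<mu> by (simp add: \<kappa>_def)
  have "filterlim (\<lambda>r. c * r powr \<theta>) at_top at_top"
    using assms by real_asymp
  then have "eventually (\<lambda>r. c * r powr \<theta> \<ge> \<kappa>) at_top"
    by (simp add: filterlim_at_top)
  then obtain R' where dominates_\<kappa>: "\<And>r. r \<ge> R' \<Longrightarrow> c * r powr \<theta> \<ge> \<kappa>"
    by (auto simp: eventually_at_top_linorder)
  have "hardy_supersolution m (- \<mu> - \<kappa>) (max R R') u Du"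
  proof (rule hardy_supersolution_improved)
    fix x assume x_bounds: "x \<in> ext_dom" "max R R' < norm x" "u x < 1"
    have "\<kappa> * hardy_weight m u x \<le> c * norm x powr \<theta> * hardy_weight m u x"
      using dominates_\<kappa>[of "norm x"] x_bounds(2) by (intro mult_right_mono) (auto simp: hardy_weight_nonneg)
    also have "\<dots> = c * norm x powr (\<theta> - m) * u x powr (m - 1)"
      using powr_add[of "norm x" \<theta> "- m"] by (simp add: hardy_weight_def)
    finally have "ennreal (\<kappa> * hardy_weight m u x) \<le> ennreal (c * norm x powr (\<theta> - m) * u x powr (m - 1))"
      by (rule ennreal_leI)
    also have "\<dots> \<le> potential x * ennreal (u x powr q)" using dominated x_bounds by auto
    finally show "ennreal (\<kappa> * hardy_weight m u x) \<le> potential x * ennreal (u x powr q)" .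
  qed (use \<open>\<kappa> > 0\<close> in simp)
  then show False
    using not_hardy_supersolution[of "max R R'"] \<open>R \<ge> 1\<close> by (simp add: \<kappa>_def)
qed

lemma nonlocal_term_ge:
  assumes "ennreal (c * norm x powr s) \<le> potential x" "c \<ge> 0" and "d * norm x powr e \<le> u x powr (q - (m - 1))"
  shows "ennreal (c * d * norm x powr (s + e) * u x powr (m - 1)) \<le> potential x * ennreal (u x powr q)"
proof -
  have "c * d * norm x powr (s + e) * u x powr (m - 1)
    = (c * norm x powr s) * ((d * norm x powr e) * u x powr (m - 1))"
    by (simp add: powr_add mult_ac)
  also have "\<dots> \<le> (c * norm x powr s) * (u x powr (q - (m - 1)) * u x powr (m - 1))"
    using assms by (intro mult_left_mono mult_right_mono) auto
  also have "u x powr (q - (m - 1)) * u x powr (m - 1) = u x powr q"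
    unfolding powr_add[symmetric] by simp
  finally have "ennreal (c * d * norm x powr (s + e) * u x powr (m - 1))
    \<le> ennreal (c * norm x powr s) * ennreal (u x powr q)"
    using \<open>c \<ge> 0\<close> by (simp add: ennreal_mult[symmetric] ennreal_leI)
  also have "\<dots> \<le> potential x * ennreal (u x powr q)"
    using assms(1) by (rule mult_right_mono) simp
  finally show ?thesis .
qed

lemma q_gt: "q > m - 1"
proof (rule ccontr)
  assume not_gt: "\<not> q > m - 1"
  obtain c where potential_ge: "c > 0" "\<And>x. norm x \<ge> 1 \<Longrightarrow> ennreal (c * norm x powr (\<alpha> - real DIM('a)))
    \<le> potential x"
    using riesz_conv_lower_bound[OF \<alpha>_bounds continuous_on_powr_u] u_pos by (metis powr_gt_zero less_irrefl)
  obtain x where x_bounds: "x \<in> ext_dom" "norm x \<ge> 1" "u x < 1"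
    "\<not> ennreal (c * norm x powr (m + \<alpha> - real DIM('a) - m) * u x powr (m - 1))
      \<le> potential x * ennreal (u x powr q)"
    using nonlocal_term_growth_bounded[of c "m + \<alpha> - real DIM('a)" 1] potential_ge(1) dim_le \<alpha>_bounds by auto
  have "1 * norm x powr 0 \<le> u x powr (q - (m - 1))"
    using x_bounds(1,3) u_pos[OF x_bounds(1)] not_gt powr_mono2'[of "q - (m - 1)" "u x" 1] by simp
  with x_bounds(4) potential_ge nonlocal_term_ge[of c x "\<alpha> - real DIM('a)" 1 0] x_bounds(2) show False by simp
qed

lemma powr_u_ge:
  assumes "c > 0" "c * norm x powr (- b) \<le> u x"
  shows "c powr (q - (m - 1)) * norm x powr (- (b * (q - (m - 1)))) \<le> u x powr (q - (m - 1))"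
proof -
  have "(c * norm x powr (- b)) powr (q - (m - 1)) \<le> u x powr (q - (m - 1))"
    using assms q_gt by (intro powr_mono2) auto
  then show ?thesis using assms(1) by (simp add: powr_power_mult)
qed

lemma nonlocal_decay_bound:
  assumes potential: "c > 0" "R \<ge> 1" "\<And>x. norm x \<ge> R \<Longrightarrow> ennreal (c * norm x powr s) \<le> potential x"
    and supersolution_b: "b > 0" "hardy_supersolution m (Kfun m DIM('a) b) R' u Du" "R' \<ge> 1"
  shows "m + s \<le> b * (q - (m - 1))"
proof (rule ccontr)
  assume not_le: "\<not> m + s \<le> b * (q - (m - 1))"
  obtain c' where u_ge: "c' > 0" "\<And>x. norm x \<ge> R' + 1 \<Longrightarrow> c' * norm x powr (- b) \<le> u x"
    using hardy_supersolution_lower_bound[OF supersolution_b(1,3,2)] by blast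
  define d where "d = c' powr (q - (m - 1))"
  have "c * d > 0" "m + s - b * (q - (m - 1)) > 0" "max R (R' + 1) \<ge> 1"
    using potential(1,2) u_ge(1) not_le by (auto simp: d_def)
  then obtain x where x_bounds: "x \<in> ext_dom" "norm x \<ge> max R (R' + 1)"
    "\<not> ennreal (c * d * norm x powr (m + s - b * (q - (m - 1)) - m) * u x powr (m - 1))
      \<le> potential x * ennreal (u x powr q)"
    using nonlocal_term_growth_bounded by blast
  have "ennreal (c * d * norm x powr (s + - (b * (q - (m - 1)))) * u x powr (m - 1))
    \<le> potential x * ennreal (u x powr q)"
    unfolding d_def using x_bounds(2) potential(1) u_ge by (intro nonlocal_term_ge potential(3) powr_u_ge) auto
  with x_bounds(3) show False by simp
qed

lemma hardy_supersolution_smaller_root: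
  assumes potential: "c > 0" "R \<ge> 1" "\<And>x. norm x \<ge> R \<Longrightarrow> ennreal (c * norm x powr s) \<le> potential x"
    and root_b: "b > 0" "Kfun m DIM('a) b = - \<mu>" and "m + s \<ge> b * (q - (m - 1))"
  obtains b' R' where "0 < b'" "b' < b" "R' \<ge> 1" "hardy_supersolution m (Kfun m DIM('a) b') R' u Du"
proof -
  define e where "e = b * (q - (m - 1))"
  obtain c' where u_ge: "c' > 0" "\<And>x. norm x \<ge> 2 \<Longrightarrow> c' * norm x powr (- b) \<le> u x"
    using hardy_supersolution_lower_bound[OF root_b(1) order_refl hardy_supersolution[folded root_b(2)]] by auto
  define \<kappa> where "\<kappa> = c * c' powr (q - (m - 1))"
  have "\<kappa> > 0" using potential(1) u_ge(1) by (simp add: \<kappa>_def)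
  have supersolution: "hardy_supersolution m (- \<mu> - \<kappa>) (max 2 R) u Du"
  proof (rule hardy_supersolution_improved)
    fix x assume x_bounds: "x \<in> ext_dom" "max 2 R < norm x" "u x < 1"
    have "\<kappa> * hardy_weight m u x \<le> \<kappa> * (norm x powr (s + - e) * u x powr (m - 1))"
      using x_bounds(2) assms(6) \<open>\<kappa> > 0\<close> unfolding hardy_weight_def
      by (intro mult_left_mono mult_right_mono powr_mono) (auto simp: e_def)
    then have "ennreal (\<kappa> * hardy_weight m u x)
        \<le> ennreal (c * c' powr (q - (m - 1)) * norm x powr (s + - e) * u x powr (m - 1))"
      unfolding \<kappa>_def mult.assoc by (rule ennreal_leI)
    also have "\<dots> \<le> potential x * ennreal (u x powr q)"
      unfolding e_def using x_bounds(2) potential(1) u_ge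
      by (intro nonlocal_term_ge potential(3) powr_u_ge) auto
    finally show "ennreal (\<kappa> * hardy_weight m u x) \<le> potential x * ennreal (u x powr q)" .
  qed (use \<open>\<kappa> > 0\<close> in simp)
  have "continuous (at b within {0..}) (Kfun m DIM('a))"
    using continuous_on_Kfun[OF m_gt_1, of "DIM('a)"] root_b(1)
    by (simp add: continuous_on_eq_continuous_within)
  then obtain d where continuity_d: "d > 0" "\<And>t. t \<ge> 0 \<Longrightarrow> dist t b < d
    \<Longrightarrow> dist (Kfun m DIM('a) t) (Kfun m DIM('a) b) < \<kappa>"
    using \<open>\<kappa> > 0\<close> by (force simp: continuous_within_eps_delta)
  define b' where "b' = max (b / 2) (b - d / 2)"
  have root_b': "0 < b'" "b' < b" "dist b' b < d"
    using root_b(1) continuity_d(1) by (auto simp: b'_def dist_real_def max_def)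
  then have "- \<mu> - \<kappa> \<le> Kfun m DIM('a) b'"
    using continuity_d(2)[of b'] root_b(2) by (simp add: dist_real_def)
  with supersolution have "hardy_supersolution m (Kfun m DIM('a) b') (max 2 R) u Du"
    by (rule hardy_supersolution_mono) simp
  with root_b' show thesis using that[of b' "max 2 R"] by (simp add: le_max_iff_disj)
qed

lemma nonlocal_decay_strict_bound:
  assumes potential: "c > 0" "R \<ge> 1" "\<And>x. norm x \<ge> R \<Longrightarrow> ennreal (c * norm x powr s) \<le> potential x"
    and "b > 0" "Kfun m DIM('a) b = - \<mu>"
  shows "m + s < b * (q - (m - 1))"
proof (rule ccontr)
  assume not_less: "\<not> m + s < b * (q - (m - 1))"
  then obtain b' R' where root_b': "0 < b'" "b' < b" "R' \<ge> 1"
    "hardy_supersolution m (Kfun m DIM('a) b') R' u Du"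
    using hardy_supersolution_smaller_root[OF assms] by auto
  then have "m + s \<le> b' * (q - (m - 1))"
    by (intro nonlocal_decay_bound[OF potential]) auto
  moreover have "b' * (q - (m - 1)) < b * (q - (m - 1))"
    using root_b'(2) q_gt by simp
  ultimately show False using not_less by simp
qed

lemma necessary_conditions:
  assumes root_b: "b > 0" "Kfun m DIM('a) b = - \<mu>"
  shows "m + \<alpha> < b * (p + q - (m - 1))" "m + \<alpha> - real DIM('a) < b * (q - (m - 1))"
proof -
  obtain c where "c > 0" "\<And>x. norm x \<ge> 2 \<Longrightarrow> c * norm x powr (- b) \<le> u x"
    using hardy_supersolution_lower_bound[OF root_b(1) order_refl hardy_supersolution[folded root_b(2)]] by auto
  then have "c powr p * norm y powr (- (b * p)) \<le> u y powr p" if "norm y \<ge> 2" for y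
    using that p_pos powr_mono2[of p "c * norm y powr (- b)" "u y"] by (simp add: powr_power_mult)
  then obtain c\<^sub>1 where "c\<^sub>1 > 0" "\<And>x. norm x \<ge> 2 \<Longrightarrow> ennreal (c\<^sub>1 * norm x powr (\<alpha> - b * p)) \<le> potential x"
    using riesz_conv_power_lower_bound[OF \<alpha>_bounds, of "c powr p" "b * p" 2 "\<lambda>y. u y powr p"] \<open>c > 0\<close>
      root_b(1) p_pos by auto
  then show "m + \<alpha> < b * (p + q - (m - 1))"
    using nonlocal_decay_strict_bound[of c\<^sub>1 2, OF _ _ _ root_b] by (force simp: algebra_simps)
  obtain c\<^sub>2 where "c\<^sub>2 > 0" "\<And>x. norm x \<ge> 1 \<Longrightarrow> ennreal (c\<^sub>2 * norm x powr (\<alpha> - real DIM('a))) \<le> potential x"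
    using riesz_conv_lower_bound[OF \<alpha>_bounds continuous_on_powr_u] u_pos by (metis powr_gt_zero less_irrefl)
  then show "m + \<alpha> - real DIM('a) < b * (q - (m - 1))"
    using nonlocal_decay_strict_bound[of c\<^sub>2 1, OF _ _ _ root_b] by force
qed

end

lemma pos_solution_imp_exterior_solution:
  fixes u :: "'a::euclidean_space \<Rightarrow> real"
  assumes "m > 1" "real DIM('a) \<le> m" "p > 0" "0 < \<alpha>" "\<alpha> < real DIM('a)" "pos_solution m \<mu> p q \<alpha> u"
  obtains Du where "exterior_solution m u Du \<mu> p q \<alpha>"
proof -
  from assms(6) obtain Du where "exterior_solution m u Du \<mu> p q \<alpha>"
    using assms(1-5) unfolding pos_solution_def exterior_solution_def exterior_sobolev_function_def
      exterior_solution_axioms_def m_flux_def inner_scaleR_left by blast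
  then show thesis by (rule that)
qed

section \<open>Sufficiency\<close>

lemma riesz_integrand_le:
  fixes x y :: "'a::euclidean_space"
  defines "n \<equiv> real DIM('a)" and "r \<equiv> norm x"
  assumes "\<alpha> < n" "\<sigma> > 0" "x \<noteq> 0"
  shows "ennreal (norm (x - y) powr (\<alpha> - n) * norm y powr (- \<sigma>))
    \<le> ennreal ((r / 2) powr (\<alpha> - n)) * (ennreal (norm y powr (- \<sigma>)) * indicator (cball 0 (r / 2)) y)
      + (ennreal ((r / 2) powr (- \<sigma>)) * (ennreal (norm (y - x) powr (- (n - \<alpha>)))
        * indicator (cball 0 (3 * r)) (y - x))
      + ennreal (2 powr (n - \<alpha>)) * (ennreal (norm y powr (- (n - \<alpha> + \<sigma>))) * indicator (- ball 0 (2 * r)) y))"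
    (is "?lhs \<le> ?near_0 + (?near_x + ?far)")
proof -
  have r_pos: "r > 0" using \<open>x \<noteq> 0\<close> by (simp add: r_def)
  have lhs_eq: "?lhs = ennreal (norm (x - y) powr (\<alpha> - n)) * ennreal (norm y powr (- \<sigma>))"
    by (simp add: ennreal_mult)
  consider "norm y \<le> r / 2" | "r / 2 \<le> norm y" "norm y \<le> 2 * r" | "norm y \<ge> 2 * r" by linarith
  then show ?thesis
  proof cases
    case 1
    then have "norm (x - y) \<ge> r / 2" using norm_triangle_ineq2[of x y] by (simp add: r_def)
    then have "norm (x - y) powr (\<alpha> - n) \<le> (r / 2) powr (\<alpha> - n)"
      using r_pos \<open>\<alpha> < n\<close> by (intro powr_mono2') auto
    with 1 have "?lhs \<le> ?near_0" by (simp add: lhs_eq mult_right_mono ennreal_leI)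
    then show ?thesis by (rule add_increasing2[OF zero_le])
  next
    case 2
    then have "norm (y - x) \<le> 3 * r" using norm_triangle_ineq4[of y x] by (simp add: r_def)
    moreover have "norm y powr (- \<sigma>) \<le> (r / 2) powr (- \<sigma>)"
      using 2 r_pos \<open>\<sigma> > 0\<close> by (intro powr_mono2') auto
    ultimately have "?lhs \<le> ?near_x"
      unfolding lhs_eq by (subst mult.commute) (simp add: mult_right_mono ennreal_leI norm_minus_commute)
    then show ?thesis by (intro add_increasing[OF zero_le] add_increasing2[OF zero_le])
  next
    case 3
    then have "norm (x - y) \<ge> norm y / 2"
      using norm_triangle_ineq2[of y x] by (simp add: r_def norm_minus_commute)
    moreover have "norm y > 0" using 3 r_pos by linarith
    ultimately have "norm (x - y) powr (\<alpha> - n) \<le> (norm y / 2) powr (\<alpha> - n)"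
      using \<open>\<alpha> < n\<close> by (intro powr_mono2') auto
    also have "\<dots> = 2 powr (n - \<alpha>) * norm y powr (\<alpha> - n)"
      by (simp add: powr_divide powr_diff field_simps)
    finally have "norm (x - y) powr (\<alpha> - n) * norm y powr (- \<sigma>)
      \<le> 2 powr (n - \<alpha>) * norm y powr (\<alpha> - n) * norm y powr (- \<sigma>)"
      by (rule mult_right_mono) simp
    also have "\<dots> = 2 powr (n - \<alpha>) * norm y powr (- (n - \<alpha> + \<sigma>))"
      unfolding mult.assoc powr_add[symmetric] by simp
    finally have "?lhs \<le> ?far" using 3 by (simp add: ennreal_mult[symmetric] ennreal_leI)
    then show ?thesis by (intro add_increasing[OF zero_le])
  qed
qed

lemma nn_integral_norm_powr_cball_translate:
  fixes x :: "'a::euclidean_space"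
  assumes "a < real DIM('a)" "R \<ge> 0"
  shows "(\<integral>\<^sup>+y. ennreal (norm (y - x) powr (- a)) * indicator (cball 0 R) (y - x) \<partial>lborel)
    = ennreal (unit_sphere_area DIM('a) / (real DIM('a) - a) * R powr (real DIM('a) - a))"
proof -
  have [measurable]: "cball (0::'a) R \<in> sets borel" by simp
  have "(\<lambda>y::'a. ennreal (norm y powr (- a)) * indicator (cball 0 R) y) \<in> borel_measurable borel" by measurable
  from lborel_nn_integral_translate[OF this, of "- x"] show ?thesis
    using nn_integral_norm_powr_cball[OF assms] by simp
qed

lemma riesz_integral_le_three_regions:
  fixes x :: "'a::euclidean_space"
  defines "n \<equiv> real DIM('a)" and "\<omega> \<equiv> unit_sphere_area DIM('a)" and "r \<equiv> norm x"
  assumes \<alpha>_bounds: "0 < \<alpha>" "\<alpha> < \<sigma>" "\<sigma> < n" and "x \<noteq> 0"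
  shows "(\<integral>\<^sup>+y. ennreal (norm (x - y) powr (\<alpha> - n) * norm y powr (- \<sigma>)) \<partial>lborel)
    \<le> ennreal ((r / 2) powr (\<alpha> - n)) * ennreal (\<omega> / (n - \<sigma>) * (r / 2) powr (n - \<sigma>))
      + (ennreal ((r / 2) powr (- \<sigma>)) * ennreal (\<omega> / \<alpha> * (3 * r) powr \<alpha>)
      + ennreal (2 powr (n - \<alpha>)) * ennreal (\<omega> / (\<sigma> - \<alpha>) * (2 * r) powr (\<alpha> - \<sigma>)))"
proof -
  have r_pos: "r > 0" using \<open>x \<noteq> 0\<close> by (simp add: r_def)
  define P where "P R = (\<lambda>y::'a. ennreal (norm y powr (- (n - \<alpha>))) * indicator (cball 0 R) y)" for R
  have [measurable]: "cball (0::'a) R \<in> sets borel" "- ball (0::'a) R \<in> sets borel" for R by auto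
  have [measurable]: "P R \<in> borel_measurable borel" for R unfolding P_def by measurable
  have near_x: "(\<integral>\<^sup>+y. P (3 * r) (y - x) \<partial>lborel) = ennreal (\<omega> / \<alpha> * (3 * r) powr \<alpha>)"
    using nn_integral_norm_powr_cball_translate[of "n - \<alpha>" "3 * r" x] \<alpha>_bounds r_pos
    by (simp add: P_def \<omega>_def n_def)
  have "(\<integral>\<^sup>+y. ennreal (norm (x - y) powr (\<alpha> - n) * norm y powr (- \<sigma>)) \<partial>lborel)
     \<le> (\<integral>\<^sup>+y. ennreal ((r / 2) powr (\<alpha> - n)) * (ennreal (norm y powr (- \<sigma>)) * indicator (cball 0 (r / 2)) y)
        + (ennreal ((r / 2) powr (- \<sigma>)) * P (3 * r) (y - x)
        + ennreal (2 powr (n - \<alpha>)) * (ennreal (norm y powr (- (n - \<alpha> + \<sigma>)))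
          * indicator (- ball 0 (2 * r)) y)) \<partial>lborel)"
    unfolding P_def r_def n_def using \<alpha>_bounds \<open>x \<noteq> 0\<close> n_def by (intro nn_integral_mono riesz_integrand_le) auto
  also have "\<dots> = ennreal ((r / 2) powr (\<alpha> - n)) * ennreal (\<omega> / (n - \<sigma>) * (r / 2) powr (n - \<sigma>))
      + (ennreal ((r / 2) powr (- \<sigma>)) * ennreal (\<omega> / \<alpha> * (3 * r) powr \<alpha>)
      + ennreal (2 powr (n - \<alpha>)) * ennreal (\<omega> / (\<sigma> - \<alpha>) * (2 * r) powr (\<alpha> - \<sigma>)))"
    using nn_integral_norm_powr_cball[of \<sigma> "r / 2", where 'a='a]
      nn_integral_norm_powr_outside_ball[of "n - \<alpha> + \<sigma>" "2 * r", where 'a='a] \<alpha>_bounds r_pos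
    by (simp add: nn_integral_add nn_integral_cmult near_x \<omega>_def n_def)
  finally show ?thesis .
qed

lemma riesz_integral_power_upper_bound:
  assumes \<alpha>_bounds: "0 < \<alpha>" "\<alpha> < \<sigma>" "\<sigma> < real DIM('a::euclidean_space)"
  obtains C where "C > 0"
    "\<And>x::'a. x \<noteq> 0 \<Longrightarrow> (\<integral>\<^sup>+y. ennreal (norm (x - y) powr (\<alpha> - real DIM('a)) * norm y powr (- \<sigma>)) \<partial>lborel)
      \<le> ennreal (C * norm x powr (\<alpha> - \<sigma>))"
proof -
  define n where "n = real DIM('a)"
  define \<omega> where "\<omega> = unit_sphere_area DIM('a)"
  have "\<omega> > 0" by (simp add: \<omega>_def)
  define C where "C = \<omega> / (n - \<sigma>) * (1 / 2) powr (\<alpha> - \<sigma>)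
    + (\<omega> / \<alpha> * 2 powr \<sigma> * 3 powr \<alpha> + \<omega> / (\<sigma> - \<alpha>) * 2 powr (n - \<sigma>))"
  have "(\<integral>\<^sup>+y. ennreal (norm (x - y) powr (\<alpha> - n) * norm y powr (- \<sigma>)) \<partial>lborel)
    \<le> ennreal (C * norm x powr (\<alpha> - \<sigma>))"
    if "x \<noteq> 0" for x :: 'a
  proof -
    define r where "r = norm x"
    have "(\<integral>\<^sup>+y. ennreal (norm (x - y) powr (\<alpha> - n) * norm y powr (- \<sigma>)) \<partial>lborel)
        \<le> ennreal ((r / 2) powr (\<alpha> - n)) * ennreal (\<omega> / (n - \<sigma>) * (r / 2) powr (n - \<sigma>))
          + (ennreal ((r / 2) powr (- \<sigma>)) * ennreal (\<omega> / \<alpha> * (3 * r) powr \<alpha>)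
          + ennreal (2 powr (n - \<alpha>)) * ennreal (\<omega> / (\<sigma> - \<alpha>) * (2 * r) powr (\<alpha> - \<sigma>)))"
      unfolding n_def \<omega>_def r_def by (rule riesz_integral_le_three_regions[OF \<alpha>_bounds that])
    also have "\<dots> = ennreal (\<omega> / (n - \<sigma>) * ((r / 2) powr (\<alpha> - n) * (r / 2) powr (n - \<sigma>))
        + (\<omega> / \<alpha> * ((r / 2) powr (- \<sigma>) * (3 * r) powr \<alpha>) + \<omega> / (\<sigma> - \<alpha>)
          * (2 powr (n - \<alpha>) * (2 * r) powr (\<alpha> - \<sigma>))))"
      using \<alpha>_bounds \<open>\<omega> > 0\<close> by (simp add: ennreal_mult[symmetric] ennreal_plus[symmetric] n_def mult_ac
        del: ennreal_plus)
    also have "(r / 2) powr (\<alpha> - n) * (r / 2) powr (n - \<sigma>) = (1 / 2) powr (\<alpha> - \<sigma>) * r powr (\<alpha> - \<sigma>)"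
      unfolding powr_add[symmetric] powr_mult[symmetric] by simp
    also have "(r / 2) powr (- \<sigma>) * (3 * r) powr \<alpha> = 2 powr \<sigma> * 3 powr \<alpha> * r powr (\<alpha> - \<sigma>)"
      by (simp add: powr_mult powr_divide powr_diff powr_minus field_simps)
    also have "2 powr (n - \<alpha>) * (2 * r) powr (\<alpha> - \<sigma>) = 2 powr (n - \<sigma>) * r powr (\<alpha> - \<sigma>)"
      by (simp add: powr_mult powr_diff)
    finally show ?thesis by (simp add: C_def r_def algebra_simps)
  qed
  moreover have "C > 0" using \<alpha>_bounds \<open>\<omega> > 0\<close> by (simp add: C_def n_def add_pos_pos)
  ultimately show thesis using that by (simp add: n_def)
qed

lemma riesz_conv_power_upper_bound:
  assumes \<alpha>_bounds: "0 < \<alpha>" "\<alpha> < \<sigma>" "\<sigma> < real DIM('a::euclidean_space)"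
  obtains C where "C > 0"
    "\<And>g k x::'a. \<lbrakk>k \<ge> 0; \<forall>y\<in>ext_dom. g y \<le> k * norm y powr (- \<sigma>); x \<noteq> 0\<rbrakk>
      \<Longrightarrow> riesz_conv \<alpha> g x \<le> ennreal (k * C * norm x powr (\<alpha> - \<sigma>))"
proof -
  define A where "A = riesz_const DIM('a) \<alpha>"
  have "A > 0" unfolding A_def using \<alpha>_bounds by (intro riesz_const_pos) auto
  obtain C where integral_bound: "C > 0"
    "\<And>x::'a. x \<noteq> 0 \<Longrightarrow> (\<integral>\<^sup>+y. ennreal (norm (x - y) powr (\<alpha> - real DIM('a)) * norm y powr (- \<sigma>)) \<partial>lborel)
      \<le> ennreal (C * norm x powr (\<alpha> - \<sigma>))"
    by (rule riesz_integral_power_upper_bound[OF \<alpha>_bounds]) (rule that)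
  have "riesz_conv \<alpha> g x \<le> ennreal (k * (A * C) * norm x powr (\<alpha> - \<sigma>))"
    if "k \<ge> 0" and g_le: "\<forall>y\<in>ext_dom. g y \<le> k * norm y powr (- \<sigma>)" and "x \<noteq> 0" for g k and x :: 'a
  proof -
    have "riesz_conv \<alpha> g x
        \<le> (\<integral>\<^sup>+y. ennreal (k * A) * ennreal (norm (x - y) powr (\<alpha> - real DIM('a)) * norm y powr (- \<sigma>)) \<partial>lborel)"
      unfolding riesz_conv_lborel
    proof (rule nn_integral_mono)
      fix y :: 'a
      have "riesz_kernel \<alpha> (x - y) * g y \<le> k * A * (norm (x - y) powr (\<alpha> - real DIM('a)) * norm y powr (- \<sigma>))"
        if "y \<in> ext_dom"
        using mult_left_mono[OF bspec[OF g_le that], of "riesz_kernel \<alpha> (x - y)"] \<open>A > 0\<close>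
        by (simp add: riesz_kernel_def A_def mult_ac)
      then show "indicator ext_dom y * ennreal (riesz_kernel \<alpha> (x - y) * g y)
          \<le> ennreal (k * A) * ennreal (norm (x - y) powr (\<alpha> - real DIM('a)) * norm y powr (- \<sigma>))"
        using \<open>k \<ge> 0\<close> \<open>A > 0\<close> by (cases "y \<in> ext_dom") (simp_all add: ennreal_mult[symmetric] ennreal_leI)
    qed
    also have "\<dots> = ennreal (k * A) * (\<integral>\<^sup>+y. ennreal (norm (x - y) powr (\<alpha> - real DIM('a))
      * norm y powr (- \<sigma>)) \<partial>lborel)"
      by (rule nn_integral_cmult) measurable
    also have "\<dots> \<le> ennreal (k * A) * ennreal (C * norm x powr (\<alpha> - \<sigma>))"
      using integral_bound(2)[OF \<open>x \<noteq> 0\<close>] by (rule mult_left_mono) simp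
    also have "\<dots> = ennreal (k * (A * C) * norm x powr (\<alpha> - \<sigma>))"
      using \<open>k \<ge> 0\<close> \<open>A > 0\<close> \<open>C > 0\<close> by (simp add: ennreal_mult[symmetric] mult_ac)
    finally show ?thesis .
  qed
  moreover have "A * C > 0" using \<open>A > 0\<close> \<open>C > 0\<close> by simp
  ultimately show thesis using that by metis
qed

lemma nn_integral_le_set_lebesgue_integral:
  assumes integrable_h: "set_integrable M A h" and nonneg: "\<And>x. x \<in> A \<Longrightarrow> h x \<ge> 0"
    and pointwise_le: "\<And>x. x \<in> A \<Longrightarrow> f x \<le> ennreal (h x)"
  shows "(\<integral>\<^sup>+x. indicator A x * f x \<partial>M) \<le> ennreal (LINT x:A|M. h x)"
proof -
  have "(\<integral>\<^sup>+x. indicator A x * f x \<partial>M) \<le> (\<integral>\<^sup>+x. ennreal (indicator A x *\<^sub>R h x) \<partial>M)"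
    using pointwise_le by (intro nn_integral_mono) (auto simp: indicator_def)
  also have "\<dots> = ennreal (LINT x:A|M. h x)"
    using integrable_h nonneg unfolding set_integrable_def set_lebesgue_integral_def
    by (intro nn_integral_eq_integral) (auto simp: indicator_def)
  finally show ?thesis .
qed

lemma power_integrable_at_infinity:
  assumes "c > 0" "\<alpha> < p * \<gamma>" and \<alpha>_less: "\<alpha> < real DIM('a::euclidean_space)"
  shows "(\<integral>\<^sup>+ y. indicator ext_dom y * ennreal ((c * norm y powr (- \<gamma>)) powr p
      / (1 + norm y powr (real DIM('a) - \<alpha>)))
    \<partial>(lebesgue :: 'a measure)) < \<infinity>"
proof -
  define n where "n = real DIM('a)"
  define e where "e = p * \<gamma> + (n - \<alpha>)"
  have "(\<integral>\<^sup>+ y. indicator ext_dom y * ennreal ((c * norm y powr (- \<gamma>)) powr p / (1 + norm y powr (n - \<alpha>)))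
    \<partial>(lebesgue :: 'a measure))
      \<le> (\<integral>\<^sup>+ y. ennreal (c powr p) * (ennreal (norm y powr (- e)) * indicator (- ball 0 1) y)
        \<partial>(lborel :: 'a measure))"
    unfolding nn_integral_completion
  proof (rule nn_integral_mono)
    fix y :: 'a
    have "(c * norm y powr (- \<gamma>)) powr p / (1 + norm y powr (n - \<alpha>)) \<le> c powr p * norm y powr (- e)"
      if "y \<in> ext_dom"
    proof -
      have "(c * norm y powr (- \<gamma>)) powr p / (1 + norm y powr (n - \<alpha>))
        \<le> c powr p * norm y powr (- (\<gamma> * p)) / norm y powr (n - \<alpha>)"
        unfolding powr_power_mult[OF \<open>c > 0\<close> norm_ge_zero] using that
        by (intro frac_le) (auto simp: ext_dom_iff)
      also have "\<dots> = c powr p * norm y powr (- e)"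
        unfolding times_divide_eq_right[symmetric] powr_diff[symmetric] by (simp add: e_def algebra_simps)
      finally show ?thesis .
    qed
    then show "indicator ext_dom y * ennreal ((c * norm y powr (- \<gamma>)) powr p / (1 + norm y powr (n - \<alpha>)))
        \<le> ennreal (c powr p) * (ennreal (norm y powr (- e)) * indicator (- ball 0 1) y)"
      by (cases "y \<in> ext_dom") (auto simp: ext_dom_iff ennreal_mult[symmetric] ennreal_leI)
  qed
  also have "\<dots> = ennreal (c powr p) * (\<integral>\<^sup>+ y. ennreal (norm y powr (- e)) * indicator (- ball 0 1) y
    \<partial>(lborel :: 'a measure))"
    by (rule nn_integral_cmult) simp
  also have "\<dots> < \<infinity>"
    using assms nn_integral_norm_powr_outside_ball[of e 1, where 'a='a]
    by (simp add: e_def n_def ennreal_mult_less_top)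
  finally show ?thesis by (simp add: n_def)
qed

lemma power_nonlocal_term_le:
  assumes "c > 0" "C \<ge> 0" "V \<le> ennreal (c powr p * C * r powr (\<alpha> - \<sigma>))" "r > 1"
    and "\<gamma> * (m - 1) + m \<le> q * \<gamma> + \<sigma> - \<alpha>"
  shows "V * ennreal ((c * r powr (- \<gamma>)) powr q) \<le> ennreal (c powr (p + q) * C * r powr (- (\<gamma> * (m - 1) + m)))"
proof -
  have "V * ennreal ((c * r powr (- \<gamma>)) powr q)
      \<le> ennreal (c powr p * C * r powr (\<alpha> - \<sigma>)) * ennreal ((c * r powr (- \<gamma>)) powr q)"
    using assms(3) by (rule mult_right_mono) simp
  also have "\<dots> = ennreal (c powr p * C * r powr (\<alpha> - \<sigma>) * (c powr q * r powr (- (\<gamma> * q))))"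
    using assms by (simp add: powr_power_mult ennreal_mult[symmetric])
  also have "c powr p * C * r powr (\<alpha> - \<sigma>) * (c powr q * r powr (- (\<gamma> * q)))
      = c powr (p + q) * C * r powr (\<alpha> - \<sigma> + - (\<gamma> * q))"
    by (simp only: powr_add mult_ac)
  also have "ennreal \<dots> \<le> ennreal (c powr (p + q) * C * r powr (- (\<gamma> * (m - 1) + m)))"
    using assms by (intro ennreal_leI mult_left_mono powr_mono) (auto simp: algebra_simps)
  finally show ?thesis .
qed

lemma nonlocal_integral_le_norm_powr:
  fixes V :: "'a::euclidean_space \<Rightarrow> ennreal"
  assumes test: "test_fun ext_dom \<phi>" "\<And>x. \<phi> x \<ge> 0" and "\<kappa> \<ge> 0"
    and nonlocal_le: "\<And>x. x \<in> ext_dom \<Longrightarrow> V x * ennreal (w x) \<le> ennreal (\<kappa> * norm x powr e)"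
  shows "(\<integral>\<^sup>+ x. indicator ext_dom x * V x * ennreal (w x * \<phi> x) \<partial>lebesgue)
    \<le> ennreal (\<kappa> * (LINT x:ext_dom|lebesgue. norm x powr e * \<phi> x))"
proof -
  have "(\<integral>\<^sup>+ x. indicator ext_dom x * (V x * ennreal (w x * \<phi> x)) \<partial>lebesgue)
      \<le> ennreal (LINT x:ext_dom|lebesgue. \<kappa> * (norm x powr e * \<phi> x))"
  proof (rule nn_integral_le_set_lebesgue_integral)
    show "set_integrable lebesgue ext_dom (\<lambda>x. \<kappa> * (norm x powr e * \<phi> x))"
      by (intro set_integrable_mult_right set_integrable_mult_test_fun[OF test(1)]
          continuous_on_norm_powr[OF zero_notin_ext_dom])
    fix x :: 'a assume "x \<in> ext_dom"
    show "0 \<le> \<kappa> * (norm x powr e * \<phi> x)" using \<open>\<kappa> \<ge> 0\<close> test(2) by simp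
    have "V x * ennreal (w x) * ennreal (\<phi> x) \<le> ennreal (\<kappa> * norm x powr e) * ennreal (\<phi> x)"
      using nonlocal_le[OF \<open>x \<in> ext_dom\<close>] by (rule mult_right_mono) simp
    then show "V x * ennreal (w x * \<phi> x) \<le> ennreal (\<kappa> * (norm x powr e * \<phi> x))"
      using test(2) by (simp add: ennreal_mult''[symmetric] mult.assoc)
  qed
  then show ?thesis by (simp add: mult.assoc)
qed

lemma nonlocal_integral_compact_finite:
  fixes V :: "'a::euclidean_space \<Rightarrow> ennreal"
  assumes "compact K" "K \<subseteq> ext_dom" "\<kappa> \<ge> 0"
    and "\<And>x. x \<in> ext_dom \<Longrightarrow> V x * ennreal (w x) \<le> ennreal (\<kappa> * norm x powr e)"
  shows "(\<integral>\<^sup>+ x. indicator K x * V x * ennreal (w x) \<partial>lebesgue) < \<infinity>"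
proof -
  have "continuous_on K (\<lambda>x. \<kappa> * norm x powr e)"
    using assms(2) zero_notin_ext_dom by (intro continuous_intros continuous_on_norm_powr) auto
  with assms(1) have "set_integrable lebesgue K (\<lambda>x. \<kappa> * norm x powr e)"
    by (rule set_integrable_continuous_compact)
  then have "(\<integral>\<^sup>+ x. indicator K x * (V x * ennreal (w x)) \<partial>lebesgue)
    \<le> ennreal (LINT x:K|lebesgue. \<kappa> * norm x powr e)"
    using assms by (intro nn_integral_le_set_lebesgue_integral) auto
  then show ?thesis by (simp add: mult.assoc le_less_trans)
qed

lemma power_hardy_integral:
  fixes \<phi> :: "'a::euclidean_space \<Rightarrow> real"
  assumes m_gt_1: "m > 1" and test: "test_fun ext_dom \<phi>" and params_pos: "c > 0" "\<gamma> > 0"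
  shows "(LINT x:ext_dom|lebesgue. m_flux m (power_grad c \<gamma> x) \<bullet> grad \<phi> x
      - \<mu> / norm x powr m * (c * norm x powr (- \<gamma>)) powr (m - 1) * \<phi> x)
    = c powr (m - 1) * (- \<mu> - Kfun m DIM('a) \<gamma>)
      * (LINT x:ext_dom|lebesgue. norm x powr (- (\<gamma> * (m - 1) + m)) * \<phi> x)"
proof -
  define J where "J = (LINT x:ext_dom|lebesgue. norm x powr (- (\<gamma> * (m - 1) + m)) * \<phi> x)"
  have hardy: "\<mu> / norm x powr m * (c * norm x powr (- \<gamma>)) powr (m - 1) * \<phi> x
      = \<mu> * c powr (m - 1) * (norm x powr (- (\<gamma> * (m - 1) + m)) * \<phi> x)" for x :: 'a
    using hardy_weight_power[OF params_pos(1), of m \<gamma> x]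
    by (simp add: hardy_weight_def powr_minus[of _ m] divide_inverse mult_ac)
  have "set_integrable lebesgue ext_dom (\<lambda>x. norm x powr (- (\<gamma> * (m - 1) + m)) * \<phi> x)"
    by (rule set_integrable_mult_test_fun[OF test continuous_on_norm_powr[OF zero_notin_ext_dom]])
  moreover have "set_integrable lebesgue ext_dom (\<lambda>x. m_flux m (power_grad c \<gamma> x) \<bullet> grad \<phi> x)"
    by (rule set_integrable_m_flux[OF m_gt_1 W1loc_power[OF m_gt_1 open_ext_dom zero_notin_ext_dom] test])
  ultimately have "(LINT x:ext_dom|lebesgue. m_flux m (power_grad c \<gamma> x) \<bullet> grad \<phi> x
      - \<mu> * c powr (m - 1) * (norm x powr (- (\<gamma> * (m - 1) + m)) * \<phi> x))
    = - (c powr (m - 1) * Kfun m DIM('a) \<gamma> * J) - \<mu> * c powr (m - 1) * J"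
    using m_flux_power_grad_integral[OF open_ext_dom zero_notin_ext_dom test params_pos, of m]
    by (subst set_integral_diff(2)) (simp_all add: J_def)
  then show ?thesis unfolding hardy J_def[symmetric] by (simp add: algebra_simps)
qed

lemma power_pos_solution:
  assumes m_gt_1: "m > 1" and params_pos: "c > 0" "\<gamma> > 0" and "\<alpha> < p * \<gamma>" "\<alpha> < real DIM('a::euclidean_space)"
    and \<kappa>_bounds: "0 \<le> \<kappa>" "\<kappa> \<le> c powr (m - 1) * (- \<mu> - Kfun m DIM('a) \<gamma>)"
    and nonlocal: "\<And>x::'a. x \<in> ext_dom \<Longrightarrow>
      riesz_conv \<alpha> (\<lambda>y. (c * norm y powr (- \<gamma>)) powr p) x * ennreal ((c * norm x powr (- \<gamma>)) powr q)
      \<le> ennreal (\<kappa> * norm x powr (- (\<gamma> * (m - 1) + m)))"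
  shows "pos_solution m \<mu> p q \<alpha> (\<lambda>x::'a. c * norm x powr (- \<gamma>))"
  unfolding pos_solution_def
proof (intro conjI exI[of _ "power_grad c \<gamma>"] allI impI ballI)
  define V where "V = riesz_conv \<alpha> (\<lambda>y::'a. (c * norm y powr (- \<gamma>)) powr p)"
  define e where "e = - (\<gamma> * (m - 1) + m)"
  have nonlocal: "V x * ennreal ((c * norm x powr (- \<gamma>)) powr q) \<le> ennreal (\<kappa> * norm x powr e)"
    if "x \<in> ext_dom" for x
    unfolding V_def e_def using nonlocal[OF that] .
  show "continuous_on ext_dom (\<lambda>x::'a. c * norm x powr (- \<gamma>))"
    by (intro continuous_intros continuous_on_norm_powr zero_notin_ext_dom)
  show "0 < c * norm x powr (- \<gamma>)" if "x \<in> ext_dom" for x :: 'a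
    using params_pos(1) that zero_notin_ext_dom by (cases "x = 0") auto
  show "W1loc m ext_dom (\<lambda>x::'a. c * norm x powr (- \<gamma>)) (power_grad c \<gamma>)"
    by (rule W1loc_power[OF m_gt_1 open_ext_dom zero_notin_ext_dom])
  show "(\<integral>\<^sup>+ x. indicator K x * V x * ennreal ((c * norm x powr (- \<gamma>)) powr q) \<partial>lebesgue) < \<infinity>"
    if "compact K \<and> K \<subseteq> ext_dom" for K
    using that \<kappa>_bounds(1) nonlocal by (intro nonlocal_integral_compact_finite) auto
  show "(\<integral>\<^sup>+ y. indicator ext_dom y * ennreal ((c * norm y powr (- \<gamma>)) powr p
    / (1 + norm y powr (real DIM('a) - \<alpha>)))
      \<partial>(lebesgue :: 'a measure)) < \<infinity>"
    using assms by (intro power_integrable_at_infinity)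
  fix \<phi> :: "'a \<Rightarrow> real" assume test_\<phi>: "test_fun ext_dom \<phi> \<and> (\<forall>x. 0 \<le> \<phi> x)"
  define J where "J = (LINT x:ext_dom|lebesgue. norm x powr e * \<phi> x)"
  have "J \<ge> 0"
    unfolding J_def set_lebesgue_integral_def using test_\<phi> by (intro Bochner_Integration.integral_nonneg) auto
  have "(\<integral>\<^sup>+ x. indicator ext_dom x * V x * ennreal ((c * norm x powr (- \<gamma>)) powr q * \<phi> x) \<partial>lebesgue)
    \<le> ennreal (\<kappa> * J)"
    unfolding J_def using test_\<phi> \<kappa>_bounds(1) nonlocal by (intro nonlocal_integral_le_norm_powr) auto
  also have "\<dots> \<le> ennreal (c powr (m - 1) * (- \<mu> - Kfun m DIM('a) \<gamma>) * J)"
    using \<kappa>_bounds(2) \<open>J \<ge> 0\<close> by (intro ennreal_leI mult_right_mono)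
  finally show "enn2real (\<integral>\<^sup>+ x. indicator ext_dom x * V x * ennreal ((c * norm x powr (- \<gamma>)) powr q * \<phi> x)
    \<partial>lebesgue)
      \<le> (LINT x:ext_dom|lebesgue. norm (power_grad c \<gamma> x) powr (m - 2) * (power_grad c \<gamma> x \<bullet> grad \<phi> x)
          - \<mu> / norm x powr m * (c * norm x powr (- \<gamma>)) powr (m - 1) * \<phi> x)"
    using power_hardy_integral[OF m_gt_1 _ params_pos, of \<phi> \<mu>] test_\<phi> \<kappa>_bounds \<open>J \<ge> 0\<close>
    by (intro enn2real_leI) (auto simp: m_flux_def J_def e_def)
qed

lemma admissible_exponents:
  fixes n m p q b \<alpha> :: real
  assumes b_bounds: "b > 0" "p * b > \<alpha>" and \<alpha>_less: "\<alpha> < n"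
    and sum_condition: "m + \<alpha> < b * (p + q - (m - 1))" and q_condition: "m + \<alpha> - n < b * (q - (m - 1))"
  obtains \<gamma> \<sigma> where "0 < \<gamma>" "\<gamma> < b" "\<alpha> < \<sigma>" "\<sigma> < n" "\<sigma> \<le> p * \<gamma>" "\<gamma> * (m - 1) + m \<le> q * \<gamma> + \<sigma> - \<alpha>"
proof -
  have "eventually (\<lambda>\<gamma>. \<alpha> < p * \<gamma>) (at_left b)" "eventually (\<lambda>\<gamma>. m + \<alpha> < \<gamma> * (p + q - (m - 1))) (at_left b)"
    "eventually (\<lambda>\<gamma>. m + \<alpha> - n < \<gamma> * (q - (m - 1))) (at_left b)" "eventually (\<lambda>\<gamma>. 0 < \<gamma>) (at_left b)"
    by (rule order_tendstoD(1)[OF _ b_bounds(2)] order_tendstoD(1)[OF _ sum_condition]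
      order_tendstoD(1)[OF _ q_condition]
        order_tendstoD(1)[OF _ b_bounds(1)]; intro tendsto_intros)+
  moreover have "eventually (\<lambda>\<gamma>. \<gamma> < b) (at_left b)" by (simp add: eventually_at_filter)
  ultimately have "eventually (\<lambda>\<gamma>. \<alpha> < p * \<gamma> \<and> m + \<alpha> < \<gamma> * (p + q - (m - 1))
      \<and> m + \<alpha> - n < \<gamma> * (q - (m - 1)) \<and> 0 < \<gamma> \<and> \<gamma> < b) (at_left b)"
    by eventually_elim simp
  then obtain \<gamma> where \<gamma>_bounds: "\<alpha> < p * \<gamma>" "m + \<alpha> < \<gamma> * (p + q - (m - 1))" "m + \<alpha> - n < \<gamma> * (q - (m - 1))"
    "0 < \<gamma>" "\<gamma> < b"
    using eventually_happens[of _ "at_left b"] by (auto simp: trivial_limit_at_left_real)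
  obtain \<sigma>\<^sub>0 where \<sigma>\<^sub>0_bounds: "max \<alpha> (\<gamma> * (m - 1) + m + \<alpha> - q * \<gamma>) < \<sigma>\<^sub>0" "\<sigma>\<^sub>0 < n"
    using dense[of "max \<alpha> (\<gamma> * (m - 1) + m + \<alpha> - q * \<gamma>)" n] \<gamma>_bounds(3) \<alpha>_less by (auto simp: algebra_simps)
  show thesis
    using \<gamma>_bounds \<sigma>\<^sub>0_bounds by (intro that[of \<gamma> "min (p * \<gamma>) \<sigma>\<^sub>0"]) (auto simp: min_def algebra_simps)
qed

text \<open>With \<open>\<gamma> < b\<close> the power \<open>c |x| powr - \<gamma>\<close> is a strict supersolution of the local part, with gap
  \<open>D\<close> in the Hardy constant, and \<open>c\<close> is chosen so that the nonlocal term uses up exactly this gap.\<close>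

lemma pos_solution_exists:
  assumes m_gt_1: "m > 1" and dim_le: "real DIM('a::euclidean_space) \<le> m"
    and \<alpha>_bounds: "0 < \<alpha>" "\<alpha> < real DIM('a)"
    and root_b: "b > 0" "Kfun m DIM('a) b = - \<mu>" "p * b > \<alpha>"
    and sum_condition: "m + \<alpha> < b * (p + q - (m - 1))"
    and q_condition: "m + \<alpha> - real DIM('a) < b * (q - (m - 1))"
  shows "\<exists>u :: 'a \<Rightarrow> real. pos_solution m \<mu> p q \<alpha> u"
proof -
  obtain \<gamma> \<sigma> where \<gamma>_bounds: "0 < \<gamma>" "\<gamma> < b" and \<sigma>_bounds: "\<alpha> < \<sigma>" "\<sigma> < real DIM('a)" "\<sigma> \<le> p * \<gamma>"
    and decay: "\<gamma> * (m - 1) + m \<le> q * \<gamma> + \<sigma> - \<alpha>"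
    using admissible_exponents[OF root_b(1,3) \<alpha>_bounds(2) sum_condition q_condition] .
  obtain C where riesz_bound: "C > 0"
    "\<And>g k x::'a. \<lbrakk>k \<ge> 0; \<forall>y\<in>ext_dom. g y \<le> k * norm y powr (- \<sigma>); x \<noteq> 0\<rbrakk>
      \<Longrightarrow> riesz_conv \<alpha> g x \<le> ennreal (k * C * norm x powr (\<alpha> - \<sigma>))"
    by (rule riesz_conv_power_upper_bound[OF \<alpha>_bounds(1) \<sigma>_bounds(1,2)]) (rule that)
  define s where "s = p + q - (m - 1)"
  have "s > 0" using sum_condition root_b(1) m_gt_1 \<alpha>_bounds zero_less_mult_pos[of b s] by (simp add: s_def)
  define D where "D = - \<mu> - Kfun m DIM('a) \<gamma>"
  have "D > 0" using Kfun_strict_mono[OF m_gt_1 dim_le, of \<gamma> b] \<gamma>_bounds root_b(2) by (simp add: D_def)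
  define c where "c = (D / C) powr (1 / s)"
  have "c > 0" using \<open>C > 0\<close> \<open>D > 0\<close> by (simp add: c_def)
  have "c powr s = D / C" using \<open>C > 0\<close> \<open>D > 0\<close> \<open>s > 0\<close> by (simp add: c_def powr_powr)
  moreover have "c powr (p + q) = c powr s * c powr (m - 1)" unfolding powr_add[symmetric] by (simp add: s_def)
  ultimately have balance: "c powr (p + q) * C = c powr (m - 1) * D" using \<open>C > 0\<close> by simp
  have "(c * norm y powr (- \<gamma>)) powr p \<le> c powr p * norm y powr (- \<sigma>)" if "y \<in> ext_dom" for y :: 'a
    using that \<sigma>_bounds(3) by (auto simp: powr_power_mult[OF \<open>c > 0\<close>] ext_dom_iff mult.commute intro!:
      mult_left_mono powr_mono)
  then have "riesz_conv \<alpha> (\<lambda>y. (c * norm y powr (- \<gamma>)) powr p) x \<le> ennreal (c powr p * C * norm x powr (\<alpha> - \<sigma>))"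
    if "x \<in> ext_dom" for x :: 'a
    using that by (intro riesz_bound(2)) (auto simp: ext_dom_iff)
  then have "riesz_conv \<alpha> (\<lambda>y. (c * norm y powr (- \<gamma>)) powr p) x * ennreal ((c * norm x powr (- \<gamma>)) powr q)
      \<le> ennreal (c powr (p + q) * C * norm x powr (- (\<gamma> * (m - 1) + m)))" if "x \<in> ext_dom" for x :: 'a
    using that \<open>c > 0\<close> \<open>C > 0\<close> decay by (intro power_nonlocal_term_le) (auto simp: ext_dom_iff)
  then have "pos_solution m \<mu> p q \<alpha> (\<lambda>x::'a. c * norm x powr (- \<gamma>))"
    using m_gt_1 \<open>c > 0\<close> \<gamma>_bounds(1) \<sigma>_bounds \<open>C > 0\<close> \<alpha>_bounds(2) balance \<open>D > 0\<close>
    by (intro power_pos_solution[where \<kappa>="c powr (p + q) * C"]) (auto simp: D_def[symmetric])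
  then show ?thesis by blast
qed

section \<open>The characterization\<close>

lemma exponent_conditions_iff:
  fixes b :: real
  assumes "b > 0"
  shows "p > \<alpha> / b \<and> p + q > m - 1 + (m + \<alpha>) / b \<and> q > m - 1 - (n - m - \<alpha>) / b
    \<longleftrightarrow> p * b > \<alpha> \<and> m + \<alpha> < b * (p + q - (m - 1)) \<and> m + \<alpha> - n < b * (q - (m - 1))"
  using assms by (simp add: field_simps)

theorem theorem1p2:
  fixes m \<mu> p q \<alpha> :: real
  assumes "m > 1" and "real DIM('a::euclidean_space) \<le> m" and "p > 0"
    and "0 < \<alpha>" and "\<alpha> < real DIM('a)"
  shows "(\<exists>u :: 'a \<Rightarrow> real. pos_solution m \<mu> p q \<alpha> u) \<longleftrightarrow>
    (\<mu> < 0 \<and>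
     p > \<alpha> / \<bar>beta_minus m DIM('a) \<mu>\<bar> \<and>
     p + q > m - 1 + (m + \<alpha>) / \<bar>beta_minus m DIM('a) \<mu>\<bar> \<and>
     q > m - 1 - (real DIM('a) - m - \<alpha>) / \<bar>beta_minus m DIM('a) \<mu>\<bar>)"
    (is "?solvable \<longleftrightarrow> \<mu> < 0 \<and> ?exponents")
proof -
  have root: "\<exists>b>0. Kfun m DIM('a) b = - \<mu> \<and> \<bar>beta_minus m DIM('a) \<mu>\<bar> = b" if "\<mu> < 0"
    using Kfun_surj[OF assms(1,2), of "- \<mu>"] beta_minus_eq[OF assms(1,2)] that by fastforce
  show ?thesis
  proof
    assume ?solvable
    then obtain u :: "'a \<Rightarrow> real" and Du where "exterior_solution m u Du \<mu> p q \<alpha>"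
      using pos_solution_imp_exterior_solution[OF assms] by metis
    then interpret exterior_solution m u Du \<mu> p q \<alpha> .
    obtain b where "b > 0" "Kfun m DIM('a) b = - \<mu>" "\<bar>beta_minus m DIM('a) \<mu>\<bar> = b"
      using root[OF \<mu>_neg] by blast
    with \<mu>_neg root_gt necessary_conditions show "\<mu> < 0 \<and> ?exponents"
      by (simp add: exponent_conditions_iff)
  next
    assume conditions: "\<mu> < 0 \<and> ?exponents"
    with root obtain b where root_b: "b > 0" "Kfun m DIM('a) b = - \<mu>" "\<bar>beta_minus m DIM('a) \<mu>\<bar> = b" by blast
    show ?solvable
      by (rule pos_solution_exists[OF assms(1,2,4,5) root_b(1,2)])
        (use conditions exponent_conditions_iff[OF root_b(1)] root_b(3) in auto)
  qed
qed

end
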